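(* Let $p$ be prime and $n\ge2$. Let $S$ be a free profinite group, $N$ a closed normal subgroup of $S$ contained in $S_{(n,p)}$, and $G=S/N$. Then: (a) $T^{\mathbb{U}_{n-1}}(G)=G_{(n,p)}$; (b) $T^{\mathbb{U}_n}(G)=G_{(n+1,p)}$ if and only if the kernel of $\inf\colon H^2(G/G_{(n,p)})_{n\text{-Massey}}\to H^2(G)$ is generated by the elements $\bar\rho^*(\alpha_n)$ (with $\bar\rho\colon G/G_{(n,p)}\to\bar{\mathbb{U}}_n$ continuous) that lie in it.
   Context: For profinite groups $\mathbb{U}$ and $G$, $T^{\mathbb{U}}(G)$ denotes the intersection of the kernels of all continuous homomorphisms $G\to\mathbb{U}$. $\mathbb{U}_n=\mathbb{U}_n(\mathbb{Z}/p)$ is the group of unipotent upper-triangular $(n+1)\times(n+1)$ matrices over $\mathbb{Z}/p$, $\mathbb{Z}/p$ embeds centrally via $r\mapsto I+rE_{1,n+1}$, and $\bar{\mathbb{U}}_n=\mathbb{U}_n/(\mathbb{Z}/p)$, giving a central extension $0\to\mathbb{Z}/p\to\mathbb{U}_n\to\bar{\mathbb{U}}_n\to1$ with class $\alpha_n\in H^2(\bar{\mathbb{U}}_n,\mathbb{Z}/p)$. Cohomology $H^i(\cdot)=H^i(\cdot,\mathbb{Z}/p)$ with trivial action. For a profinite group $\bar G$, $H^2(\bar G)_{n\text{-Massey}}$ is the subgroup generated by all pullbacks $\bar\rho^*(\alpha_n)$ along continuous $\bar\rho\colon\bar G\to\bar{\mathbb{U}}_n$ (the elements of $n$-fold Massey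 products). The $p$-Zassenhaus filtration is defined by $G_{(1,p)}=G$ and $G_{(n,p)}=(G_{(\lceil n/p\rceil,p)})^p\prod_{i+j=n}[G_{(i,p)},G_{(j,p)}]$ for $n\ge2$ (closed subgroups generated). *)

theory Defs
  imports "HOL-Analysis.Analysis" "HOL-Algebra.Algebra"
begin

definition topgroup :: "('a, 'm) monoid_scheme \<Rightarrow> 'a topology \<Rightarrow> bool" where
  "topgroup G T \<longleftrightarrow> group G \<and> topspace T = carrier G
     \<and> continuous_map (prod_topology T T) T (\<lambda>(x, y). x \<otimes>\<^bsub>G\<^esub> y)
     \<and> continuous_map T T (\<lambda>x. inv\<^bsub>G\<^esub> x)"

definition profinite :: "('a, 'm) monoid_scheme \<Rightarrow> 'a topology \<Rightarrow> bool" where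
  "profinite G T \<longleftrightarrow> topgroup G T \<and> compact_space T \<and> Hausdorff_space T
     \<and> (\<forall>x\<in>topspace T. connected_component_of_set T x = {x})"

definition cont_hom_fin :: "('a, 'm) monoid_scheme \<Rightarrow> 'a topology \<Rightarrow> ('b, 'n) monoid_scheme \<Rightarrow> ('a \<Rightarrow> 'b) set" where
  "cont_hom_fin G T H = {h. h \<in> hom G H \<and> continuous_map T (discrete_topology (carrier H)) h}"

text \<open>Free profinite group on a set \<open>B\<close> (basis \<open>emb\<close> converging to 1), via the universal
  property with respect to finite groups (which is equivalent to the one for all profinite groups).\<close>
definition free_profinite :: "('a, 'm) monoid_scheme \<Rightarrow> 'a topology \<Rightarrow> 'b set \<Rightarrow> ('b \<Rightarrow> 'a) \<Rightarrow> bool" where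
  "free_profinite S T B emb \<longleftrightarrow> profinite S T \<and> emb \<in> Pi B (\<lambda>_. carrier S)
     \<and> (\<forall>U. openin T U \<and> one S \<in> U \<longrightarrow> finite {x\<in>B. emb x \<notin> U})
     \<and> (\<forall>(H :: nat monoid) f. group H \<and> finite (carrier H) \<and> f \<in> Pi B (\<lambda>_. carrier H)
          \<and> finite {x\<in>B. f x \<noteq> one H} \<longrightarrow>
          (\<exists>h\<in>cont_hom_fin S T H. (\<forall>x\<in>B. h (emb x) = f x)
             \<and> (\<forall>h'\<in>cont_hom_fin S T H. (\<forall>x\<in>B. h' (emb x) = f x) \<longrightarrow> (\<forall>s\<in>carrier S. h' s = h s))))"

definition quot_top :: "('a, 'm) monoid_scheme \<Rightarrow> 'a topology \<Rightarrow> 'a set \<Rightarrow> 'a set topology" where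
  "quot_top G T N = topology_generated_by {U. U \<subseteq> rcosets\<^bsub>G\<^esub> N \<and> openin T (\<Union>U)}"

definition closed_gen :: "('a, 'm) monoid_scheme \<Rightarrow> 'a topology \<Rightarrow> 'a set \<Rightarrow> 'a set" where
  "closed_gen G T A = \<Inter>{H. subgroup H G \<and> closedin T H \<and> A \<subseteq> H}"

text \<open>One step: level \<open>m\<close> computed from the lower levels \<open>f\<close>; \<open>\<lceil>m/p\<rceil> = (m + p - 1) div p\<close>.\<close>
definition zass_step :: "('a, 'm) monoid_scheme \<Rightarrow> 'a topology \<Rightarrow> nat \<Rightarrow> (nat \<Rightarrow> 'a set) \<Rightarrow> nat \<Rightarrow> 'a set" where
  "zass_step G T p f m = (if m \<le> 1 then carrier G else
     closed_gen G T ({x [^]\<^bsub>G\<^esub> p | x. x \<in> f ((m + p - 1) div p)}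
       \<union> {x \<otimes>\<^bsub>G\<^esub> y \<otimes>\<^bsub>G\<^esub> inv\<^bsub>G\<^esub> x \<otimes>\<^bsub>G\<^esub> inv\<^bsub>G\<^esub> y | x y i j.
             1 \<le> i \<and> 1 \<le> j \<and> i + j = m \<and> x \<in> f i \<and> y \<in> f j}))"

primrec zass_iter :: "('a, 'm) monoid_scheme \<Rightarrow> 'a topology \<Rightarrow> nat \<Rightarrow> nat \<Rightarrow> nat \<Rightarrow> 'a set" where
  "zass_iter G T p 0 = (\<lambda>m. carrier G)"
| "zass_iter G T p (Suc k) = zass_step G T p (zass_iter G T p k)"

text \<open>\<open>zass G T p m = G_(m,p)\<close> (for \<open>m \<ge> 1\<close>); after \<open>m\<close> iterations levels \<open>\<le> m\<close> are correct.\<close>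
definition zass :: "('a, 'm) monoid_scheme \<Rightarrow> 'a topology \<Rightarrow> nat \<Rightarrow> nat \<Rightarrow> 'a set" where
  "zass G T p m = zass_iter G T p m m"

text \<open>\<open>unip p n = U_n(Z/p)\<close>: unipotent upper triangular \<open>(n+1)\<times>(n+1)\<close> matrices, indices \<open>0..n\<close>,
  entries in \<open>{0..<p}\<close>, zero outside the index range.\<close>
definition unip :: "nat \<Rightarrow> nat \<Rightarrow> (nat \<Rightarrow> nat \<Rightarrow> int) monoid" where
  "unip p n = \<lparr> carrier = {A. (\<forall>i j. A i j \<in> {0..<int p})
        \<and> (\<forall>i\<le>n. A i i = 1)
        \<and> (\<forall>i j. (j < i \<or> n < i \<or> n < j) \<longrightarrow> A i j = 0)},
      mult = (\<lambda>A B i j. if i \<le> n \<and> j \<le> n then (\<Sum>k\<le>n. A i k * B k j) mod int p else 0),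
      one = (\<lambda>i j. if i = j \<and> i \<le> n then 1 else 0) \<rparr>"

text \<open>The central copy of \<open>Z/p\<close>: matrices \<open>I + r E_{1,n+1}\<close> (indices \<open>0\<close> and \<open>n\<close> here).\<close>
definition unip_center :: "nat \<Rightarrow> nat \<Rightarrow> (nat \<Rightarrow> nat \<Rightarrow> int) set" where
  "unip_center p n = {A \<in> carrier (unip p n). \<forall>i j. i \<noteq> j \<and> (i, j) \<noteq> (0, n) \<longrightarrow> A i j = 0}"

definition ubar :: "nat \<Rightarrow> nat \<Rightarrow> (nat \<Rightarrow> nat \<Rightarrow> int) set monoid" where
  "ubar p n = unip p n Mod unip_center p n"

text \<open>2-cocycle representing \<open>\<alpha>_n\<close>: for a set-theoretic section \<open>s\<close>,
  \<open>(C,D) \<mapsto> s(C)s(D)s(CD)\<inverse> \<in> Z/p\<close>, read off at entry \<open>(1,n+1)\<close>.\<close>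
definition alpha :: "nat \<Rightarrow> nat \<Rightarrow> (nat \<Rightarrow> nat \<Rightarrow> int) set \<times> (nat \<Rightarrow> nat \<Rightarrow> int) set \<Rightarrow> int" where
  "alpha p n = (\<lambda>(C, D). let s = (\<lambda>E. SOME x. x \<in> E) in
      (s C \<otimes>\<^bsub>unip p n\<^esub> s D \<otimes>\<^bsub>unip p n\<^esub> inv\<^bsub>unip p n\<^esub> (s (C \<otimes>\<^bsub>ubar p n\<^esub> D))) 0 n)"

definition cocycles2 :: "nat \<Rightarrow> ('a, 'm) monoid_scheme \<Rightarrow> 'a topology \<Rightarrow> ('a \<times> 'a \<Rightarrow> int) set" where
  "cocycles2 p K TK = {c. c \<in> PiE (carrier K \<times> carrier K) (\<lambda>_. {0..<int p})
     \<and> continuous_map (prod_topology TK TK) (discrete_topology {0..<int p}) c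
     \<and> (\<forall>x\<in>carrier K. \<forall>y\<in>carrier K. \<forall>z\<in>carrier K.
          (c (y, z) - c (x \<otimes>\<^bsub>K\<^esub> y, z) + c (x, y \<otimes>\<^bsub>K\<^esub> z) - c (x, y)) mod int p = 0)}"

definition coboundaries2 :: "nat \<Rightarrow> ('a, 'm) monoid_scheme \<Rightarrow> 'a topology \<Rightarrow> ('a \<times> 'a \<Rightarrow> int) set" where
  "coboundaries2 p K TK = {restrict (\<lambda>(x, y). (f y - f (x \<otimes>\<^bsub>K\<^esub> y) + f x) mod int p) (carrier K \<times> carrier K)
     | f. f \<in> Pi (carrier K) (\<lambda>_. {0..<int p}) \<and> continuous_map TK (discrete_topology {0..<int p}) f}"

definition Z2grp :: "nat \<Rightarrow> ('a, 'm) monoid_scheme \<Rightarrow> 'a topology \<Rightarrow> ('a \<times> 'a \<Rightarrow> int) monoid" where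
  "Z2grp p K TK = \<lparr> carrier = cocycles2 p K TK,
      mult = (\<lambda>c d. restrict (\<lambda>xy. (c xy + d xy) mod int p) (carrier K \<times> carrier K)),
      one = restrict (\<lambda>xy. 0) (carrier K \<times> carrier K) \<rparr>"

definition H2 :: "nat \<Rightarrow> ('a, 'm) monoid_scheme \<Rightarrow> 'a topology \<Rightarrow> ('a \<times> 'a \<Rightarrow> int) set monoid" where
  "H2 p K TK = Z2grp p K TK Mod coboundaries2 p K TK"

definition cls :: "nat \<Rightarrow> ('a, 'm) monoid_scheme \<Rightarrow> 'a topology \<Rightarrow> ('a \<times> 'a \<Rightarrow> int) \<Rightarrow> ('a \<times> 'a \<Rightarrow> int) set" where
  "cls p K TK c = coboundaries2 p K TK #>\<^bsub>Z2grp p K TK\<^esub> c"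

definition pullc :: "('a, 'm) monoid_scheme \<Rightarrow> ('a \<Rightarrow> 'b) \<Rightarrow> ('b \<times> 'b \<Rightarrow> int) \<Rightarrow> ('a \<times> 'a \<Rightarrow> int)" where
  "pullc K \<rho> c = restrict (\<lambda>(x, y). c (\<rho> x, \<rho> y)) (carrier K \<times> carrier K)"

definition pullH :: "nat \<Rightarrow> ('a, 'm) monoid_scheme \<Rightarrow> 'a topology \<Rightarrow> ('a \<Rightarrow> 'b)
    \<Rightarrow> ('b \<times> 'b \<Rightarrow> int) set \<Rightarrow> ('a \<times> 'a \<Rightarrow> int) set" where
  "pullH p K TK \<pi> C = cls p K TK (pullc K \<pi> (SOME c. c \<in> C))"

definition TU :: "('a, 'm) monoid_scheme \<Rightarrow> 'a topology \<Rightarrow> ('b, 'n) monoid_scheme \<Rightarrow> 'a set" where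
  "TU G TG U = carrier G \<inter> \<Inter>{kernel G U h | h. h \<in> cont_hom_fin G TG U}"

definition massey_kernel_gen :: "nat \<Rightarrow> nat \<Rightarrow> ('a, 'm) monoid_scheme \<Rightarrow> 'a topology \<Rightarrow> bool" where
  "massey_kernel_gen p n G TG \<longleftrightarrow>
    (let Z = zass G TG p n;
         Gb = G Mod Z;
         TGb = quot_top G TG Z;
         \<pi> = (\<lambda>x. Z #>\<^bsub>G\<^esub> x);
         gens = {cls p Gb TGb (pullc Gb \<rho> (alpha p n)) | \<rho>. \<rho> \<in> cont_hom_fin Gb TGb (ubar p n)};
         M = generate (H2 p Gb TGb) gens;
         inf = pullH p G TG \<pi>
     in {x \<in> M. inf x = \<one>\<^bsub>H2 p G TG\<^esub>} = generate (H2 p Gb TGb) {x \<in> gens. inf x = \<one>\<^bsub>H2 p G TG\<^esub>})"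

end

theory Submission
  imports Defs
begin

text \<open>Magnus' theorem \<open>T(S) = S_(m,p)\<close> for the free group is reduced to a finite quotient \<open>P\<close> of \<open>S\<close> with
  \<open>P_(m,p) = 1\<close>. By Jennings' theorem the functions of weighted degree less than \<open>m\<close> separate the points of \<open>P\<close>;
  by freeness such functions have a Taylor expansion along \<open>S\<close> whose coefficients are the Magnus coefficients, that is,
  matrix entries of homomorphisms into unitriangular groups. Hence an element killed by all these homomorphisms is trivial in \<open>P\<close>.

  For the second part, every homomorphism from \<open>S/S_(n,p)\<close> to the quotient of \<open>U_n\<close> by its center lifts to \<open>\<rho>: S \<rightarrow> U_n\<close>,
  and the corresponding Massey element is the transgression of the corner entry of \<open>\<rho>\<close> on \<open>S_(n,p)\<close>. Transgression is injective and
  the inflation of a class to \<open>G\<close> vanishes iff the corresponding homomorphism vanishes on \<open>N\<close>. By Magnus' theorem, applied in degree \<open>n + 1\<close>,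
  both conditions then say by duality in the elementary abelian group \<open>S_(n,p)/S_(n+1,p)\<close> that the common kernel of the corner entries
  vanishing on \<open>N\<close> is \<open>S_(n+1,p) N\<close>.\<close>

section \<open>Jennings' theorem for functions on a finite group\<close>

text \<open>Jennings' theorem is usually stated for ideals of the group ring over Z/p. The dual
  form, with functions killed by all products of differences \<open>h - 1\<close> of large total
  weight, is what Taylor expansion consumes: it needs enough functions to tell points apart. An
  element of P may have weight above 1, whereas the expansion differentiates only along the images
  of the basis, at weight 1. Weighted degree less than m is the condition that works for both: it
  bounds the number of such differences by m - 1, yet there are still enough of these functions to
  separate points. Values in Z/p are represented by integers and equations by divisibility by p.
  Since \<open>alpha\<close> and \<open>pullH\<close> pick representatives with \<open>SOME\<close>,
  transgression is handled as a relation between classes and functions on S_(n,p), valid for every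
  representative. Topology enters the duality argument through compactness: N, or the closed set
  where a functional is nonzero, is covered by finitely many sets on which some homomorphism is
  nontrivial, and this leaves linear algebra over Z/p for finite families of functionals.\<close>

definition fdiff :: "('a, 'm) monoid_scheme \<Rightarrow> 'a \<Rightarrow> ('a \<Rightarrow> int) \<Rightarrow> 'a \<Rightarrow> int" where
  "fdiff G h f x = f (x \<otimes>\<^bsub>G\<^esub> h) - f x"

text \<open>An N_p-series in the sense of Lazard. The indexing starts at 0 with the whole group, so
  that an arbitrary element can be used at weight 0.\<close>

locale np_series = group G for G (structure) +
  fixes p n :: nat and L :: "nat \<Rightarrow> 'a set"
  assumes prime_p: "Factorial_Ring.prime p"
    and fin: "finite (carrier G)"
    and sub_L: "\<And>i. subgroup (L i) G"
    and L0: "L 0 = carrier G" and L1: "L 1 = carrier G"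
    and dec_L: "\<And>i. L (Suc i) \<subseteq> L i"
    and comm_L: "\<And>i j x y. x \<in> L i \<Longrightarrow> y \<in> L j \<Longrightarrow> x \<otimes> y \<otimes> inv x \<otimes> inv y \<in> L (i + j)"
    and pow_L: "\<And>i x. x \<in> L i \<Longrightarrow> x [^] p \<in> L (p * i)"
    and Ln: "L n = {\<one>}"
begin

lemma L_antimono: "i \<le> j \<Longrightarrow> L j \<subseteq> L i"
  by (rule lift_Suc_antimono_le[where f = L, OF dec_L])

lemma L_carr: "x \<in> L i \<Longrightarrow> x \<in> carrier G"
  by (rule subgroup.mem_carrier[OF sub_L])

definition cj :: "'a \<Rightarrow> 'a \<Rightarrow> 'a" where "cj y x = inv y \<otimes> x \<otimes> y"

lemma cj_carr [simp]: "y \<in> carrier G \<Longrightarrow> x \<in> carrier G \<Longrightarrow> cj y x \<in> carrier G"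
  by (simp add: cj_def)

lemma cj_mult: "\<lbrakk>y \<in> carrier G; x \<in> carrier G; z \<in> carrier G\<rbrakk> \<Longrightarrow> cj y (x \<otimes> z) = cj y x \<otimes> cj y z"
  by (simp add: cj_def m_assoc inv_solve_left) (metis inv_closed l_inv l_one m_assoc m_closed r_inv)

definition cm :: "'a \<Rightarrow> 'a \<Rightarrow> 'a" where "cm y x = inv x \<otimes> cj y x"

lemma cm_L: assumes "x \<in> L j" "y \<in> L i" shows "cm y x \<in> L (i + j)"
proof -
  have "inv x \<in> L j" "inv y \<in> L i" using assms sub_L by (simp_all add: subgroup.m_inv_closed)
  from comm_L[OF this] show ?thesis
    using assms L_carr[OF assms(1)] L_carr[OF assms(2)]
    by (simp add: cm_def cj_def m_assoc add.commute)
qed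

lemma cj_cm: "\<lbrakk>y \<in> carrier G; x \<in> carrier G\<rbrakk> \<Longrightarrow> cj y x = x \<otimes> cm y x"
  by (simp add: cm_def cj_def m_assoc[symmetric])

lemma cj_L: assumes "x \<in> L j" "y \<in> carrier G" shows "cj y x \<in> L j"
  using cm_L[of x j y 0] assms cj_cm[of y x] L_carr[OF assms(1)] L0 sub_L[of j]
  by (simp add: subgroup.m_closed)

text \<open>The weight is a tag and not a function of the element: \<open>h\<close> may be used with
  any \<open>i\<close> such that \<open>h \<in> L i\<close>. The increments stay in the subgroup
  \<open>Q\<close> on which the functions live, but their weights refer to the filtration of the
  whole group.\<close>

definition wl :: "'a set \<Rightarrow> ('a \<times> nat) list set" where
  "wl Q = {hs. \<forall>(h, i) \<in> set hs. h \<in> Q \<and> h \<in> L i}"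

text \<open>This is the action, through right translation, of the product of the group ring elements
  \<open>h - 1\<close>. The functions in \<open>Fl\<close> are those annihilated by all such
  products of weight at least \<open>m\<close>.\<close>

definition Dl :: "('a \<times> nat) list \<Rightarrow> ('a \<Rightarrow> int) \<Rightarrow> 'a \<Rightarrow> int" where
  "Dl hs f = foldr (\<lambda>(h, i). fdiff G h) hs f"

definition wt :: "('a \<times> nat) list \<Rightarrow> int" where
  "wt hs = (\<Sum>(h, i)\<leftarrow>hs. int i)"

text \<open>Functions on \<open>Q\<close> modulo \<open>p\<close> of weighted degree less than \<open>m\<close>.\<close>
definition Fl :: "'a set \<Rightarrow> int \<Rightarrow> ('a \<Rightarrow> int) set" where
  "Fl Q m = {f. \<forall>hs \<in> wl Q. m \<le> wt hs \<longrightarrow> (\<forall>x\<in>Q. int p dvd Dl hs f x)}"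

lemma FlI: "(\<And>hs x. hs \<in> wl Q \<Longrightarrow> m \<le> wt hs \<Longrightarrow> x \<in> Q \<Longrightarrow> int p dvd Dl hs f x) \<Longrightarrow> f \<in> Fl Q m"
  by (simp add: Fl_def)

lemma FlD: "f \<in> Fl Q m \<Longrightarrow> hs \<in> wl Q \<Longrightarrow> m \<le> wt hs \<Longrightarrow> x \<in> Q \<Longrightarrow> int p dvd Dl hs f x"
  by (simp add: Fl_def)

lemma wl_simps [simp]: "[] \<in> wl Q" "(y, i) # hs \<in> wl Q \<longleftrightarrow> y \<in> Q \<and> y \<in> L i \<and> hs \<in> wl Q"
  "hs @ hs' \<in> wl Q \<longleftrightarrow> hs \<in> wl Q \<and> hs' \<in> wl Q"
  by (auto simp: wl_def)

lemma wt_simps [simp]: "wt [] = 0" "wt ((y, i) # hs) = int i + wt hs" "wt (hs @ hs') = wt hs + wt hs'"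
  by (auto simp: wt_def)

lemma Dl_simps [simp]: "Dl [] f = f" "Dl ((y, i) # hs) f = fdiff G y (Dl hs f)"
  "Dl (hs @ hs') f = Dl hs (Dl hs' f)"
  by (auto simp: Dl_def)

lemma Dl_add: "Dl hs (\<lambda>x. f x + g x) = (\<lambda>x. Dl hs f x + Dl hs g x)"
proof (induction hs)
  case (Cons a hs) then show ?case by (cases a) (auto simp: fdiff_def fun_eq_iff)
qed auto

lemma Dl_diff: "Dl hs (\<lambda>x. f x - g x) = (\<lambda>x. Dl hs f x - Dl hs g x)"
proof (induction hs)
  case (Cons a hs) then show ?case by (cases a) (auto simp: fdiff_def fun_eq_iff)
qed auto

text \<open>Iterated differences at a point of \<open>Q\<close> with increments in \<open>Q\<close>
  read only values on \<open>Q\<close>. Hence an integer function on the whole type can stand for a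
  function from \<open>Q\<close> to Z/p.\<close>

lemma Dl_cong:
  assumes "subgroup Q G" "hs \<in> wl Q" "\<And>x. x \<in> Q \<Longrightarrow> int p dvd f x - g x" "x \<in> Q"
  shows "int p dvd Dl hs f x - Dl hs g x"
  using assms(2,4)
proof (induction hs arbitrary: x)
  case (Cons a hs)
  obtain y i where a: "a = (y, i)" by fastforce
  have "y \<in> Q" "hs \<in> wl Q" using Cons a by auto
  then have "int p dvd Dl hs f (x \<otimes> y) - Dl hs g (x \<otimes> y)" "int p dvd Dl hs f x - Dl hs g x"
    using Cons assms(1) by (auto simp: subgroup.m_closed)
  from dvd_diff[OF this] show ?case by (simp add: a fdiff_def algebra_simps)
qed (use assms in auto)

lemma Fl_add: "f \<in> Fl Q m \<Longrightarrow> g \<in> Fl Q m \<Longrightarrow> (\<lambda>x. f x + g x) \<in> Fl Q m"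
  by (simp add: Fl_def Dl_add)

lemma Fl_mono: "m \<le> m' \<Longrightarrow> Fl Q m \<subseteq> Fl Q m'"
  by (force simp add: Fl_def)

lemma Fl_fdiff: assumes "f \<in> Fl Q m" "y \<in> Q" "y \<in> L i" shows "fdiff G y f \<in> Fl Q (m - int i)"
proof (rule FlI)
  fix hs x assume "hs \<in> wl Q" "m - int i \<le> wt hs" "x \<in> Q"
  then show "int p dvd Dl hs (fdiff G y f) x" using FlD[OF assms(1), of "hs @ [(y, i)]" x] assms by simp
qed

text \<open>The empty list has weight 0, so for \<open>m \<le> 0\<close> the values themselves are
  among the differences that must vanish.\<close>

lemma Fl_nonpos: "f \<in> Fl Q m \<Longrightarrow> m \<le> 0 \<Longrightarrow> x \<in> Q \<Longrightarrow> int p dvd f x"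
  using FlD[of f Q m "[]" x] by simp

lemma Dl_left:
  assumes "subgroup Q G" "hs \<in> wl Q" "x \<in> Q" "y \<in> Q"
  shows "Dl hs (\<lambda>z. f (y \<otimes> z) - f z) x = Dl hs f (y \<otimes> x) - Dl hs f x"
  using assms(2,3)
proof (induction hs arbitrary: x)
  case (Cons a hs)
  obtain h i where a: "a = (h, i)" by fastforce
  have "h \<in> Q" "hs \<in> wl Q" using Cons a by auto
  then show ?case using Cons assms(1,4)
    by (simp add: a fdiff_def subgroup.m_closed m_assoc subgroup.mem_carrier)
qed auto

text \<open>Left differences are right differences by a conjugate.\<close>
lemma Fl_left:
  assumes Q: "subgroup Q G" and "f \<in> Fl Q m" "y \<in> Q" "y \<in> L i"
  shows "(\<lambda>z. f (y \<otimes> z) - f z) \<in> Fl Q (m - int i)"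
proof (rule FlI)
  fix hs x assume *: "hs \<in> wl Q" "m - int i \<le> wt hs" "x \<in> Q"
  have xc: "x \<in> carrier G" "y \<in> carrier G" using * assms by (auto simp: subgroup.mem_carrier)
  have "cj x y \<in> Q" unfolding cj_def using * assms by (simp add: subgroup.m_closed subgroup.m_inv_closed)
  moreover have "cj x y \<in> L i" using cj_L xc assms by auto
  ultimately have "int p dvd Dl ((cj x y, i) # hs) f x"
    using * by (intro FlD[OF assms(2)]) auto
  moreover have "x \<otimes> cj x y = y \<otimes> x" using xc by (simp add: cj_def m_assoc[symmetric])
  ultimately show "int p dvd Dl hs (\<lambda>z. f (y \<otimes> z) - f z) x"
    using Dl_left[OF Q *(1,3) assms(3)] by (simp add: fdiff_def)
qed

definition mapc :: "'a \<Rightarrow> ('a \<times> nat) list \<Rightarrow> ('a \<times> nat) list" where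
  "mapc y hs = map (\<lambda>(h, i). (cj y h, i)) hs"

lemma wt_mapc: "wt (mapc y hs) = wt hs"
  by (induction hs) (auto simp: mapc_def)

lemma wl_mapc: "\<lbrakk>y \<in> carrier G; \<And>x. x \<in> Q \<Longrightarrow> cj y x \<in> Q; hs \<in> wl Q\<rbrakk> \<Longrightarrow> mapc y hs \<in> wl Q"
  by (auto simp: wl_def mapc_def cj_L)

lemma Dl_cj:
  assumes "y \<in> carrier G" "subgroup Q G" "hs \<in> wl Q" "x \<in> Q"
  shows "Dl hs (\<lambda>x. f (cj y x)) x = Dl (mapc y hs) f (cj y x)"
  using assms(3,4)
proof (induction hs arbitrary: x)
  case (Cons a hs)
  obtain h i where a: "a = (h, i)" by fastforce
  have "h \<in> Q" "hs \<in> wl Q" using Cons a by auto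
  then show ?case using Cons assms(1,2)
    by (simp add: a fdiff_def subgroup.m_closed cj_mult subgroup.mem_carrier mapc_def)
qed (auto simp: mapc_def)

lemma Fl_cj:
  assumes "y \<in> carrier G" "subgroup Q G" "\<And>x. x \<in> Q \<Longrightarrow> cj y x \<in> Q" "f \<in> Fl Q m"
  shows "(\<lambda>x. f (cj y x)) \<in> Fl Q m"
  using assms by (intro FlI) (auto simp: Dl_cj wt_mapc wl_mapc FlD)

lemma fdiff_mult:
  "\<lbrakk>x \<in> carrier G; h \<in> carrier G; k \<in> carrier G\<rbrakk> \<Longrightarrow>
   fdiff G (h \<otimes> k) f x = fdiff G h f x + fdiff G k f x + fdiff G h (fdiff G k f) x"
  by (simp add: fdiff_def m_assoc)

text \<open>Conjugation moves \<open>x\<close> to \<open>x \<otimes> cm y x\<close>, where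
  \<open>cm y x \<in> L i\<close>, which explains the loss of \<open>i\<close>. The increment
  depends on the point, however, so this is no single difference operator. For an increment
  \<open>h\<close> of weight \<open>j\<close> one has \<open>cj y h = h \<otimes> k\<close> with
  \<open>k = cm y h\<close> of weight \<open>i + j\<close>; the terms that contain
  \<open>fdiff G k\<close> have lost enough, and the remaining one is the same problem for
  \<open>fdiff G h f\<close>.\<close>

lemma Fl_cj_diff:
  assumes y: "y \<in> L i" and Q: "subgroup Q G" and inv: "\<And>x. x \<in> Q \<Longrightarrow> cj y x \<in> Q" and f: "f \<in> Fl Q m"
  shows "(\<lambda>x. f (cj y x) - f x) \<in> Fl Q (m - int i)"
proof (rule FlI)
  have yc: "y \<in> carrier G" using y by (rule L_carr)
  have Qc: "z \<in> carrier G" if "z \<in> Q" for z using that Q subgroup.mem_carrier by metis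
  have cmQ: "cm y z \<in> Q" if "z \<in> Q" for z
    using that inv Q by (simp add: cm_def subgroup.m_closed subgroup.m_inv_closed)
  fix hs x assume "hs \<in> wl Q" "m - int i \<le> wt hs" "x \<in> Q"
  then show "int p dvd Dl hs (\<lambda>x. f (cj y x) - f x) x"
    using f
  \<comment> \<open>The innermost operator, the last of the list, is peeled off, so the function and
    its degree change in the induction.\<close>
  proof (induction hs arbitrary: f m x rule: rev_induct)
    case Nil
    \<comment> \<open>The bound has become \<open>m \<le> i\<close>, so one difference of weight
      \<open>i\<close> vanishes already, and at a fixed point its increment may depend on
      \<open>x\<close>.\<close>
    have "int p dvd Dl [(cm y x, i)] f x"
      using Nil cmQ cm_L[of x 0 y i] y L0 Qc by (intro FlD[OF Nil(4)]) auto
    then show ?case using Nil yc Qc by (simp add: fdiff_def cj_cm)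
  next
    case (snoc a hs)
    obtain h j where a: "a = (h, j)" by fastforce
    have h: "h \<in> Q" "h \<in> L j" "hs \<in> wl Q" using snoc a by auto
    define k where "k = cm y h"
    have k: "k \<in> Q" "k \<in> L (i + j)" unfolding k_def using cmQ cm_L h y by auto
    define r where "r = (\<lambda>z. fdiff G k f z + fdiff G h (fdiff G k f) z)"
    have "fdiff G k f \<in> Fl Q (m - int (i + j))" by (rule Fl_fdiff[OF snoc.prems(4) k])
    moreover from Fl_fdiff[OF this h(1,2)] have "fdiff G h (fdiff G k f) \<in> Fl Q (m - int (i + j))"
      using Fl_mono[of "m - int (i + j) - int j" "m - int (i + j)"] by auto
    ultimately have r: "r \<in> Fl Q (m - int (i + j))" unfolding r_def by (rule Fl_add)
    then have rc: "(\<lambda>z. r (cj y z)) \<in> Fl Q (m - int (i + j))" using Fl_cj yc Q inv by auto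
    have eq: "fdiff G h (\<lambda>x. f (cj y x) - f x) z
         = (fdiff G h f (cj y z) - fdiff G h f z) + r (cj y z)" if z: "z \<in> Q" for z
    proof -
      have "f (cj y (z \<otimes> h)) - f (cj y z) = fdiff G (h \<otimes> k) f (cj y z)"
        using z h Qc yc unfolding fdiff_def k_def by (simp add: cj_mult flip: cj_cm)
      also have "\<dots> = fdiff G h f (cj y z) + r (cj y z)"
        using z h k Qc inv by (simp add: fdiff_mult r_def)
      finally show ?thesis by (simp add: fdiff_def)
    qed
    have "int p dvd Dl hs (\<lambda>z. (fdiff G h f (cj y z) - fdiff G h f z)) x"
      using snoc.prems a Fl_fdiff[OF snoc.prems(4) h(1,2)] by (intro snoc.IH[of "m - int j"]) auto
    moreover have "int p dvd Dl hs (\<lambda>z. r (cj y z)) x"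
      using snoc.prems a by (intro FlD[OF rc]) auto
    moreover have "int p dvd Dl hs (fdiff G h (\<lambda>x. f (cj y x) - f x)) x
       - Dl hs (\<lambda>z. (fdiff G h f (cj y z) - fdiff G h f z) + r (cj y z)) x"
      using snoc.prems h eq by (intro Dl_cong[OF Q]) auto
    ultimately show ?case by (simp add: a Dl_add) (metis diff_add_cancel dvd_add)
  qed
qed

end


section \<open>Adjoining one element: from functions on \<open>R\<close> to functions on a group of
  order p over \<open>R\<close>\<close>

locale np_step = np_series +
  fixes R :: "'a set" and w :: nat and g :: 'a
  assumes R: "subgroup R G" and R_low: "L (Suc w) \<subseteq> R" and R_up: "R \<subseteq> L w"
    and g: "g \<in> L w" and gR: "g \<notin> R" and w: "1 \<le> w"
begin

lemma p2: "2 \<le> p" using prime_p by (rule prime_ge_2_nat)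

lemma gc [simp]: "g \<in> carrier G" using g by (rule L_carr)

lemma Rc: "x \<in> R \<Longrightarrow> x \<in> carrier G" by (rule subgroup.mem_carrier[OF R])

lemmas R_mult = subgroup.m_closed[OF R] and R_inv = subgroup.m_inv_closed[OF R]
  and R_one = subgroup.one_closed[OF R]

text \<open>Any subgroup between consecutive terms is normal, because a commutator with an element
  of \<open>L 1\<close>, the whole group, gains one unit of weight.\<close>

lemma R_cj: assumes "x \<in> R" "y \<in> carrier G" shows "cj y x \<in> R"
proof -
  have "cm y x \<in> L (1 + w)" using assms R_up L1 by (intro cm_L) auto
  then have "cm y x \<in> R" using R_low by auto
  then show ?thesis using assms by (simp add: cj_cm Rc R_mult)
qed

text \<open>This is where \<open>1 \<le> w\<close> matters: it gives
  \<open>Suc w \<le> p * w\<close>, so the p-th power already falls into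
  \<open>L (Suc w) \<subseteq> R\<close>.\<close>

lemma gpR: "g [^] p \<in> R"
proof -
  have "Suc w \<le> p * w" using p2 w mult_le_mono1[of 2 p w] by linarith
  then show ?thesis using pow_L[OF g] L_antimono R_low by blast
qed

lemma R_pow: "x \<in> R \<Longrightarrow> x [^] (k::nat) \<in> R"
  by (induction k) (simp_all add: R_one R_mult)

definition Q where "Q = {g [^] e \<otimes> h | e h. e < p \<and> h \<in> R}"

lemma Q_pow: assumes "h \<in> R" shows "g [^] (e::nat) \<otimes> h \<in> Q"
proof -
  have "g [^] e = g [^] (e mod p + p * (e div p))" by simp
  also have "\<dots> = g [^] (e mod p) \<otimes> (g [^] p) [^] (e div p)"
    by (simp add: nat_pow_mult nat_pow_pow)
  finally have "g [^] e \<otimes> h = g [^] (e mod p) \<otimes> ((g [^] p) [^] (e div p) \<otimes> h)"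
    using assms by (simp add: m_assoc Rc)
  moreover have "(g [^] p) [^] (e div p) \<otimes> h \<in> R" using gpR assms R_pow R_mult by simp
  moreover have "e mod p < p" using p2 by simp
  ultimately show ?thesis unfolding Q_def by blast
qed

lemma swap: "x \<in> carrier G \<Longrightarrow> y \<in> carrier G \<Longrightarrow> x \<otimes> y = y \<otimes> cj y x"
  by (simp add: cj_def m_assoc[symmetric])

lemma Q_sub: "subgroup Q G"
proof (rule subgroupI)
  show "Q \<subseteq> carrier G" unfolding Q_def using Rc by auto
  show "Q \<noteq> {}" using Q_pow R_one by blast
next
  fix a b assume "a \<in> Q" "b \<in> Q"
  then obtain e e' :: nat and h h' where a: "a = g [^] e \<otimes> h" "h \<in> R" and b: "b = g [^] e' \<otimes> h'" "h' \<in> R"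
    unfolding Q_def by blast
  have "a \<otimes> b = g [^] e \<otimes> (h \<otimes> g [^] e') \<otimes> h'" using a b Rc by (simp add: m_assoc)
  also have "\<dots> = g [^] (e + e') \<otimes> (cj (g [^] e') h \<otimes> h')"
    using a b Rc swap[of h "g [^] e'"] by (simp add: m_assoc nat_pow_mult[symmetric])
  finally show "a \<otimes> b \<in> Q" using Q_pow R_mult R_cj a b by simp
next
  fix a assume "a \<in> Q"
  then obtain e :: nat and h where a: "a = g [^] e \<otimes> h" "h \<in> R" "e < p"
    unfolding Q_def by blast
  have "g [^] e \<otimes> g [^] (p - e) = g [^] p" using a by (simp add: nat_pow_mult)
  then have "inv (g [^] e) = g [^] (p - e) \<otimes> inv (g [^] p)"
    by (metis gc inv_closed inv_solve_right inv_solve_left m_assoc m_closed nat_pow_closed r_one r_inv)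
  then have "inv a = (inv h \<otimes> g [^] (p - e)) \<otimes> inv (g [^] p)"
    using a Rc by (simp add: inv_mult_group m_assoc)
  also have "\<dots> = g [^] (p - e) \<otimes> (cj (g [^] (p - e)) (inv h) \<otimes> inv (g [^] p))"
    using a Rc swap[of "inv h" "g [^] (p - e)"] by (simp add: m_assoc)
  finally show "inv a \<in> Q" using Q_pow R_mult R_cj R_inv gpR a by simp
qed

lemma g_Q: "g \<in> Q" using Q_pow[OF R_one, of 1] by simp

lemma R_Q: "h \<in> R \<Longrightarrow> h \<in> Q" using Q_pow[of h 0] Rc by simp

text \<open>A nonzero exponent below p is invertible modulo p, so \<open>g\<close> would be a
  product of powers of \<open>g [^] e\<close> and \<open>g [^] p\<close>, both in
  \<open>R\<close>.\<close>

lemma g_pow_R: assumes "g [^] (e::nat) \<in> R" "e < p" shows "e = 0"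
proof (rule ccontr)
  assume "e \<noteq> 0"
  then have "coprime e p" using assms prime_p
    by (metis coprime_commute nat_dvd_not_less not_gr_zero prime_imp_coprime)
  then obtain u v where uv: "u * int e + v * int p = 1"
    using bezout_int[of "int e" "int p"] by (metis coprime_imp_gcd_eq_1 coprime_int_iff)
  have "g = g [^] (u * int e + v * int p)" by (simp add: uv)
  also have "\<dots> = (g [^] e) [^] u \<otimes> (g [^] p) [^] v"
    by (simp add: int_pow_mult int_pow_pow mult.commute flip: int_pow_int)
  also have "\<dots> \<in> R" using assms(1) gpR R by (simp add: R_mult subgroup_int_pow_closed)
  finally show False using gR by simp
qed

definition ee where "ee x = (THE e. e < p \<and> inv (g [^] e) \<otimes> x \<in> R)"
definition hh where "hh x = inv (g [^] ee x) \<otimes> x"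

lemma ee: assumes "e < p" "h \<in> R" shows "ee (g [^] e \<otimes> h) = e"
  unfolding ee_def
proof (rule the_equality)
  show "e < p \<and> inv (g [^] e) \<otimes> (g [^] e \<otimes> h) \<in> R"
    using assms Rc by (simp add: m_assoc[symmetric])
next
  fix d assume d: "d < p \<and> inv (g [^] d) \<otimes> (g [^] e \<otimes> h) \<in> R"
  have "(inv (g [^] d) \<otimes> g [^] e) \<otimes> h \<in> R" using d assms Rc by (simp add: m_assoc)
  then have "(inv (g [^] d) \<otimes> g [^] e) \<otimes> h \<otimes> inv h \<in> R" using assms R_mult R_inv by blast
  then have *: "inv (g [^] d) \<otimes> g [^] e \<in> R" using assms Rc by (simp add: m_assoc)
  show "d = e"
  proof (cases "d \<le> e")
    case True
    then have "g [^] e = g [^] d \<otimes> g [^] (e - d)" by (simp add: nat_pow_mult)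
    then have "g [^] (e - d) \<in> R" using * by (simp add: m_assoc[symmetric])
    moreover have "e - d < p" using assms by simp
    ultimately have "e - d = 0" by (rule g_pow_R)
    then show ?thesis using True by simp
  next
    case False
    have "inv (inv (g [^] d) \<otimes> g [^] e) \<in> R" using * by (rule R_inv)
    moreover have "g [^] d = g [^] e \<otimes> g [^] (d - e)" using False by (simp add: nat_pow_mult)
    ultimately have "g [^] (d - e) \<in> R" by (simp add: m_assoc[symmetric] inv_mult_group)
    moreover have "d - e < p" using d by auto
    ultimately have "d - e = 0" by (rule g_pow_R)
    then show ?thesis using False by simp
  qed
qed

lemma hh: assumes "e < p" "h \<in> R" shows "hh (g [^] e \<otimes> h) = h"
  using assms Rc by (simp add: hh_def ee m_assoc[symmetric])

text \<open>Binomial coefficients in the exponent of \<open>g\<close> are the discrete analogue of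
  divided powers: by Pascal's rule a step along \<open>g\<close> lowers \<open>k\<close> by one.
  With functions on \<open>R\<close> as second factor they form the dual of Jennings' basis.\<close>

definition u :: "nat \<Rightarrow> ('a \<Rightarrow> int) \<Rightarrow> 'a \<Rightarrow> int" where
  "u k f x = int (ee x choose k) * f (hh x)"

lemma u_eq: "e < p \<Longrightarrow> h \<in> R \<Longrightarrow> u k f (g [^] e \<otimes> h) = int (e choose k) * f h"
  by (simp add: u_def ee hh)

text \<open>The span of the products in which the binomial factor counts with weight
  \<open>k * w\<close>. The rule \<open>congr\<close> makes membership depend only on residues on
  \<open>Q\<close>. The aim is stability under differences, which yields
  \<open>V_Fl\<close>.\<close>

inductive V :: "int \<Rightarrow> ('a \<Rightarrow> int) \<Rightarrow> bool" where
  base: "k < p \<Longrightarrow> f \<in> Fl R (m - int (k * w)) \<Longrightarrow> V m (u k f)"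
| addr: "V m F \<Longrightarrow> V m F' \<Longrightarrow> V m (\<lambda>x. F x + F' x)"
| congr: "V m F \<Longrightarrow> (\<And>x. x \<in> Q \<Longrightarrow> int p dvd F x - F' x) \<Longrightarrow> V m F'"

lemma V_mono: "V m F \<Longrightarrow> m \<le> m' \<Longrightarrow> V m' F"
proof (induction rule: V.induct)
  case (base k f m)
  then show ?case using Fl_mono[of "m - int (k * w)" "m' - int (k * w)"] by (intro V.base) auto
qed (auto intro: V.addr V.congr)

lemma V_nonpos: "V m F \<Longrightarrow> m \<le> 0 \<Longrightarrow> x \<in> Q \<Longrightarrow> int p dvd F x"
proof (induction rule: V.induct)
  case (base k f m)
  obtain e h where "x = g [^] e \<otimes> h" "e < p" "h \<in> R" using base unfolding Q_def by blast
  moreover have "int p dvd f h"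
    by (rule Fl_nonpos[OF base(2) _ \<open>h \<in> R\<close>]) (use base(3) in \<open>simp add: order_trans[of m 0]\<close>)
  ultimately show ?case by (simp add: u_eq)
next
  case (congr m F F')
  then have "int p dvd F x" "int p dvd F x - F' x" by auto
  from dvd_diff[OF this] show ?case by simp
qed auto

text \<open>Right multiplication by an element of \<open>R\<close> leaves the exponent of
  \<open>g\<close> alone and acts on the second coordinate only, because the powers of
  \<open>g\<close> stand on the left.\<close>

lemma V_fdiff_R: assumes "V m F" "y \<in> R" "y \<in> L i" shows "V (m - int i) (fdiff G y F)"
  using assms(1)
proof (induction rule: V.induct)
  case (base k f m)
  have "fdiff G y f \<in> Fl R (m - int (k * w) - int i)" using Fl_fdiff base assms by auto
  then have "V (m - int i) (u k (fdiff G y f))" using base by (intro V.base) (auto simp: algebra_simps)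
  then show ?case
  proof (rule V.congr)
    fix x assume "x \<in> Q"
    then obtain e h where x: "x = g [^] e \<otimes> h" "e < p" "h \<in> R" unfolding Q_def by blast
    then have "x \<otimes> y = g [^] e \<otimes> (h \<otimes> y)" "h \<otimes> y \<in> R" using assms Rc by (auto simp: m_assoc R_mult)
    then show "int p dvd u k (fdiff G y f) x - fdiff G y (u k f) x"
      using x by (simp add: fdiff_def u_eq algebra_simps)
  qed
next
  case (addr m F F')
  then show ?case by (intro V.congr[OF V.addr[OF addr(3,4)]]) (simp add: fdiff_def)
next
  case (congr m F F')
  show ?case
  proof (rule V.congr[OF congr(3)])
    fix x assume "x \<in> Q"
    then have "int p dvd F x - F' x" "int p dvd F (x \<otimes> y) - F' (x \<otimes> y)"
      using congr assms R_Q Q_sub by (auto simp: subgroup.m_closed)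
    from dvd_diff[OF this(2,1)] show "int p dvd fdiff G y F x - fdiff G y F' x"
      by (simp add: fdiff_def algebra_simps)
  qed
qed

lemma p_dvd_choose: "1 \<le> k \<Longrightarrow> k < p \<Longrightarrow> int p dvd int (p choose k)"
  using prime_p dvd_choose_prime[of k p] p2 by simp

text \<open>The carry \<open>g\<^sup>p \<in> R\<close> only matters for \<open>k = 0\<close>, where it is a left difference of weight \<open>p w\<close>.\<close>
lemma V_fdiff_g: assumes "V m F" shows "V (m - int w) (fdiff G g F)"
  using assms
proof (induction rule: V.induct)
  case (base k f m)
  let ?c = "\<lambda>x. f (cj g x)"
  \<comment> \<open>The three sources of change in a step along \<open>g\<close>: \<open>A\<close>
    is the drop from \<open>k\<close> to \<open>k - 1\<close> by Pascal's rule, \<open>D\<close>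
    comes from moving the second coordinate past \<open>g\<close>, and \<open>E\<close> corrects the
    carry. For exponents below p the coefficient \<open>e choose (p - 1)\<close> is 1 at
    \<open>e = p - 1\<close> and 0 elsewhere, so \<open>E\<close> is concentrated where the carry
    happens.\<close>
  define A where "A = (\<lambda>x. if k = 0 then 0 else u (k - 1) ?c x)"
  define D where "D = u k (\<lambda>x. f (cj g x) - f x)"
  define f' where "f' = (\<lambda>z. f (g [^] p \<otimes> z) - f z)"
  define E where "E = (\<lambda>x. if k = 0 then u (p - 1) (\<lambda>x. f' (cj g x)) x else 0)"
  have c: "?c \<in> Fl R (m - int (k * w))" using base R R_cj by (intro Fl_cj) auto
  have zero: "V l (\<lambda>x. 0)" for l
  proof -
    have "Dl hs (\<lambda>x. 0) = (\<lambda>x. 0)" for hs using Dl_diff[of hs f f] by simp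
    then have "(\<lambda>x. 0) \<in> Fl R (l - int (0 * w))" by (intro FlI) simp
    then have "V l (u 0 (\<lambda>x. 0))" using p2 by (intro V.base) auto
    then show ?thesis by (simp add: u_def[abs_def])
  qed
  have A: "V (m - int w) A"
  proof (cases "k = 0")
    case False
    then have "int (k * w) = int w + int ((k - 1) * w)" by (cases k) auto
    then show ?thesis using base False c unfolding A_def by (simp, intro V.base) (auto simp: algebra_simps)
  qed (simp add: A_def zero)
  have "(\<lambda>x. f (cj g x) - f x) \<in> Fl R (m - int (k * w) - int w)"
    using g R R_cj base by (intro Fl_cj_diff) auto
  then have D: "V (m - int w) D" unfolding D_def using base
    by (intro V.base) (auto simp: algebra_simps)
  have E: "V (m - int w) E"
  proof (cases "k = 0")
    case True
    then have "f \<in> Fl R m" using base by simp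
    then have "f' \<in> Fl R (m - int (p * w))"
      unfolding f'_def using R gpR pow_L[OF g] by (intro Fl_left) auto
    then have "(\<lambda>x. f' (cj g x)) \<in> Fl R (m - int (p * w))" using R R_cj by (intro Fl_cj) auto
    \<comment> \<open>The carry costs weight \<open>p * w\<close>, and this is exactly what is
      available: \<open>w\<close> from the step itself and \<open>(p - 1) * w\<close> from the
      binomial factor of \<open>E\<close>.\<close>
    moreover have "m - int (p * w) = m - int w - int ((p - 1) * w)"
      using p2 by (cases p) (simp_all add: algebra_simps)
    ultimately have "(\<lambda>x. f' (cj g x)) \<in> Fl R (m - int w - int ((p - 1) * w))"
      by (simp only:)
    then have "V (m - int w) (u (p - 1) (\<lambda>x. f' (cj g x)))" using p2 by (intro V.base) simp_all
    moreover have "E = u (p - 1) (\<lambda>x. f' (cj g x))" using True by (simp add: E_def)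
    ultimately show ?thesis by simp
  qed (simp add: E_def zero)
  have "V (m - int w) (\<lambda>x. A x + D x + E x)" using A D E by (intro V.addr)
  then show ?case
  proof (rule V.congr)
    fix x assume "x \<in> Q"
    then obtain e h where x: "x = g [^] e \<otimes> h" "e < p" "h \<in> R" unfolding Q_def by blast
    have ch: "cj g h \<in> R" using x R_cj by auto
    have xg: "x \<otimes> g = g [^] (Suc e) \<otimes> cj g h"
      using x Rc swap[of h g] by (simp add: m_assoc)
    have pascal: "A x + D x = int (Suc e choose k) * f (cj g h) - int (e choose k) * f h"
      using x by (cases k) (auto simp: A_def D_def u_eq algebra_simps)
    show "int p dvd A x + D x + E x - fdiff G g (u k f) x"
    proof (cases "Suc e < p")
      case True
      then have "E x = 0" using x by (simp add: E_def u_eq binomial_eq_0)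
      moreover have "fdiff G g (u k f) x = int (Suc e choose k) * f (cj g h) - int (e choose k) * f h"
        unfolding fdiff_def xg u_eq[OF True ch] using x by (simp add: u_eq)
      ultimately show ?thesis using pascal by simp
    next
      case False
      then have e: "Suc e = p" using x by simp
      have "x \<otimes> g = g [^] (0::nat) \<otimes> (g [^] p \<otimes> cj g h)" using xg e Rc ch gpR by simp
      then have "u k f (x \<otimes> g) = int (0 choose k) * f (g [^] p \<otimes> cj g h)"
        using u_eq[of 0 "g [^] p \<otimes> cj g h" k f] p2 ch gpR R_mult by simp
      then have fd: "fdiff G g (u k f) x = int (0 choose k) * f (g [^] p \<otimes> cj g h) - int (e choose k) * f h"
        using x by (simp add: fdiff_def u_eq)
      show ?thesis
      proof (cases "k = 0")
        case True
        have "E x = f (g [^] p \<otimes> cj g h) - f (cj g h)"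
        proof -
          have "p - 1 = e" using e by simp
          then show ?thesis unfolding E_def x(1) u_eq[OF x(2,3)] using True by (simp add: f'_def)
        qed
        then show ?thesis using pascal fd True by simp
      next
        case False
        \<comment> \<open>For \<open>k > 0\<close> the carry resets the binomial factor to 0, while
          Pascal's rule predicts \<open>p choose k\<close>. Modulo p these agree.\<close>
        then have "A x + D x + E x - fdiff G g (u k f) x = int (p choose k) * f (cj g h)"
          using pascal fd e by (simp add: E_def)
        then show ?thesis using p_dvd_choose[of k] False base by simp
      qed
    qed
  qed
next
  case (addr m F F')
  then show ?case by (intro V.congr[OF V.addr[OF addr(3,4)]]) (simp add: fdiff_def)
next
  case (congr m F F')
  show ?case
  proof (rule V.congr[OF congr(3)])
    fix x assume "x \<in> Q"
    then have "int p dvd F x - F' x" "int p dvd F (x \<otimes> g) - F' (x \<otimes> g)"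
      using congr g_Q Q_sub by (auto simp: subgroup.m_closed)
    from dvd_diff[OF this(2,1)] show "int p dvd fdiff G g F x - fdiff G g F' x"
      by (simp add: fdiff_def algebra_simps)
  qed
qed

text \<open>In the product rule \<open>fdiff_mult\<close> the mixed term has lost \<open>i\<close>
  twice and therefore satisfies a stronger bound.\<close>

lemma V_fdiff_mult:
  assumes "\<And>m F. V m F \<Longrightarrow> V (m - int i) (fdiff G y F)" "\<And>m F. V m F \<Longrightarrow> V (m - int i) (fdiff G z F)"
    and "y \<in> carrier G" "z \<in> carrier G" "V m F"
  shows "V (m - int i) (fdiff G (y \<otimes> z) F)"
proof -
  have "V (m - int i - int i) (fdiff G y (fdiff G z F))" using assms by blast
  then have "V (m - int i) (fdiff G y (fdiff G z F))" by (rule V_mono) simp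
  then have "V (m - int i) (\<lambda>x. fdiff G y F x + fdiff G z F x + fdiff G y (fdiff G z F) x)"
    using assms by (intro V.addr) auto
  then show ?thesis
    by (rule V.congr) (use assms Q_sub in \<open>auto simp: fdiff_mult subgroup.mem_carrier\<close>)
qed

text \<open>Beyond level \<open>w\<close> the element lies in \<open>R\<close>. Otherwise both
  factors of \<open>g [^] e \<otimes> h\<close> belong to \<open>L w \<subseteq> L i\<close>, and
  the product rule reduces the claim to \<open>g\<close> and \<open>h\<close>.\<close>

lemma V_fdiff: assumes "V m F" "y \<in> Q" "y \<in> L i" shows "V (m - int i) (fdiff G y F)"
proof (cases "i \<le> w")
  case False
  then have "y \<in> R" using L_antimono[of "Suc w" i] R_low assms by auto
  then show ?thesis using assms V_fdiff_R by blast
next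
  case True
  obtain e :: nat and h where y: "y = g [^] e \<otimes> h" "h \<in> R" using assms unfolding Q_def by blast
  have gi: "g \<in> L i" using L_antimono[OF True] g by auto
  have hi: "h \<in> L i" using L_antimono[OF True] R_up y by auto
  have Vg: "V (m - int i) (fdiff G g F)" if "V m F" for m F
    using V_mono[OF V_fdiff_g[OF that]] True by simp
  have Vh: "V (m - int i) (fdiff G h F)" if "V m F" for m F
    using V_fdiff_R that hi y by blast
  have "V (m - int i) (fdiff G (g [^] e \<otimes> h) F)" if "V m F" for m F
    using that
  proof (induction e arbitrary: m F)
    case 0
    then show ?case using Vh Rc y by simp
  next
    case (Suc e)
    have "g [^] Suc e \<otimes> h = g \<otimes> (g [^] e \<otimes> h)" using y Rc
      by (metis m_assoc nat_pow_Suc2 gc nat_pow_closed)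
    then show ?case using V_fdiff_mult[of i g "g [^] e \<otimes> h"] Vg Suc y Rc by simp
  qed
  then show ?thesis using assms y by simp
qed

lemma V_Dl: "V m F \<Longrightarrow> hs \<in> wl Q \<Longrightarrow> V (m - wt hs) (Dl hs F)"
proof (induction hs)
  case (Cons a hs)
  obtain y i where "a = (y, i)" by fastforce
  then show ?case using V_fdiff[of "m - wt hs" "Dl hs F" y i] Cons by (simp add: algebra_simps)
qed auto

lemma V_Fl: "V m F \<Longrightarrow> F \<in> Fl Q m"
  using V_Dl V_nonpos by (intro FlI) (metis diff_le_0_iff_le)

lemma Q_bounds: "L (Suc w) \<subseteq> Q" "Q \<subseteq> L w" "R \<subset> Q"
proof -
  show "L (Suc w) \<subseteq> Q" using R_low R_Q by auto
  show "R \<subset> Q" using R_Q g_Q gR by auto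
  have "g [^] e \<in> L w" for e :: nat
    by (induction e) (use g sub_L in \<open>simp_all add: subgroup.one_closed subgroup.m_closed\<close>)
  then show "Q \<subseteq> L w" unfolding Q_def using R_up sub_L by (auto simp: subgroup.m_closed)
qed

text \<open>An element of \<open>R\<close> is detected by a function on \<open>R\<close> extended
  constantly along \<open>g\<close>. Any other element is detected by its exponent of
  \<open>g\<close>, a function of weighted degree at most \<open>w\<close>, which is below
  \<open>n\<close>.\<close>

lemma separates_step:
  assumes sep: "\<And>s. s \<in> R \<Longrightarrow> s \<noteq> \<one> \<Longrightarrow> \<exists>f \<in> Fl R (int n). \<not> int p dvd f s - f \<one>"
    and wn: "w < n" and s: "s \<in> Q" "s \<noteq> \<one>"
  shows "\<exists>f \<in> Fl Q (int n). \<not> int p dvd f s - f \<one>"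
proof -
  obtain e h where x: "s = g [^] e \<otimes> h" "e < p" "h \<in> R" using s unfolding Q_def by blast
  have one: "u k f \<one> = int (0 choose k) * f \<one>" for k f
    using u_eq[of 0 \<one> k f] p2 R_one by simp
  show ?thesis
  proof (cases "e = 0")
    case True
    then have "s = h" using x Rc by simp
    then obtain f where f: "f \<in> Fl R (int n)" "\<not> int p dvd f h - f \<one>" using sep s x by blast
    then have "V (int n) (u 0 f)" using p2 by (intro V.base) auto
    moreover have "u 0 f s - u 0 f \<one> = f h - f \<one>" using x True u_eq[of 0 h 0 f] by (simp add: one)
    ultimately show ?thesis using f V_Fl by metis
  next
    case False
    have D1: "Dl hs (\<lambda>x. 1) = (\<lambda>x. 0)" if "hs \<noteq> []" for hs
      using that
    proof (induction hs)
      case (Cons a hs)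
      then show ?case by (cases a; cases "hs = []") (auto simp: fdiff_def fun_eq_iff)
    qed auto
    have "(\<lambda>x. 1) \<in> Fl R 1"
    proof (rule FlI)
      fix hs x assume "1 \<le> wt hs"
      then have "hs \<noteq> []" by auto
      then show "int p dvd Dl hs (\<lambda>x. 1) x" by (simp add: D1)
    qed
    then have "(\<lambda>x. 1) \<in> Fl R (int n - int (1 * w))"
      using Fl_mono[of 1 "int n - int (1 * w)"] wn by auto
    then have "V (int n) (u 1 (\<lambda>x. 1))" using p2 by (intro V.base) auto
    moreover have "u 1 (\<lambda>x. 1) s - u 1 (\<lambda>x. 1) \<one> = int e" using x by (simp add: u_eq one)
    moreover have "\<not> int p dvd int e" using x False by (auto dest: dvd_imp_le)
    ultimately show ?thesis using V_Fl by metis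
  qed
qed

end

context np_series
begin

text \<open>Jennings' theorem in dual form. Grow a subgroup \<open>Q\<close> with this property from the trivial one, by degree \<open>p\<close> steps between consecutive terms of \<open>L\<close>.\<close>
theorem separates:
  assumes "s \<in> carrier G" "s \<noteq> \<one>"
  shows "\<exists>f \<in> Fl (carrier G) (int n). \<not> int p dvd f s - f \<one>"
proof -
  define good where "good Q \<longleftrightarrow> subgroup Q G \<and> (\<exists>w. L (Suc w) \<subseteq> Q \<and> Q \<subseteq> L w)
    \<and> (\<forall>s\<in>Q. s \<noteq> \<one> \<longrightarrow> (\<exists>f \<in> Fl Q (int n). \<not> int p dvd f s - f \<one>))" for Q
  have "good {\<one>}" unfolding good_def
    using triv_subgroup dec_L[of n] Ln by auto
  moreover have "good Q \<longrightarrow> card Q < Suc (card (carrier G))" for Q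
    using card_mono[OF fin] by (auto simp: good_def dest: subgroup.subset intro: le_imp_less_Suc)
  ultimately obtain R where R: "good R" and max: "\<And>Q. good Q \<Longrightarrow> card Q \<le> card R"
    using ex_has_greatest_nat[of good "{\<one>}" card "Suc (card (carrier G))"] by metis
  have Rsub: "subgroup R G" using R by (simp add: good_def)
  \<comment> \<open>Let \<open>v\<close> be the predecessor of the least \<open>w\<close> with
    \<open>L w \<subseteq> R\<close>. If \<open>1 \<le> v\<close>, an element of \<open>L v\<close>
    outside \<open>R\<close> fits the step, because
    \<open>R \<subseteq> L w0 \<subseteq> L v\<close>, and the larger group contradicts maximality.
    So \<open>w \<le> 1\<close>, and \<open>L 0 = L 1\<close> is everything. The bound
    \<open>w \<le> n\<close> supplies \<open>v < n\<close>.\<close>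
  define w where "w = (LEAST w. L w \<subseteq> R)"
  obtain w0 where w0: "L (Suc w0) \<subseteq> R" "R \<subseteq> L w0" using R by (auto simp: good_def)
  have "L w \<subseteq> R" unfolding w_def using w0(1) by (rule LeastI)
  have "w \<le> Suc w0" unfolding w_def using w0(1) by (rule Least_le)
  have "w \<le> n" unfolding w_def using Ln subgroup.one_closed[OF Rsub] by (intro Least_le) auto
  have "w \<le> 1"
  proof (rule ccontr)
    assume "\<not> w \<le> 1"
    then obtain v where v: "w = Suc v" "1 \<le> v" by (cases w) auto
    have "\<not> L v \<subseteq> R" using not_less_Least[of v "\<lambda>w. L w \<subseteq> R"] v unfolding w_def by simp
    then obtain g where g: "g \<in> L v" "g \<notin> R" by auto
    interpret st: np_step G p n L R v g
      apply unfold_locales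
               apply (simp_all add: subgroup.subset[OF Rsub] subgroup.m_closed[OF Rsub]
                 subgroup.one_closed[OF Rsub] subgroup.m_inv_closed[OF Rsub])
      using g v \<open>L w \<subseteq> R\<close> w0(2) L_antimono[of v w0] \<open>w \<le> Suc w0\<close>
      by auto
    have "good st.Q" unfolding good_def
      using st.Q_sub st.Q_bounds st.separates_step R v \<open>w \<le> n\<close> by (auto simp: good_def)
    moreover have "card R < card st.Q"
      using st.Q_bounds(3) finite_subset[OF subgroup.subset[OF st.Q_sub] fin] by (rule psubset_card_mono[rotated])
    ultimately show False using max by fastforce
  qed
  then have "L w = carrier G" using L0 L1 by (cases w) auto
  then have "R = carrier G" using \<open>L w \<subseteq> R\<close> subgroup.subset[OF Rsub] by auto
  then show ?thesis using R assms by (simp add: good_def)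
qed

end

section \<open>Unitriangular groups and their filtration\<close>

text \<open>Left translations of a finite set are injective and hence surjective. This spares
  explicit inverses of matrices and of power series.\<close>

lemma finite_cancel_group:
  fixes G (structure)
  assumes "monoid G" "finite (carrier G)"
    and cancel: "\<And>a x y. \<lbrakk>a \<in> carrier G; x \<in> carrier G; y \<in> carrier G; a \<otimes> x = a \<otimes> y\<rbrakk> \<Longrightarrow> x = y"
  shows "group G"
proof -
  interpret monoid G by fact
  have right: "\<exists>x\<in>carrier G. a \<otimes> x = \<one>" if a: "a \<in> carrier G" for a
  proof -
    have "inj_on (\<lambda>x. a \<otimes> x) (carrier G)" using cancel a by (auto intro!: inj_onI)
    moreover have "(\<lambda>x. a \<otimes> x) ` carrier G \<subseteq> carrier G" using a by auto
    ultimately have "(\<lambda>x. a \<otimes> x) ` carrier G = carrier G" using assms(2) by (simp add: endo_inj_surj)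
    then show ?thesis by (metis imageE one_closed)
  qed
  show ?thesis
  proof (rule group_l_invI)
    fix a assume a: "a \<in> carrier G"
    obtain x where x: "x \<in> carrier G" "a \<otimes> x = \<one>" using right a by blast
    obtain y where y: "y \<in> carrier G" "x \<otimes> y = \<one>" using right x by blast
    have "y = (a \<otimes> x) \<otimes> y" using x y by simp
    also have "\<dots> = a" using a x(1) y by (simp add: m_assoc)
    finally show "\<exists>y\<in>carrier G. y \<otimes> a = \<one>" using x y by blast
  qed
qed

lemma mod_sum_mult_left: "(\<Sum>k\<in>A. (f k mod m) * g k) mod m = (\<Sum>k\<in>A. f k * g k) mod (m :: int)"
  using mod_sum_eq[of "\<lambda>k. (f k mod m) * g k" m A] mod_sum_eq[of "\<lambda>k. f k * g k" m A]
  by (simp add: mod_simps)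

lemma mod_sum_mult_right: "(\<Sum>k\<in>A. f k * (g k mod m)) mod m = (\<Sum>k\<in>A. f k * g k) mod (m :: int)"
  using mod_sum_mult_left[of g m f A] by (simp add: mult.commute)

locale unitriangular =
  fixes p n :: nat
  assumes p1: "1 < p"
begin

abbreviation "U \<equiv> unip p n"

lemma carrierD:
  assumes "A \<in> carrier U"
  shows "0 \<le> A i j" "A i j < int p" "i \<le> n \<Longrightarrow> A i i = 1" "j < i \<Longrightarrow> A i j = 0"
    "n < i \<Longrightarrow> A i j = 0" "n < j \<Longrightarrow> A i j = 0" "A i j mod int p = A i j"
proof -
  have *: "A i j \<in> {0..<int p}" using assms unfolding unip_def by simp
  then show "0 \<le> A i j" "A i j < int p" "A i j mod int p = A i j" by auto
qed (use assms in \<open>auto simp: unip_def\<close>)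

lemma carrierI:
  assumes "\<And>i j. A i j \<in> {0..<int p}" "\<And>i. i \<le> n \<Longrightarrow> A i i = 1"
    "\<And>i j. j < i \<or> n < i \<or> n < j \<Longrightarrow> A i j = 0"
  shows "A \<in> carrier U"
  using assms unfolding unip_def by simp

lemma mult_entry: "(A \<otimes>\<^bsub>U\<^esub> B) i j = (if i \<le> n \<and> j \<le> n then (\<Sum>k\<le>n. A i k * B k j) mod int p else 0)"
  by (simp add: unip_def)

lemma one_entry: "\<one>\<^bsub>U\<^esub> i j = (if i = j \<and> i \<le> n then 1 else 0)"
  by (simp add: unip_def)

lemma sum_between:
  assumes "A \<in> carrier U" "B \<in> carrier U" "j \<le> n"
  shows "(\<Sum>k\<le>n. A i k * B k j) = (\<Sum>k\<in>{i..j}. A i k * B k j)"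
proof (rule sum.mono_neutral_right)
  show "\<forall>k\<in>{..n} - {i..j}. A i k * B k j = 0"
  proof
    fix k assume "k \<in> {..n} - {i..j}"
    then have "k < i \<or> j < k" by auto
    then show "A i k * B k j = 0" using carrierD(4)[OF assms(1), of k i] carrierD(4)[OF assms(2), of j k] by auto
  qed
qed (use assms in auto)

lemma mult_entry_between:
  assumes "A \<in> carrier U" "B \<in> carrier U" "i \<le> n" "j \<le> n"
  shows "(A \<otimes>\<^bsub>U\<^esub> B) i j = (\<Sum>k\<in>{i..j}. A i k * B k j) mod int p"
  using assms by (simp add: mult_entry sum_between)

lemma mult_carrier: assumes "A \<in> carrier U" "B \<in> carrier U" shows "A \<otimes>\<^bsub>U\<^esub> B \<in> carrier U"
proof (rule carrierI)
  show "(A \<otimes>\<^bsub>U\<^esub> B) i j \<in> {0..<int p}" for i j using p1 by (auto simp: mult_entry)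
  show "(A \<otimes>\<^bsub>U\<^esub> B) i i = 1" if "i \<le> n" for i
    using that p1 carrierD(3)[OF assms(1) that] carrierD(3)[OF assms(2) that]
    by (simp add: mult_entry_between[OF assms])
  show "(A \<otimes>\<^bsub>U\<^esub> B) i j = 0" if "j < i \<or> n < i \<or> n < j" for i j
    using that by (cases "i \<le> n \<and> j \<le> n") (auto simp: mult_entry_between[OF assms], auto simp: mult_entry)
qed

lemma one_carrier: "\<one>\<^bsub>U\<^esub> \<in> carrier U"
  by (rule carrierI) (use p1 in \<open>auto simp: one_entry\<close>)

lemma finite_carrier: "finite (carrier U)"
proof -
  let ?F = "{f. \<forall>x. (x \<in> {..n} \<times> {..n} \<longrightarrow> f x \<in> {0..<int p}) \<and> (x \<notin> {..n} \<times> {..n} \<longrightarrow> f x = 0)}"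
  have "finite ?F" by (rule finite_set_of_finite_funs) auto
  moreover have "carrier U \<subseteq> curry ` ?F"
  proof
    fix A assume A: "A \<in> carrier U"
    have "A = curry (\<lambda>(i, j). A i j)" by (simp add: curry_def)
    moreover have "(\<lambda>(i, j). A i j) \<in> ?F" using carrierD[OF A] by (auto simp: not_le)
    ultimately show "A \<in> curry ` ?F" by blast
  qed
  ultimately show ?thesis using finite_surj by blast
qed

lemma monoid_U: "monoid U"
proof (rule monoidI)
  fix A B C
  show "A \<otimes>\<^bsub>U\<^esub> B \<otimes>\<^bsub>U\<^esub> C = A \<otimes>\<^bsub>U\<^esub> (B \<otimes>\<^bsub>U\<^esub> C)"
  proof (intro ext)
    fix i j
    show "(A \<otimes>\<^bsub>U\<^esub> B \<otimes>\<^bsub>U\<^esub> C) i j = (A \<otimes>\<^bsub>U\<^esub> (B \<otimes>\<^bsub>U\<^esub> C)) i j"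
    proof (cases "i \<le> n \<and> j \<le> n")
      case True
      have "(A \<otimes>\<^bsub>U\<^esub> B \<otimes>\<^bsub>U\<^esub> C) i j = (\<Sum>k\<le>n. ((\<Sum>l\<le>n. A i l * B l k) mod int p) * C k j) mod int p"
        using True by (simp add: mult_entry)
      also have "\<dots> = (\<Sum>k\<le>n. \<Sum>l\<le>n. A i l * B l k * C k j) mod int p"
        by (simp add: mod_sum_mult_left sum_distrib_right)
      also have "\<dots> = (\<Sum>l\<le>n. \<Sum>k\<le>n. A i l * (B l k * C k j)) mod int p"
        by (subst sum.swap) (simp add: mult.assoc)
      also have "\<dots> = (\<Sum>l\<le>n. A i l * ((\<Sum>k\<le>n. B l k * C k j) mod int p)) mod int p"
        by (simp add: mod_sum_mult_right sum_distrib_left)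
      also have "\<dots> = (A \<otimes>\<^bsub>U\<^esub> (B \<otimes>\<^bsub>U\<^esub> C)) i j" using True by (simp add: mult_entry)
      finally show ?thesis .
    next
      case False
      then have "(M \<otimes>\<^bsub>U\<^esub> Y) i j = 0" for M Y by (auto simp: mult_entry)
      then show ?thesis by simp
    qed
  qed
next
  fix A assume A: "A \<in> carrier U"
  show "\<one>\<^bsub>U\<^esub> \<otimes>\<^bsub>U\<^esub> A = A" "A \<otimes>\<^bsub>U\<^esub> \<one>\<^bsub>U\<^esub> = A"
  proof (intro ext)
    fix i j
    show "(\<one>\<^bsub>U\<^esub> \<otimes>\<^bsub>U\<^esub> A) i j = A i j"
      using carrierD(5,7)[OF A, of i j] carrierD(6)[OF A, of j i] by (auto simp: mult_entry one_entry if_distrib[of "\<lambda>x. x * _"] sum.delta cong: if_cong)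
  next
    show "(A \<otimes>\<^bsub>U\<^esub> \<one>\<^bsub>U\<^esub>) = A"
    proof (intro ext)
      fix i j
      have "(\<Sum>k\<le>n. A i k * \<one>\<^bsub>U\<^esub> k j) = (\<Sum>k\<le>n. if k = j then A i k else 0)"
        by (rule sum.cong) (auto simp: one_entry)
      then show "(A \<otimes>\<^bsub>U\<^esub> \<one>\<^bsub>U\<^esub>) i j = A i j"
        using carrierD(5,7)[OF A, of i j] carrierD(6)[OF A, of j i] by (auto simp: mult_entry)
    qed
  qed
qed (simp_all add: mult_carrier one_carrier)

text \<open>Back substitution: row \<open>i\<close> of the product is row \<open>i\<close> of the
  right factor plus a combination of later rows, so the rows are recovered from the last one
  upwards.\<close>

lemma left_cancel:
  assumes A: "A \<in> carrier U" and B: "B \<in> carrier U" and C: "C \<in> carrier U"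
    and eq: "A \<otimes>\<^bsub>U\<^esub> B = A \<otimes>\<^bsub>U\<^esub> C"
  shows "B = C"
proof -
  have "B i j = C i j" if "i \<le> n" "j \<le> n" for i j
    using that
  proof (induction "n - i" arbitrary: i rule: less_induct)
    case less
    show ?case
    proof (cases "i \<le> j")
      case True
      have split: "(\<Sum>k\<in>{i..j}. A i k * D k j) = D i j + (\<Sum>k\<in>{Suc i..j}. A i k * D k j)" for D
        using True carrierD(3)[OF A less(2)] by (simp add: sum.atLeast_Suc_atMost)
      have "(\<Sum>k\<in>{Suc i..j}. A i k * B k j) = (\<Sum>k\<in>{Suc i..j}. A i k * C k j)"
        using less by (intro sum.cong) auto
      moreover have "(B i j + (\<Sum>k\<in>{Suc i..j}. A i k * B k j)) mod int p
          = (C i j + (\<Sum>k\<in>{Suc i..j}. A i k * C k j)) mod int p"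
        using fun_cong[OF fun_cong[OF eq, of i], of j] less
        by (simp add: mult_entry_between A B C split)
      ultimately have "B i j mod int p = C i j mod int p"
        by (simp add: mod_eq_dvd_iff)
      then show ?thesis by (simp add: carrierD(7) B C)
    qed (use carrierD(4)[OF B, of j i] carrierD(4)[OF C, of j i] in auto)
  qed
  moreover have "B i j = C i j" if "\<not> (i \<le> n \<and> j \<le> n)" for i j
    using that carrierD(5)[OF B, of i j] carrierD(5)[OF C, of i j] carrierD(6)[OF B, of j i] carrierD(6)[OF C, of j i] by auto
  ultimately show ?thesis by (intro ext) blast
qed

sublocale U: group U
  by (rule finite_cancel_group[OF monoid_U finite_carrier left_cancel])

text \<open>Equality on all diagonals \<open>j - i < m\<close>. The additive form of the inequality
  includes the entries below the main diagonal.\<close>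

definition agree :: "nat \<Rightarrow> (nat \<Rightarrow> nat \<Rightarrow> int) \<Rightarrow> (nat \<Rightarrow> nat \<Rightarrow> int) \<Rightarrow> bool" where
  "agree m A B \<longleftrightarrow> (\<forall>i j. j < i + m \<longrightarrow> A i j = B i j)"

lemma agree_refl: "agree m A A" and agree_sym: "agree m A B \<Longrightarrow> agree m B A"
  and agree_trans: "agree m A B \<Longrightarrow> agree m B C \<Longrightarrow> agree m A C"
  by (auto simp: agree_def)

lemma agree_mult:
  assumes "A \<in> carrier U" "A' \<in> carrier U" "B \<in> carrier U" "B' \<in> carrier U" "agree m A A'" "agree m B B'"
  shows "agree m (A \<otimes>\<^bsub>U\<^esub> B) (A' \<otimes>\<^bsub>U\<^esub> B')"
  unfolding agree_def
proof (intro allI impI)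
  fix i j assume ij: "j < i + m"
  have "(\<Sum>k\<in>{i..j}. A i k * B k j) = (\<Sum>k\<in>{i..j}. A' i k * B' k j)"
    using assms(5,6) ij by (intro sum.cong) (auto simp: agree_def)
  then show "(A \<otimes>\<^bsub>U\<^esub> B) i j = (A' \<otimes>\<^bsub>U\<^esub> B') i j"
    using assms by (cases "i \<le> n \<and> j \<le> n") (auto simp: mult_entry_between, auto simp: mult_entry)
qed

definition uf :: "nat \<Rightarrow> (nat \<Rightarrow> nat \<Rightarrow> int) set" where
  "uf m = {A \<in> carrier U. agree m A \<one>\<^bsub>U\<^esub>}"

lemma uf_carrier: "A \<in> uf m \<Longrightarrow> A \<in> carrier U" by (simp add: uf_def)

text \<open>Congruence modulo \<open>uf m\<close> is read off the entries of \<open>A\<close> and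
  \<open>B\<close>, so the entries of an inverse never have to be computed.\<close>

lemma uf_iff_agree:
  assumes "A \<in> carrier U" "B \<in> carrier U" shows "A \<otimes>\<^bsub>U\<^esub> inv\<^bsub>U\<^esub> B \<in> uf m \<longleftrightarrow> agree m A B"
proof
  assume "A \<otimes>\<^bsub>U\<^esub> inv\<^bsub>U\<^esub> B \<in> uf m"
  then have "agree m (A \<otimes>\<^bsub>U\<^esub> inv\<^bsub>U\<^esub> B \<otimes>\<^bsub>U\<^esub> B) (\<one>\<^bsub>U\<^esub> \<otimes>\<^bsub>U\<^esub> B)"
    using assms by (intro agree_mult) (auto simp: uf_def agree_refl)
  then show "agree m A B" using assms by (simp add: U.m_assoc)
next
  assume "agree m A B"
  then have "agree m (A \<otimes>\<^bsub>U\<^esub> inv\<^bsub>U\<^esub> B) (B \<otimes>\<^bsub>U\<^esub> inv\<^bsub>U\<^esub> B)"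
    using assms by (intro agree_mult) (auto simp: agree_refl)
  then show "A \<otimes>\<^bsub>U\<^esub> inv\<^bsub>U\<^esub> B \<in> uf m" using assms by (simp add: uf_def)
qed

lemma uf_subgroup: "subgroup (uf m) U"
proof (rule U.subgroupI)
  show "uf m \<subseteq> carrier U" "uf m \<noteq> {}" by (auto simp: uf_def intro: agree_refl)
  show "inv\<^bsub>U\<^esub> A \<in> uf m" if "A \<in> uf m" for A
    using that uf_iff_agree[of "\<one>\<^bsub>U\<^esub>" A m] agree_sym by (auto simp: uf_def)
  show "A \<otimes>\<^bsub>U\<^esub> B \<in> uf m" if "A \<in> uf m" "B \<in> uf m" for A B
    using that agree_mult[of A "\<one>\<^bsub>U\<^esub>" B "\<one>\<^bsub>U\<^esub>" m] by (auto simp: uf_def)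
qed

lemma uf_conj:
  assumes M: "M \<in> carrier U" and A: "A \<in> uf m"
  shows "M \<otimes>\<^bsub>U\<^esub> A \<otimes>\<^bsub>U\<^esub> inv\<^bsub>U\<^esub> M \<in> uf m"
proof -
  have Ac: "A \<in> carrier U" using A by (rule uf_carrier)
  have "agree m (M \<otimes>\<^bsub>U\<^esub> A) (M \<otimes>\<^bsub>U\<^esub> \<one>\<^bsub>U\<^esub>)"
    using M A by (intro agree_mult) (auto simp: uf_def agree_refl)
  then have "agree m (M \<otimes>\<^bsub>U\<^esub> A) M" using M by simp
  then show ?thesis using uf_iff_agree[of "M \<otimes>\<^bsub>U\<^esub> A" M m] M Ac by simp
qed

lemma uf_normal: "normal (uf m) U"
  using U.normal_inv_iff[of "uf m"] uf_subgroup uf_conj by blast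

lemma uf_0: "uf 0 = carrier U" and uf_1: "uf (Suc 0) = carrier U" and uf_top: "uf (Suc n) = {\<one>\<^bsub>U\<^esub>}"
proof -
  show "uf 0 = carrier U" "uf (Suc 0) = carrier U"
    by (auto simp: uf_def agree_def one_entry carrierD less_Suc_eq)
  have "A = \<one>\<^bsub>U\<^esub>" if "A \<in> uf (Suc n)" for A
  proof (intro ext)
    fix i j show "A i j = \<one>\<^bsub>U\<^esub> i j"
    proof (cases "j < i + Suc n")
      case True then show ?thesis using that by (simp add: uf_def agree_def)
    next
      case False then show ?thesis using that carrierD(6)[of A j i] by (simp add: uf_def one_entry)
    qed
  qed
  moreover have "\<one>\<^bsub>U\<^esub> \<in> uf (Suc n)" by (simp add: uf_def agree_refl)
  ultimately show "uf (Suc n) = {\<one>\<^bsub>U\<^esub>}" by blast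
qed

lemma uf_entry_zero: assumes "A \<in> uf m" "i \<noteq> j" "j < i + m" shows "A i j = 0"
  using assms by (auto simp: uf_def agree_def one_entry)

text \<open>A cross term with \<open>i < k < j\<close> would need \<open>k - i \<ge> a\<close> and
  \<open>j - k \<ge> b\<close>, which is too long for this diagonal. What remains is symmetric in
  the two factors, so they commute up to \<open>uf (a + b)\<close>.\<close>

lemma uf_mult_entry:
  assumes A: "A \<in> uf a" and B: "B \<in> uf b" and ij: "i < j" "j < i + (a + b)" "j \<le> n"
  shows "(A \<otimes>\<^bsub>U\<^esub> B) i j = (A i j + B i j) mod int p"
proof -
  have Ac: "A \<in> carrier U" and Bc: "B \<in> carrier U" using A B by (auto simp: uf_def)
  have "(\<Sum>k\<in>{i..j}. A i k * B k j) = (\<Sum>k\<in>{i..j}. (if k = i then B i j else 0) + (if k = j then A i j else 0))"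
  proof (rule sum.cong)
    fix k assume k: "k \<in> {i..j}"
    show "A i k * B k j = (if k = i then B i j else 0) + (if k = j then A i j else 0)"
    proof (cases "k = i \<or> k = j")
      case True
      then show ?thesis using ij carrierD(3)[OF Ac, of i] carrierD(3)[OF Bc, of j] by auto
    next
      case False
      then have "k < i + a \<or> j < k + b" using ij by linarith
      then show ?thesis using False uf_entry_zero[OF A, of i k] uf_entry_zero[OF B, of k j] by auto
    qed
  qed simp
  then show ?thesis using ij by (simp add: mult_entry_between Ac Bc sum.distrib add.commute)
qed

lemma uf_comm:
  assumes A: "A \<in> uf a" and B: "B \<in> uf b"
  shows "A \<otimes>\<^bsub>U\<^esub> B \<otimes>\<^bsub>U\<^esub> inv\<^bsub>U\<^esub> A \<otimes>\<^bsub>U\<^esub> inv\<^bsub>U\<^esub> B \<in> uf (a + b)"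
proof -
  have Ac: "A \<in> carrier U" and Bc: "B \<in> carrier U" using A B by (auto simp: uf_def)
  have "agree (a + b) (A \<otimes>\<^bsub>U\<^esub> B) (B \<otimes>\<^bsub>U\<^esub> A)"
    unfolding agree_def
  proof (intro allI impI)
    fix i j assume ij: "j < i + (a + b)"
    consider "i < j \<and> j \<le> n" | "j \<le> i \<or> n < j" by linarith
    then show "(A \<otimes>\<^bsub>U\<^esub> B) i j = (B \<otimes>\<^bsub>U\<^esub> A) i j"
    proof cases
      case 1 then show ?thesis
        using uf_mult_entry[OF A B, of i j] uf_mult_entry[OF B A, of i j] ij by (simp add: add.commute)
    next
      case 2
      have "agree (Suc 0) (A \<otimes>\<^bsub>U\<^esub> B) \<one>\<^bsub>U\<^esub>" "agree (Suc 0) (B \<otimes>\<^bsub>U\<^esub> A) \<one>\<^bsub>U\<^esub>"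
        using uf_1 mult_carrier Ac Bc unfolding uf_def by blast+
      then have "j \<le> i \<Longrightarrow> ?thesis" by (simp add: agree_def)
      moreover have "n < j \<Longrightarrow> ?thesis" by (simp add: mult_entry)
      ultimately show ?thesis using 2 by blast
    qed
  qed
  then show ?thesis using uf_iff_agree[of "A \<otimes>\<^bsub>U\<^esub> B" "B \<otimes>\<^bsub>U\<^esub> A" "a + b"] Ac Bc
    by (simp add: U.inv_mult_group U.m_assoc)
qed

text \<open>The unreduced integer powers of the nilpotent matrix \<open>A - 1\<close>, as they occur
  in the binomial expansion \<open>pow_entry\<close>.\<close>

primrec Xp :: "(nat \<Rightarrow> nat \<Rightarrow> int) \<Rightarrow> nat \<Rightarrow> nat \<Rightarrow> nat \<Rightarrow> int" where
  "Xp A 0 = \<one>\<^bsub>U\<^esub>"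
| "Xp A (Suc r) = (\<lambda>i j. \<Sum>k\<le>n. Xp A r i k * (A k j - \<one>\<^bsub>U\<^esub> k j))"

lemma Xp_zero: "A \<in> uf m \<Longrightarrow> j < i + r * m \<Longrightarrow> Xp A r i j = 0"
proof (induction r arbitrary: j)
  case (Suc r)
  have "Xp A r i k * (A k j - \<one>\<^bsub>U\<^esub> k j) = 0" for k
  proof (cases "k < i + r * m")
    case False
    then have "j < k + m" using Suc by simp
    then show ?thesis using Suc by (simp add: uf_def agree_def)
  qed (use Suc in auto)
  then show ?case by (simp add: sum.neutral)
qed (simp add: one_entry)

lemma pow_entry:
  assumes A: "A \<in> carrier U" and ij: "i \<le> n" "j \<le> n"
  shows "(A [^]\<^bsub>U\<^esub> k) i j = (\<Sum>r\<le>k. int (k choose r) * Xp A r i j) mod int p"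
  using ij(2)
proof (induction k arbitrary: j)
  case 0
  then show ?case using ij p1 by (simp add: one_entry)
next
  case (Suc k)
  define g where "g = (\<lambda>r j. int (k choose r) * Xp A r i j)"
  have delta: "(\<Sum>l\<le>n. f l * \<one>\<^bsub>U\<^esub> l j) = f j" for f :: "nat \<Rightarrow> int"
  proof -
    have "(\<Sum>l\<le>n. f l * \<one>\<^bsub>U\<^esub> l j) = (\<Sum>l\<le>n. if l = j then f l else 0)"
      by (rule sum.cong) (auto simp: one_entry)
    then show ?thesis using Suc by simp
  qed
  have "(A [^]\<^bsub>U\<^esub> Suc k) i j = (\<Sum>l\<le>n. ((\<Sum>r\<le>k. g r l) mod int p) * A l j) mod int p"
    using Suc ij by (simp add: mult_entry g_def)
  also have "\<dots> = (\<Sum>l\<le>n. (\<Sum>r\<le>k. g r l) * (\<one>\<^bsub>U\<^esub> l j + (A l j - \<one>\<^bsub>U\<^esub> l j))) mod int p"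
    by (simp add: mod_sum_mult_left)
  also have "(\<Sum>l\<le>n. (\<Sum>r\<le>k. g r l) * (\<one>\<^bsub>U\<^esub> l j + (A l j - \<one>\<^bsub>U\<^esub> l j)))
     = (\<Sum>r\<le>k. g r j) + (\<Sum>l\<le>n. \<Sum>r\<le>k. g r l * (A l j - \<one>\<^bsub>U\<^esub> l j))"
    by (simp only: distrib_left sum.distrib delta) (simp only: sum_distrib_right)
  also have "(\<Sum>l\<le>n. \<Sum>r\<le>k. g r l * (A l j - \<one>\<^bsub>U\<^esub> l j)) = (\<Sum>r\<le>k. int (k choose r) * Xp A (Suc r) i j)"
    by (subst sum.swap) (simp add: g_def sum_distrib_left mult.assoc)
  also have "(\<Sum>r\<le>k. g r j) + (\<Sum>r\<le>k. int (k choose r) * Xp A (Suc r) i j)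
     = (\<Sum>r\<le>Suc k. int (Suc k choose r) * Xp A r i j)"
  proof -
    have "(\<Sum>r\<le>k. g r j) = (\<Sum>r\<le>Suc k. int (k choose r) * Xp A r i j)" by (simp add: g_def)
    also have "\<dots> = Xp A 0 i j + (\<Sum>r\<le>k. int (k choose Suc r) * Xp A (Suc r) i j)"
      by (subst sum.atMost_Suc_shift) simp
    finally show ?thesis
      by (subst sum.atMost_Suc_shift) (simp add: sum.distrib distrib_right del: Xp.simps)
  qed
  finally show ?case .
qed

text \<open>In the binomial expansion of the p-th power the middle coefficients are divisible by p,
  and the last term, the p-th power of \<open>A - 1\<close>, starts only at diagonal
  \<open>p * m\<close>.\<close>

lemma uf_pow:
  assumes p: "Factorial_Ring.prime p" and A: "A \<in> uf m" shows "A [^]\<^bsub>U\<^esub> p \<in> uf (p * m)"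
proof -
  have Ac: "A \<in> carrier U" using A by (simp add: uf_def)
  have "(A [^]\<^bsub>U\<^esub> p) i j = \<one>\<^bsub>U\<^esub> i j" if ij: "j < i + p * m" for i j
  proof (cases "i \<le> n \<and> j \<le> n")
    case True
    have "(\<Sum>r\<le>p. int (p choose r) * Xp A r i j) mod int p
        = (\<Sum>r\<le>p. if r = 0 then \<one>\<^bsub>U\<^esub> i j else 0) mod int p"
    proof (subst mod_sum_eq[symmetric], subst (2) mod_sum_eq[symmetric], rule arg_cong[where f = "\<lambda>x. x mod int p"], rule sum.cong)
      fix r assume r: "r \<in> {..p}"
      consider "r = 0" | "r = p" | "0 < r" "r < p" using r by fastforce
      then show "int (p choose r) * Xp A r i j mod int p = (if r = 0 then \<one>\<^bsub>U\<^esub> i j else 0) mod int p"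
      proof cases
        case 2 then show ?thesis using Xp_zero[OF A ij] p1 by simp
      next
        case 3 then show ?thesis using dvd_choose_prime[of r p] p p1 by (simp del: Xp.simps)
      qed simp
    qed simp
    then show ?thesis using True p1 by (simp add: pow_entry[OF Ac] one_entry)
  next
    case False
    then show ?thesis using carrierD(5,6)[OF U.nat_pow_closed[OF Ac, of p], of _] by (auto simp: one_entry)
  qed
  then show ?thesis using Ac by (simp add: uf_def agree_def)
qed

lemma center_uf: "1 \<le> n \<Longrightarrow> unip_center p n = uf n"
proof (intro equalityI subsetI)
  fix A assume n: "1 \<le> n" and A: "A \<in> unip_center p n"
  have Ac: "A \<in> carrier U" using A by (simp add: unip_center_def)
  have "A i j = \<one>\<^bsub>U\<^esub> i j" if "j < i + n" for i j
  proof (cases "i = j")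
    case True then show ?thesis using carrierD(3,5)[OF Ac, of i] by (simp add: one_entry)
  next
    case False
    moreover have "(i, j) \<noteq> (0, n)" using that by auto
    ultimately show ?thesis using A by (simp add: unip_center_def one_entry)
  qed
  then show "A \<in> uf n" using Ac by (simp add: uf_def agree_def)
next
  fix A assume n: "1 \<le> n" and A: "A \<in> uf n"
  have "A i j = 0" if "i \<noteq> j" "(i, j) \<noteq> (0, n)" for i j
  proof (cases "j < i + n")
    case True then show ?thesis using uf_entry_zero[OF A that(1)] by simp
  next
    case False
    then have "n < j \<or> (i = 0 \<and> j = n)" by linarith
    then show ?thesis using that carrierD(6)[of A j i] A by (auto simp: uf_def)
  qed
  then show "A \<in> unip_center p n" using A by (simp add: unip_center_def uf_def)
qed

lemma coset_uf: assumes "A \<in> carrier U" shows "uf m #>\<^bsub>U\<^esub> A = {B \<in> carrier U. agree m B A}"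
proof -
  have "B \<in> uf m #>\<^bsub>U\<^esub> A \<longleftrightarrow> agree m B A" if "B \<in> carrier U" for B
    using uf_iff_agree[of B A m] subgroup.rcos_module[OF uf_subgroup U.is_group assms that] assms that by blast
  moreover have "uf m #>\<^bsub>U\<^esub> A \<subseteq> carrier U" using U.r_coset_subset_G[OF subgroup.subset[OF uf_subgroup] assms] .
  ultimately show ?thesis by blast
qed

text \<open>The inner terms of the corner of a product involve only entries on diagonals below
  \<open>n\<close>, where the two pairs agree. Changes of the corner therefore add up, and all
  cocycle computations with \<open>alpha\<close> rest on this.\<close>

lemma corner_mult:
  assumes "1 \<le> n" "A \<in> carrier U" "A' \<in> carrier U" "B \<in> carrier U" "B' \<in> carrier U" "agree n A A'" "agree n B B'"
  shows "int p dvd ((A \<otimes>\<^bsub>U\<^esub> B) 0 n - (A' \<otimes>\<^bsub>U\<^esub> B') 0 n) - ((A 0 n - A' 0 n) + (B 0 n - B' 0 n))"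
proof -
  obtain k where n: "n = Suc k" using assms by (cases n) auto
  have split: "(\<Sum>l\<le>n. C 0 l * D l n) = D 0 n + C 0 n + (\<Sum>l\<in>{Suc 0..k}. C 0 l * D l n)"
    if "C \<in> carrier U" "D \<in> carrier U" for C D
  proof -
    have "{..n} = insert 0 (insert n {Suc 0..k})" using n by auto
    then show ?thesis using carrierD(3)[OF that(1), of 0] carrierD(3)[OF that(2), of n] n by simp
  qed
  have mid: "(\<Sum>l\<in>{Suc 0..k}. A 0 l * B l n) = (\<Sum>l\<in>{Suc 0..k}. A' 0 l * B' l n)"
    using assms(6,7) n by (intro sum.cong[OF refl]) (auto simp: agree_def)
  have "(A \<otimes>\<^bsub>U\<^esub> B) 0 n - (A' \<otimes>\<^bsub>U\<^esub> B') 0 n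
     = (\<Sum>l\<le>n. A 0 l * B l n) mod int p - (\<Sum>l\<le>n. A' 0 l * B' l n) mod int p"
    by (simp add: mult_entry)
  moreover have "(\<Sum>l\<le>n. A 0 l * B l n) - (\<Sum>l\<le>n. A' 0 l * B' l n) = (A 0 n - A' 0 n) + (B 0 n - B' 0 n)"
    using assms by (simp add: split mid)
  moreover have "int p dvd (x mod int p - y mod int p) - (x - y)" for x y
    by (simp add: mod_simps flip: mod_eq_dvd_iff)
  ultimately show ?thesis by metis
qed

end

text \<open>The block embedding with an extra 1 in the last diagonal place. It lets homomorphisms to
  the smaller group be tested by homomorphisms to the larger one.\<close>

definition unip_ext :: "nat \<Rightarrow> (nat \<Rightarrow> nat \<Rightarrow> int) \<Rightarrow> nat \<Rightarrow> nat \<Rightarrow> int" where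
  "unip_ext n A = (\<lambda>i j. if i = Suc n \<and> j = Suc n then 1 else A i j)"

lemma unip_ext:
  assumes p: "1 < p"
  shows "unip_ext n \<in> hom (unip p n) (unip p (Suc n))"
    and "A \<in> carrier (unip p n) \<Longrightarrow> unip_ext n A = \<one>\<^bsub>unip p (Suc n)\<^esub> \<Longrightarrow> A = \<one>\<^bsub>unip p n\<^esub>"
proof -
  interpret u: unitriangular p n by unfold_locales fact
  interpret v: unitriangular p "Suc n" by unfold_locales fact
  have carr: "unip_ext n A \<in> carrier (unip p (Suc n))" if "A \<in> carrier (unip p n)" for A
    by (rule v.carrierI) (use u.carrierD[OF that] p in \<open>auto simp: unip_ext_def le_Suc_eq\<close>)
  show "unip_ext n \<in> hom (unip p n) (unip p (Suc n))"
  proof (rule homI)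
    fix A B assume A: "A \<in> carrier (unip p n)" and B: "B \<in> carrier (unip p n)"
    show "unip_ext n (A \<otimes>\<^bsub>unip p n\<^esub> B) = unip_ext n A \<otimes>\<^bsub>unip p (Suc n)\<^esub> unip_ext n B"
    proof (intro ext)
      fix i j
      show "unip_ext n (A \<otimes>\<^bsub>unip p n\<^esub> B) i j = (unip_ext n A \<otimes>\<^bsub>unip p (Suc n)\<^esub> unip_ext n B) i j"
        using p u.carrierD(6)[OF A, of "Suc n" i] u.carrierD(5)[OF B, of "Suc n" j]
          u.carrierD(5)[OF A, of "Suc n"] u.carrierD(6)[OF B, of "Suc n"]
        by (auto simp: v.mult_entry u.mult_entry unip_ext_def le_Suc_eq)
    qed
  qed (rule carr)
  assume A: "A \<in> carrier (unip p n)" "unip_ext n A = \<one>\<^bsub>unip p (Suc n)\<^esub>"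
  show "A = \<one>\<^bsub>unip p n\<^esub>"
  proof (intro ext)
    fix i j
    show "A i j = \<one>\<^bsub>unip p n\<^esub> i j"
      using fun_cong[OF fun_cong[OF A(2), of i], of j] u.carrierD(5,6)[OF A(1), of i j] u.carrierD(5,6)[OF A(1), of j i]
      by (auto simp: unip_ext_def u.one_entry v.one_entry split: if_splits) 
  qed
qed

section \<open>The Magnus group\<close>

text \<open>Truncated noncommutative power series with constant term 1: functions on the words of length at most \<open>N\<close>.\<close>
definition magnus :: "nat \<Rightarrow> nat \<Rightarrow> 'b set \<Rightarrow> ('b list \<Rightarrow> int) monoid" where
  "magnus p N Y = \<lparr> carrier = {a. (\<forall>w. a w \<in> {0..<int p}) \<and> a [] = 1
        \<and> (\<forall>w. N < length w \<or> \<not> set w \<subseteq> Y \<longrightarrow> a w = 0)},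
      mult = (\<lambda>a b w. if length w \<le> N \<and> set w \<subseteq> Y
         then (\<Sum>k\<le>length w. a (take k w) * b (drop k w)) mod int p else 0),
      one = (\<lambda>w. if w = [] then 1 else 0) \<rparr>"

text \<open>Entry (i, j) is the coefficient at the factor of \<open>w\<close> between positions
  \<open>i\<close> and \<open>j\<close>. Splitting such a factor at an intermediate position is
  matrix multiplication, which turns Magnus coefficients into entries of unitriangular
  representations.\<close>

definition subword_matrix :: "'b list \<Rightarrow> ('b list \<Rightarrow> int) \<Rightarrow> nat \<Rightarrow> nat \<Rightarrow> int" where
  "subword_matrix w a i j = (if i \<le> j \<and> j \<le> length w then a (take (j - i) (drop i w)) else 0)"

locale magnus_words = unitriangular p N for p N :: nat +
  fixes Y :: "'b set"
  assumes fin_Y: "finite Y"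
begin

abbreviation "W \<equiv> magnus p N Y"

lemma magnusD:
  assumes "a \<in> carrier W"
  shows "0 \<le> a w" "a w < int p" "a [] = 1" "N < length w \<Longrightarrow> a w = 0" "\<not> set w \<subseteq> Y \<Longrightarrow> a w = 0"
    "a w mod int p = a w"
proof -
  have *: "a w \<in> {0..<int p}" using assms unfolding magnus_def by simp
  then show "0 \<le> a w" "a w < int p" "a w mod int p = a w" by auto
qed (use assms in \<open>auto simp: magnus_def\<close>)

lemma magnus_mult: "(a \<otimes>\<^bsub>W\<^esub> b) w = (if length w \<le> N \<and> set w \<subseteq> Y
         then (\<Sum>k\<le>length w. a (take k w) * b (drop k w)) mod int p else 0)"
  by (simp add: magnus_def)

lemma magnus_one: "\<one>\<^bsub>W\<^esub> = (\<lambda>w. if w = [] then 1 else 0)"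
  by (simp add: magnus_def)

lemma mult_closed: assumes "a \<in> carrier W" "b \<in> carrier W" shows "a \<otimes>\<^bsub>W\<^esub> b \<in> carrier W"
proof -
  have "(a \<otimes>\<^bsub>W\<^esub> b) w \<in> {0..<int p}" for w using p1 by (simp add: magnus_mult)
  moreover have "(a \<otimes>\<^bsub>W\<^esub> b) [] = 1" using p1 magnusD(3)[OF assms(1)] magnusD(3)[OF assms(2)]
    by (simp add: magnus_mult)
  moreover have "(a \<otimes>\<^bsub>W\<^esub> b) w = 0" if "N < length w \<or> \<not> set w \<subseteq> Y" for w
    using that by (auto simp: magnus_mult)
  ultimately show ?thesis by (simp add: magnus_def)
qed

lemma one_closed: "\<one>\<^bsub>W\<^esub> \<in> carrier W"
  using p1 by (auto simp: magnus_def)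

lemma subword_matrix_carrier:
  assumes a: "a \<in> carrier W" and w: "length w = N"
  shows "subword_matrix w a \<in> carrier U"
  by (rule carrierI) (use magnusD[OF a] p1 w in \<open>auto simp: subword_matrix_def\<close>)

lemma subword_matrix_mult:
  assumes a: "a \<in> carrier W" and b: "b \<in> carrier W" and w: "length w = N" "set w \<subseteq> Y"
  shows "subword_matrix w (a \<otimes>\<^bsub>W\<^esub> b) = subword_matrix w a \<otimes>\<^bsub>U\<^esub> subword_matrix w b"
proof (intro ext)
  fix i j
  have c: "subword_matrix w a \<in> carrier U" "subword_matrix w b \<in> carrier U"
    using a b w subword_matrix_carrier by auto
  show "subword_matrix w (a \<otimes>\<^bsub>W\<^esub> b) i j = (subword_matrix w a \<otimes>\<^bsub>U\<^esub> subword_matrix w b) i j"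
  proof (cases "i \<le> j \<and> j \<le> N")
    case False
    then show ?thesis using w carrierD(4,5)[OF U.m_closed[OF c], of j i] carrierD(6)[OF U.m_closed[OF c], of j i]
      by (auto simp: subword_matrix_def)
  next
    case True
    define v where "v = take (j - i) (drop i w)"
    have v: "length v = j - i" "length v \<le> N" "set v \<subseteq> Y"
      using True w by (auto simp: v_def dest!: in_set_takeD in_set_dropD)
    have "(\<Sum>k\<in>{i..j}. subword_matrix w a i k * subword_matrix w b k j)
        = (\<Sum>l\<le>length v. a (take l v) * b (drop l v))"
    proof (rule sum.reindex_bij_witness[of _ "\<lambda>l. i + l" "\<lambda>k. k - i"])
      fix k assume "k \<in> {i..j}"
      then have k: "i \<le> k" "k \<le> j" by auto
      have "take (k - i) v = take (k - i) (drop i w)" using k True by (simp add: v_def min_def)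
      moreover have "drop (k - i) v = take (j - k) (drop k w)" using k by (simp add: v_def drop_take)
      ultimately show "a (take (k - i) v) * b (drop (k - i) v) = subword_matrix w a i k * subword_matrix w b k j"
        using k True w by (simp add: subword_matrix_def)
    qed (use v True in auto)
    then show ?thesis using True v w
      by (simp add: mult_entry_between[OF c] subword_matrix_def magnus_mult flip: v_def)
  qed
qed

lemma eq_if_subword_matrix_eq:
  assumes a: "a \<in> carrier W" and b: "b \<in> carrier W"
    and eq: "\<And>w. length w = N \<Longrightarrow> set w \<subseteq> Y \<Longrightarrow> subword_matrix w a = subword_matrix w b"
  shows "a = b"
proof
  fix w
  show "a w = b w"
  proof (cases "w = [] \<or> N < length w \<or> \<not> set w \<subseteq> Y")
    case True
    then show ?thesis using magnusD(3,4,5)[OF a] magnusD(3,4,5)[OF b] by metis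
  next
    case False
    \<comment> \<open>A short word is padded to length \<open>N\<close> with its own first letter,
      which certainly lies in \<open>Y\<close>. It stays a prefix, so its coefficient is entry (0,
      \<open>length w\<close>).\<close>
    define w' where "w' = w @ replicate (N - length w) (hd w)"
    have "length w' = N" "set w' \<subseteq> Y" using False by (auto simp: w'_def)
    then have "subword_matrix w' a 0 (length w) = subword_matrix w' b 0 (length w)" using eq by simp
    then show ?thesis using \<open>length w' = N\<close> False by (simp add: subword_matrix_def) (simp add: w'_def)
  qed
qed

lemma subword_matrix_one: "length w = N \<Longrightarrow> subword_matrix w \<one>\<^bsub>W\<^esub> = \<one>\<^bsub>U\<^esub>"
  by (auto simp: fun_eq_iff subword_matrix_def magnus_one one_entry)

lemma finite_magnus: "finite (carrier W)"
proof -
  let ?V = "{w. set w \<subseteq> Y \<and> length w \<le> N}"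
  let ?F = "{f. \<forall>x. (x \<in> ?V \<longrightarrow> f x \<in> {0..<int p}) \<and> (x \<notin> ?V \<longrightarrow> f x = 0)}"
  have "finite ?F" using finite_lists_length_le[OF fin_Y] by (intro finite_set_of_finite_funs) auto
  moreover have "carrier W \<subseteq> ?F" using magnusD by (fastforce simp: not_le)
  ultimately show ?thesis by (rule finite_subset[rotated])
qed

text \<open>Associativity, units and cancellation are inherited from the unitriangular group, since
  the maps \<open>subword_matrix w\<close> are multiplicative and jointly injective.\<close>

lemma group_magnus: "group W"
proof (rule finite_cancel_group[OF _ finite_magnus])
  show "monoid W"
  proof (rule monoidI)
    fix a b c assume "a \<in> carrier W" "b \<in> carrier W" "c \<in> carrier W"
    then show "a \<otimes>\<^bsub>W\<^esub> b \<otimes>\<^bsub>W\<^esub> c = a \<otimes>\<^bsub>W\<^esub> (b \<otimes>\<^bsub>W\<^esub> c)"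
      by (intro eq_if_subword_matrix_eq)
         (simp_all add: mult_closed subword_matrix_mult U.m_assoc subword_matrix_carrier)
  next
    fix a assume "a \<in> carrier W"
    then show "\<one>\<^bsub>W\<^esub> \<otimes>\<^bsub>W\<^esub> a = a" "a \<otimes>\<^bsub>W\<^esub> \<one>\<^bsub>W\<^esub> = a"
      by (intro eq_if_subword_matrix_eq;
          simp add: mult_closed one_closed subword_matrix_mult subword_matrix_one subword_matrix_carrier)+
  qed (simp_all add: mult_closed one_closed)
  fix a b c assume *: "a \<in> carrier W" "b \<in> carrier W" "c \<in> carrier W" and eq: "a \<otimes>\<^bsub>W\<^esub> b = a \<otimes>\<^bsub>W\<^esub> c"
  show "b = c"
  proof (rule eq_if_subword_matrix_eq[OF *(2,3)])
    fix w :: "'b list" assume w: "length w = N" "set w \<subseteq> Y"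
    have "subword_matrix w a \<otimes>\<^bsub>U\<^esub> subword_matrix w b = subword_matrix w a \<otimes>\<^bsub>U\<^esub> subword_matrix w c"
      using eq * w by (simp flip: subword_matrix_mult)
    then show "subword_matrix w b = subword_matrix w c" using * w by (simp add: subword_matrix_carrier)
  qed
qed

lemma subword_matrix_hom: "length w = N \<Longrightarrow> set w \<subseteq> Y \<Longrightarrow> subword_matrix w \<in> hom W U"
  by (intro homI) (simp_all add: subword_matrix_carrier subword_matrix_mult)

end

section \<open>The Zassenhaus filtration\<close>

lemma ceil_div:
  fixes m p :: nat
  assumes "2 \<le> p" 
  shows "2 \<le> m \<Longrightarrow> (m + p - 1) div p < m" "m \<le> p * ((m + p - 1) div p)" "(p * i + p - 1) div p = i"
proof -
  show "(p * i + p - 1) div p = i"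
    using assms by (intro div_nat_eqI) (auto simp: algebra_simps)
  show "m \<le> p * ((m + p - 1) div p)"
  proof -
    have "m + p - 1 = p * ((m + p - 1) div p) + (m + p - 1) mod p" by simp
    moreover have "(m + p - 1) mod p < p" using assms by simp
    ultimately show ?thesis by linarith
  qed
  show "(m + p - 1) div p < m" if "2 \<le> m"
  proof -
    have "m + p - 1 < m * p"
      using that assms
      by (induction m rule: dec_induct) auto
    then show ?thesis using assms by (simp add: less_mult_imp_div_less)
  qed
qed

locale top_carrier = group G for G (structure) +
  fixes T :: "'a topology" and p :: nat
  assumes topspace_T: "topspace T = carrier G" and p2: "2 \<le> p"
begin

lemma closed_gen_subgroup: "subgroup (closed_gen G T A) G" if "A \<subseteq> carrier G"
  unfolding closed_gen_def
  using that closedin_topspace[of T] by (intro subgroups_Inter) (auto simp: topspace_T subgroup_self)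

lemma closed_gen_closed: "A \<subseteq> carrier G \<Longrightarrow> closedin T (closed_gen G T A)"
  unfolding closed_gen_def
  using closedin_topspace[of T] subgroup_self by (intro closedin_Inter) (auto simp: topspace_T)

lemma closed_gen_incl: "A \<subseteq> closed_gen G T A"
  by (auto simp: closed_gen_def)

lemma closed_gen_least: "subgroup H G \<Longrightarrow> closedin T H \<Longrightarrow> A \<subseteq> H \<Longrightarrow> closed_gen G T A \<subseteq> H"
  by (auto simp: closed_gen_def)

abbreviation "Z \<equiv> zass G T p"

definition zgen :: "(nat \<Rightarrow> 'a set) \<Rightarrow> nat \<Rightarrow> 'a set" where
  "zgen f m = {x [^] p | x. x \<in> f ((m + p - 1) div p)}
       \<union> {x \<otimes> y \<otimes> inv x \<otimes> inv y | x y i j. 1 \<le> i \<and> 1 \<le> j \<and> i + j = m \<and> x \<in> f i \<and> y \<in> f j}"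

lemma zass_step_eq: "zass_step G T p f m = (if m \<le> 1 then carrier G else closed_gen G T (zgen f m))"
  by (simp add: zass_step_def zgen_def)

lemma zgen_mono:
  assumes "2 \<le> m" "\<And>i. i < m \<Longrightarrow> f i \<subseteq> f' i" shows "zgen f m \<subseteq> zgen f' m"
proof
  fix z assume "z \<in> zgen f m"
  then consider x where "z = x [^] p" "x \<in> f ((m + p - 1) div p)"
    | x y i j where "z = x \<otimes> y \<otimes> inv x \<otimes> inv y" "1 \<le> i" "1 \<le> j" "i + j = m" "x \<in> f i" "y \<in> f j"
    unfolding zgen_def by blast
  then show "z \<in> zgen f' m"
  proof cases
    case 1
    then have "x \<in> f' ((m + p - 1) div p)" using assms(2) ceil_div(1)[OF p2 assms(1)] by blast
    then show ?thesis unfolding zgen_def using 1 by blast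
  next
    case 2
    then have "x \<in> f' i" "y \<in> f' j" using assms(2)[of i] assms(2)[of j] by auto
    then show ?thesis unfolding zgen_def using 2 by blast
  qed
qed

lemma zgen_cong: "2 \<le> m \<Longrightarrow> (\<And>i. i < m \<Longrightarrow> f i = f' i) \<Longrightarrow> zgen f m = zgen f' m"
  by (intro equalityI zgen_mono) simp_all

text \<open>Level \<open>m\<close> refers only to strictly smaller levels, also in the power part
  because the ceiling of m/p is below \<open>m\<close> for \<open>2 \<le> m\<close>. Once the lower
  levels are stable, so is this one.\<close>

lemma zass_iter_stable: "m \<le> Suc k \<Longrightarrow> zass_iter G T p (Suc k) m = zass_iter G T p k m"
proof (induction k arbitrary: m)
  case (Suc k)
  show ?case
  proof (cases "m \<le> 1")
    case False
    have "zgen (zass_iter G T p (Suc k)) m = zgen (zass_iter G T p k) m"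
      using False Suc by (intro zgen_cong) auto
    then show ?thesis using False unfolding zass_iter.simps(2)[of _ _ _ "Suc k"] zass_iter.simps(2)[of _ _ _ k]
      by (simp add: zass_step_eq)
  qed (simp add: zass_step_eq)
qed (simp add: zass_step_eq)

lemma zass_iter_eq: "m \<le> k \<Longrightarrow> zass_iter G T p k m = Z m"
  by (induction k rule: dec_induct) (simp_all add: zass_def zass_iter_stable del: zass_iter.simps)

lemma zass_01: "m \<le> 1 \<Longrightarrow> Z m = carrier G"
  by (cases m) (simp_all add: zass_def zass_step_eq)

lemma zass_rec: "2 \<le> m \<Longrightarrow> Z m = closed_gen G T (zgen Z m)"
proof -
  assume m: "2 \<le> m"
  then obtain k where k: "m = Suc k" by (cases m) auto
  have "zgen (zass_iter G T p k) m = zgen Z m"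
    using m k by (intro zgen_cong) (auto simp: zass_iter_eq)
  then show ?thesis using m k by (simp add: zass_def zass_step_eq)
qed

lemma zass_props: "subgroup (Z m) G" "closedin T (Z m)"
proof -
  have "subgroup (Z m) G \<and> closedin T (Z m)"
  proof (induction m rule: less_induct)
    case (less m)
    show ?case
    proof (cases "m \<le> 1")
      case True
      then show ?thesis using closedin_topspace[of T] by (simp add: zass_01 subgroup_self topspace_T)
    next
      case False
      have sub: "Z i \<subseteq> carrier G" if "i < m" for i using less that by (simp add: subgroup.subset)
      have "zgen Z m \<subseteq> carrier G"
      proof
        fix z assume "z \<in> zgen Z m"
        then consider x where "z = x [^] p" "x \<in> Z ((m + p - 1) div p)"
          | x y i j where "z = x \<otimes> y \<otimes> inv x \<otimes> inv y" "1 \<le> i" "1 \<le> j" "i + j = m" "x \<in> Z i" "y \<in> Z j"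
          unfolding zgen_def by blast
        then show "z \<in> carrier G"
        proof cases
          case 1 then show ?thesis using sub[of "(m + p - 1) div p"] False ceil_div(1)[OF p2, of m] by auto
        next
          case 2
          then have "x \<in> carrier G" "y \<in> carrier G" using sub[of i] sub[of j] by auto
          then show ?thesis using 2 by simp
        qed
      qed
      then show ?thesis using False by (simp add: zass_rec closed_gen_subgroup closed_gen_closed)
    qed
  qed
  then show "subgroup (Z m) G" "closedin T (Z m)" by auto
qed

lemma zass_carrier: "x \<in> Z m \<Longrightarrow> x \<in> carrier G"
  using zass_props(1) subgroup.mem_carrier by metis

lemma zass_commutator:
  assumes "1 \<le> i" "1 \<le> j" "x \<in> Z i" "y \<in> Z j" shows "x \<otimes> y \<otimes> inv x \<otimes> inv y \<in> Z (i + j)"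
proof -
  have "x \<otimes> y \<otimes> inv x \<otimes> inv y \<in> zgen Z (i + j)" using assms unfolding zgen_def by blast
  then show ?thesis using assms closed_gen_incl by (auto simp: zass_rec)
qed

lemma zass_power_ceil:
  assumes "2 \<le> m" "x \<in> Z ((m + p - 1) div p)" shows "x [^] p \<in> Z m"
proof -
  have "x [^] p \<in> zgen Z m" using assms unfolding zgen_def by blast
  then show ?thesis using assms closed_gen_incl by (auto simp: zass_rec)
qed

text \<open>The induction principle of the filtration. The closure conditions may assume that the
  elements already lie in \<open>Z\<close>; the comparison of consecutive terms below relies on
  this.\<close>

lemma zass_least:
  assumes sub: "\<And>m. subgroup (F m) G" and clo: "\<And>m. closedin T (F m)"
    and F1: "\<And>m. m \<le> 1 \<Longrightarrow> F m = carrier G"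
    and pow: "\<And>m x. 2 \<le> m \<Longrightarrow> x \<in> Z ((m + p - 1) div p) \<Longrightarrow> x \<in> F ((m + p - 1) div p) \<Longrightarrow> x [^] p \<in> F m"
    and comm: "\<And>i j x y. 1 \<le> i \<Longrightarrow> 1 \<le> j \<Longrightarrow> x \<in> Z i \<Longrightarrow> y \<in> Z j \<Longrightarrow> x \<in> F i \<Longrightarrow> y \<in> F j \<Longrightarrow>
      x \<otimes> y \<otimes> inv x \<otimes> inv y \<in> F (i + j)"
  shows "Z m \<subseteq> F m"
proof (induction m rule: less_induct)
  case (less m)
  show ?case
  proof (cases "m \<le> 1")
    case True then show ?thesis by (simp add: zass_01 F1)
  next
    case False
    have "zgen Z m \<subseteq> F m"
    proof
      fix z assume "z \<in> zgen Z m"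
      then consider x where "z = x [^] p" "x \<in> Z ((m + p - 1) div p)"
        | x y i j where "z = x \<otimes> y \<otimes> inv x \<otimes> inv y" "1 \<le> i" "1 \<le> j" "i + j = m" "x \<in> Z i" "y \<in> Z j"
        unfolding zgen_def by blast
      then show "z \<in> F m"
      proof cases
        case 1 then show ?thesis using less[of "(m + p - 1) div p"] False ceil_div(1)[OF p2, of m] pow by auto
      next
        case 2 then show ?thesis using less[of i] less[of j] comm[of i j x y] by auto
      qed
    qed
    then show ?thesis using False sub clo by (simp add: zass_rec closed_gen_least)
  qed
qed

lemma zass_Suc: "Z (Suc m) \<subseteq> Z m"
proof -
  have "Z m \<subseteq> Z (m - 1)" for m
  proof (rule zass_least[of "\<lambda>m. Z (m - 1)"])
    fix m x assume m: "2 \<le> m" and x: "x \<in> Z ((m + p - 1) div p)" "x \<in> Z ((m + p - 1) div p - 1)"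
    show "x [^] p \<in> Z (m - 1)"
    proof (cases "m = 2")
      case True then show ?thesis using zass_carrier[OF x(1)] by (simp add: zass_01)
    next
      case False
      \<comment> \<open>Passing from \<open>m\<close> to \<open>m - 1\<close> lowers the ceiling of
        the quotient by p at most by one, and \<open>x\<close> lies in both of the levels that can
        occur.\<close>
      define a b where "a = (m + p - 1) div p" and "b = (m - 1 + p - 1) div p"
      have "b \<le> a" unfolding a_def b_def by (intro div_le_mono) auto
      moreover have "a \<le> Suc b"
      proof -
        have "m + p - 1 = Suc (m - 1 + p - 1)" using m p2 by simp
        then have "a = Suc (m - 1 + p - 1) div p" unfolding a_def by (rule arg_cong)
        then show ?thesis unfolding b_def div_Suc by (simp split: if_splits)
      qed
      ultimately have "b = a \<or> b = a - 1" by linarith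
      then have "x \<in> Z b" using x unfolding a_def by metis
      then show ?thesis using False m unfolding b_def by (intro zass_power_ceil) auto
    qed
  next
    fix i j x y assume ij: "1 \<le> i" "1 \<le> j" and xy: "x \<in> Z i" "y \<in> Z j" "x \<in> Z (i - 1)" "y \<in> Z (j - 1)"
    \<comment> \<open>One index that is at least 2 can be lowered by one. If both are 1, the target
      is level 1, the whole group.\<close>
    consider "2 \<le> i" | "2 \<le> j" | "i = 1" "j = 1" using ij by linarith
    then show "x \<otimes> y \<otimes> inv x \<otimes> inv y \<in> Z (i + j - 1)"
    proof cases
      case 1 then show ?thesis using zass_commutator[of "i - 1" j x y] ij xy by simp
    next
      case 2 then show ?thesis using zass_commutator[of i "j - 1" x y] ij xy by simp
    next
      case 3 then show ?thesis using xy zass_carrier by (simp add: zass_01)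
    qed
  qed (auto simp: zass_props zass_01)
  from this[of "Suc m"] show ?thesis by simp
qed

lemma zass_power: assumes "x \<in> Z i" shows "x [^] p \<in> Z (p * i)"
proof (cases "p * i \<le> 1")
  case False
  then show ?thesis using zass_power_ceil[of "p * i" x, unfolded ceil_div(3)[OF p2]] assms by simp
qed (use assms zass_carrier in \<open>simp add: zass_01\<close>)

lemma zass_normal: "Z m \<lhd> G"
proof (cases "m \<le> 1")
  case True
  then show ?thesis using normal_self by (simp add: zass_01)
next
  case False
  show ?thesis
  proof (rule normal_invI[OF zass_props(1)])
    fix g h assume g: "g \<in> carrier G" and h: "h \<in> Z m"
    have hc: "h \<in> carrier G" using h by (rule zass_carrier)
    have "g \<in> Z 1" using g by (simp add: zass_01)
    from zass_commutator[OF _ _ this h] have "g \<otimes> h \<otimes> inv g \<otimes> inv h \<in> Z (1 + m)" using False by simp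
    then have "g \<otimes> h \<otimes> inv g \<otimes> inv h \<in> Z m" using zass_Suc[of m] by auto
    from subgroup.m_closed[OF zass_props(1) this h] show "g \<otimes> h \<otimes> inv g \<in> Z m"
      using g hc by (simp add: m_assoc)
  qed
qed

text \<open>Index 0 is covered by normality. \<open>np_series\<close> asks for the commutator law
  from index 0 on.\<close>

lemma zass_commutator0:
  assumes "x \<in> Z i" "y \<in> Z j" shows "x \<otimes> y \<otimes> inv x \<otimes> inv y \<in> Z (i + j)"
proof -
  have xc: "x \<in> carrier G" "y \<in> carrier G" using assms zass_carrier by auto
  consider "i = 0" | "j = 0" | "1 \<le> i" "1 \<le> j" by linarith
  then show ?thesis
  proof cases
    case 1
    have "x \<otimes> y \<otimes> inv x \<in> Z j" using normal.inv_op_closed2[OF zass_normal xc(1) assms(2)] .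
    then show ?thesis using 1 assms zass_props(1) by (simp add: subgroup.m_closed subgroup.m_inv_closed)
  next
    case 2
    have "y \<otimes> inv x \<otimes> inv y \<in> Z i"
      using normal.inv_op_closed2[OF zass_normal xc(2), of "inv x" i] assms zass_props(1)
      by (simp add: subgroup.m_inv_closed)
    from subgroup.m_closed[OF zass_props(1) assms(1) this] show ?thesis using 2 xc by (simp add: m_assoc)
  qed (use assms zass_commutator in auto)
qed

end

section \<open>Profinite and free profinite groups\<close>

lemma locally_const_combine:
  assumes "continuous_map T (discrete_topology A) f" "continuous_map T (discrete_topology B) g"
    and "\<And>a b. a \<in> A \<Longrightarrow> b \<in> B \<Longrightarrow> F a b \<in> C"
  shows "continuous_map T (discrete_topology C) (\<lambda>x. F (f x) (g x))"
proof -
  have "continuous_map T (discrete_topology (A \<times> B)) (\<lambda>x. (f x, g x))"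
    using assms by (simp add: prod_topology_discrete_topology continuous_map_paired)
  moreover have "continuous_map (discrete_topology (A \<times> B)) (discrete_topology C) (\<lambda>(a, b). F a b)"
    using assms(3) by auto
  ultimately have "continuous_map T (discrete_topology C) ((\<lambda>(a, b). F a b) \<circ> (\<lambda>x. (f x, g x)))"
    by (rule continuous_map_compose)
  then show ?thesis by (simp add: o_def)
qed

lemma locally_const_compose:
  assumes "continuous_map T (discrete_topology A) f" "\<And>a. a \<in> A \<Longrightarrow> F a \<in> C"
  shows "continuous_map T (discrete_topology C) (\<lambda>x. F (f x))"
proof -
  have "continuous_map (discrete_topology A) (discrete_topology C) F" using assms by auto
  from continuous_map_compose[OF assms(1) this] show ?thesis by (simp add: o_def)
qed

lemma clopen_indicator:
  assumes "openin T W" "closedin T W" shows "continuous_map T (discrete_topology UNIV) (\<lambda>x. x \<in> W)"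
proof -
  have "openin T {x \<in> topspace T. x \<in> W \<longleftrightarrow> b}" for b
  proof (cases b)
    case True
    then have "{x \<in> topspace T. x \<in> W \<longleftrightarrow> b} = W" using openin_subset[OF assms(1)] by auto
    then show ?thesis using assms by simp
  next
    case False
    then have "{x \<in> topspace T. x \<in> W \<longleftrightarrow> b} = topspace T - W" by auto
    then show ?thesis using assms(2) by (simp add: openin_diff)
  qed
  moreover have "{x \<in> topspace T. (x \<in> W) \<in> V} = (\<Union>b\<in>V. {x \<in> topspace T. x \<in> W \<longleftrightarrow> b})" for V by auto
  ultimately show ?thesis by (auto simp: continuous_map_def)
qed

text \<open>In a compact Hausdorff space components are quasi-components, and a quasi-component is
  separated from a disjoint compact set by a clopen set.\<close>

lemma totally_disconnected_clopen:
  assumes "compact_space T" "Hausdorff_space T" "connected_component_of_set T x = {x}"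
    and "openin T V" "x \<in> V"
  obtains W where "openin T W" "closedin T W" "x \<in> W" "W \<subseteq> V"
proof -
  have x: "x \<in> topspace T" using assms openin_subset by blast
  have q: "quasi_component_of_set T x = {x}"
    using quasi_eq_connected_component_of[of T x] assms by simp
  then have "{x} \<in> quasi_components_of T" using x by (auto simp: quasi_components_of_def)
  moreover have "compactin T (topspace T - V)"
    using assms by (intro closedin_compact_space) auto
  moreover have "disjnt {x} (topspace T - V)" using assms by (auto simp: disjnt_iff)
  ultimately have "separated_between T {x} (topspace T - V)"
    by (simp add: separated_between_quasi_component_compact)
  then obtain W W' where W: "openin T W" "openin T W'" "W \<union> W' = topspace T" "disjnt W W'" "{x} \<subseteq> W" "topspace T - V \<subseteq> W'"
    unfolding separated_between_def by blast
  then have "W = topspace T - W'" by (auto simp: disjnt_iff)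
  then have "closedin T W" using W by auto
  then show thesis using that W by (auto simp: disjnt_iff)
qed

locale topological_group = group G for G (structure) +
  fixes T :: "'a topology"
  assumes top: "topgroup G T"
begin

lemma topspace_T: "topspace T = carrier G"
  and mult_cont: "continuous_map (prod_topology T T) T (\<lambda>(x, y). x \<otimes> y)"
  and inv_cont: "continuous_map T T (\<lambda>x. inv x)"
  using top by (auto simp: topgroup_def)

lemma mult_cont_compose:
  assumes "continuous_map Y T f" "continuous_map Y T g" shows "continuous_map Y T (\<lambda>x. f x \<otimes> g x)"
proof -
  have "continuous_map Y (prod_topology T T) (\<lambda>x. (f x, g x))" using assms by (simp add: continuous_map_paired)
  from continuous_map_compose[OF this mult_cont] show ?thesis by (simp add: o_def)
qed

lemma left_translation_cont: "a \<in> carrier G \<Longrightarrow> continuous_map T T (\<lambda>x. a \<otimes> x)"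
  using mult_cont_compose[of T "\<lambda>_. a" "\<lambda>x. x"] by (simp add: topspace_T)

text \<open>The elements that may be cancelled in every membership test for a clopen \<open>W\<close> form an open normal subgroup inside \<open>W\<close>;
  openness holds because the projection along the compact square of the group is closed.\<close>
lemma open_normal_in_clopen:
  assumes comp: "compact_space T" and W: "openin T W" "closedin T W" "\<one> \<in> W"
  obtains K where "K \<lhd> G" "openin T K" "K \<subseteq> W"
proof -
  define K where "K = {x \<in> carrier G. \<forall>a\<in>carrier G. \<forall>b\<in>carrier G. a \<otimes> x \<otimes> b \<in> W \<longleftrightarrow> a \<otimes> b \<in> W}"
  let ?X = "prod_topology (prod_topology T T) T"
  define D where "D = {z \<in> topspace ?X. ((fst (fst z) \<otimes> snd z \<otimes> snd (fst z) \<in> W) \<noteq> (fst (fst z) \<otimes> snd (fst z) \<in> W)) \<in> {True}}"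
  have fsts: "continuous_map ?X T (\<lambda>z. fst (fst z))" "continuous_map ?X T (\<lambda>z. snd (fst z))" "continuous_map ?X T snd"
    using continuous_map_compose[OF continuous_map_fst[of "prod_topology T T" T] continuous_map_fst[of T T]]
      continuous_map_compose[OF continuous_map_fst[of "prod_topology T T" T] continuous_map_snd[of T T]]
    by (simp_all add: o_def continuous_map_snd)
  have ind: "continuous_map ?X (discrete_topology UNIV) (\<lambda>z. f z \<in> W)" if "continuous_map ?X T f" for f
    using continuous_map_compose[OF that clopen_indicator[OF W(1,2)]] by (simp add: o_def)
  have "continuous_map ?X (discrete_topology UNIV)
      (\<lambda>z. (fst (fst z) \<otimes> snd z \<otimes> snd (fst z) \<in> W) \<noteq> (fst (fst z) \<otimes> snd (fst z) \<in> W))"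
    by (intro locally_const_combine[of _ UNIV _ UNIV _ "\<lambda>a b. a \<noteq> b"] ind mult_cont_compose fsts) auto
  then have "closedin ?X D" unfolding D_def by (rule closedin_continuous_map_preimage) auto
  moreover have "closed_map ?X T snd"
    using comp by (intro closed_map_snd) (simp add: compact_space_prod_topology)
  ultimately have "closedin T (snd ` D)" by (simp add: closed_map_def)
  moreover have "K = topspace T - snd ` D"
  proof (intro equalityI subsetI)
    fix x assume "x \<in> K" then show "x \<in> topspace T - snd ` D"
      by (auto simp: K_def D_def topspace_T)
  next
    fix x assume x: "x \<in> topspace T - snd ` D"
    then have "((a, b), x) \<notin> D" for a b by (metis DiffD2 imageI snd_conv)
    then show "x \<in> K" using x by (auto simp: K_def D_def topspace_T)
  qed
  ultimately have op: "openin T K" by auto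
  have KW: "K \<subseteq> W"
  proof
    fix x assume "x \<in> K"
    then have "\<one> \<otimes> x \<otimes> \<one> \<in> W \<longleftrightarrow> \<one> \<otimes> \<one> \<in> W" "x \<in> carrier G" unfolding K_def by blast+
    then show "x \<in> W" using W(3) by simp
  qed
  have "K \<lhd> G"
  proof (rule normal_invI)
    show "subgroup K G"
    proof (rule subgroupI)
      show "K \<subseteq> carrier G" by (auto simp: K_def)
      show "K \<noteq> {}" by (auto simp: K_def intro!: exI[of _ \<one>])
    next
      fix x assume x: "x \<in> K"
      have "a \<otimes> inv x \<otimes> b \<in> W \<longleftrightarrow> a \<otimes> b \<in> W" if "a \<in> carrier G" "b \<in> carrier G" for a b
      proof -
        have "(a \<otimes> inv x) \<otimes> x \<otimes> b \<in> W \<longleftrightarrow> (a \<otimes> inv x) \<otimes> b \<in> W" using x that by (auto simp: K_def)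
        then show ?thesis using x that by (simp add: K_def m_assoc)
      qed
      then show "inv x \<in> K" using x by (auto simp: K_def)
    next
      fix x y assume x: "x \<in> K" and y: "y \<in> K"
      have "a \<otimes> (x \<otimes> y) \<otimes> b \<in> W \<longleftrightarrow> a \<otimes> b \<in> W" if "a \<in> carrier G" "b \<in> carrier G" for a b
      proof -
        have "a \<otimes> x \<otimes> (y \<otimes> b) \<in> W \<longleftrightarrow> a \<otimes> (y \<otimes> b) \<in> W" "a \<otimes> y \<otimes> b \<in> W \<longleftrightarrow> a \<otimes> b \<in> W"
          using x y that by (auto simp: K_def)
        then show ?thesis using x y that by (simp add: K_def m_assoc)
      qed
      then show "x \<otimes> y \<in> K" using x y by (auto simp: K_def)
    qed
  next
    fix g x assume g: "g \<in> carrier G" and x: "x \<in> K"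
    have "a \<otimes> (g \<otimes> x \<otimes> inv g) \<otimes> b \<in> W \<longleftrightarrow> a \<otimes> b \<in> W" if "a \<in> carrier G" "b \<in> carrier G" for a b
    proof -
      have "(a \<otimes> g) \<otimes> x \<otimes> (inv g \<otimes> b) \<in> W \<longleftrightarrow> (a \<otimes> g) \<otimes> (inv g \<otimes> b) \<in> W"
        using x g that by (auto simp: K_def)
      moreover have "(a \<otimes> g) \<otimes> (inv g \<otimes> b) = a \<otimes> b" using g that
        by (metis inv_closed m_assoc m_closed r_inv r_one)
      ultimately show ?thesis using x g that by (simp add: K_def m_assoc)
    qed
    then show "g \<otimes> x \<otimes> inv g \<in> K" using x g by (auto simp: K_def)
  qed
  then show thesis using that op KW by blast
qed

text \<open>The cosets form a disjoint open cover, so a finite subcover must contain all of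
  them.\<close>

lemma open_subgroup_cosets_finite:
  assumes comp: "compact_space T" and K: "subgroup K G" "openin T K"
  shows "finite (rcosets K)" "C \<in> rcosets K \<Longrightarrow> openin T C"
proof -
  have op: "openin T (K #> a)" if a: "a \<in> carrier G" for a
  proof -
    have "continuous_map T T (\<lambda>x. x \<otimes> inv a)"
      using mult_cont_compose[of T "\<lambda>x. x" "\<lambda>_. inv a"] a by (simp add: topspace_T)
    then have "openin T {x \<in> topspace T. x \<otimes> inv a \<in> K}" using K by (simp add: openin_continuous_map_preimage)
    moreover have "{x \<in> topspace T. x \<otimes> inv a \<in> K} = K #> a"
      using subgroup.rcos_module[OF K(1) is_group a] r_coset_subset_G[OF subgroup.subset[OF K(1)] a]
      by (auto simp: topspace_T)
    ultimately show ?thesis by simp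
  qed
  then show "C \<in> rcosets K \<Longrightarrow> openin T C" by (auto simp: RCOSETS_def)
  have "\<exists>F. finite F \<and> F \<subseteq> rcosets K \<and> topspace T \<subseteq> \<Union>F"
    using comp op rcosets_part_G[OF K(1)] unfolding compact_space_alt
    by (metis (no_types, lifting) RCOSETS_def UN_E singletonD topspace_T order_refl)
  then obtain F where F: "finite F" "F \<subseteq> rcosets K" "carrier G \<subseteq> \<Union>F" by (auto simp: topspace_T)
  have "rcosets K \<subseteq> F"
  proof
    fix C assume C: "C \<in> rcosets K"
    then obtain a where a: "a \<in> carrier G" "C = K #> a" by (auto simp: RCOSETS_def)
    then have "a \<in> C" using rcos_self K by auto
    then obtain Y where Y: "Y \<in> F" "a \<in> Y" using F a by blast
    then have "C = Y" using rcos_disjoint[OF K(1)] C F \<open>a \<in> C\<close>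
      by (meson disjointD disjoint_iff pairwiseD disjnt_iff subsetD)
    then show "C \<in> F" using Y by simp
  qed
  then show "finite (rcosets K)" using F finite_subset by blast
qed

end

lemma cont_hom_finD:
  assumes "h \<in> cont_hom_fin G T H"
  shows "h \<in> hom G H" "continuous_map T (discrete_topology (carrier H)) h"
  using assms by (auto simp: cont_hom_fin_def)

lemma cont_hom_fin_compose:
  assumes "h \<in> cont_hom_fin G T H" "f \<in> hom H K"
  shows "(\<lambda>x. f (h x)) \<in> cont_hom_fin G T K"
proof -
  have h: "h \<in> hom G H" "continuous_map T (discrete_topology (carrier H)) h" using assms(1) by (auto simp: cont_hom_fin_def)
  have "(\<lambda>x. f (h x)) \<in> hom G K" using Group.hom_compose[OF h(1) assms(2)] by (simp add: o_def)
  moreover have "continuous_map T (discrete_topology (carrier K)) (\<lambda>x. f (h x))"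
    using h(2) by (rule locally_const_compose) (use assms(2) in \<open>auto simp: hom_def\<close>)
  ultimately show ?thesis by (simp add: cont_hom_fin_def)
qed

text \<open>The universal property in \<open>free_profinite\<close> quantifies over finite groups of
  natural numbers; other finite groups are reached through an isomorphic copy.\<close>

lemma (in group) nat_copy:
  assumes "finite (carrier G)"
  obtains H :: "nat monoid" and \<beta> where "group H" "finite (carrier H)" "\<beta> \<in> iso G H"
proof -
  obtain \<beta> :: "'a \<Rightarrow> nat" where \<beta>: "inj_on \<beta> (carrier G)" using assms by (metis finite_imp_inj_to_nat_seg)
  show thesis
    by (rule that[OF inj_imp_image_group_is_group[OF \<beta>] _ inj_imp_image_group_iso[OF \<beta>]])
       (simp add: image_group_carrier assms)
qed

locale free_pro = topological_group S T for S (structure) and T +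
  fixes B :: "'x set" and emb :: "'x \<Rightarrow> 'a"
  assumes free: "free_profinite S T B emb"
begin

lemma compact_T: "compact_space T" and Hausdorff_T: "Hausdorff_space T"
  and components: "x \<in> carrier S \<Longrightarrow> connected_component_of_set T x = {x}"
  using free topspace_T by (auto simp: free_profinite_def profinite_def)

lemma emb_carrier: "x \<in> B \<Longrightarrow> emb x \<in> carrier S"
  using free by (auto simp: free_profinite_def)

lemma open_normal_base:
  assumes "openin T V" "\<one> \<in> V"
  obtains K where "K \<lhd> S" "openin T K" "K \<subseteq> V"
proof -
  obtain W where "openin T W" "closedin T W" "\<one> \<in> W" "W \<subseteq> V"
    using totally_disconnected_clopen[OF compact_T Hausdorff_T components assms] by blast
  then show thesis using open_normal_in_clopen[OF compact_T, of W] that by (metis order_trans)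
qed

lemma support_finite:
  assumes "group H" "h \<in> cont_hom_fin S T H" shows "finite {x \<in> B. h (emb x) \<noteq> \<one>\<^bsub>H\<^esub>}"
proof -
  note h = cont_hom_finD[OF assms(2)]
  have one: "h \<one> = \<one>\<^bsub>H\<^esub>" using h(1) assms(1) is_group by (simp add: hom_one)
  have "openin T {x \<in> topspace T. h x \<in> {\<one>\<^bsub>H\<^esub>}}"
    using h(2) by (rule openin_continuous_map_preimage) (simp add: assms(1) group.is_monoid monoid.one_closed)
  moreover have "\<one> \<in> {x \<in> topspace T. h x \<in> {\<one>\<^bsub>H\<^esub>}}" using one by (simp add: topspace_T)
  ultimately have "finite {x \<in> B. emb x \<notin> {x \<in> topspace T. h x \<in> {\<one>\<^bsub>H\<^esub>}}}"
    using free unfolding free_profinite_def by blast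
  then show ?thesis by (rule rev_finite_subset) auto
qed

lemma extend:
  fixes H :: "'c monoid"
  assumes H: "group H" "finite (carrier H)" and f: "f \<in> B \<rightarrow> carrier H" "finite {x \<in> B. f x \<noteq> \<one>\<^bsub>H\<^esub>}"
  obtains h where "h \<in> cont_hom_fin S T H" "\<And>x. x \<in> B \<Longrightarrow> h (emb x) = f x"
proof -
  interpret H: group H by fact
  obtain K :: "nat monoid" and \<beta> where K: "group K" "finite (carrier K)" "\<beta> \<in> iso H K"
    using H.nat_copy[OF H(2)] by blast
  have b1: "\<beta> \<one>\<^bsub>H\<^esub> = \<one>\<^bsub>K\<^esub>" using K H by (simp add: hom_one iso_imp_homomorphism)
  define \<gamma> where "\<gamma> = inv_into (carrier H) \<beta>"
  have \<gamma>: "\<gamma> \<in> iso K H" unfolding \<gamma>_def using H.iso_set_sym K(3) by blast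
  have bij: "bij_betw \<beta> (carrier H) (carrier K)" using K(3) by (simp add: iso_def)
  have "(\<lambda>x. \<beta> (f x)) \<in> B \<rightarrow> carrier K" using f(1) bij by (auto simp: bij_betw_def)
  moreover have "finite {x \<in> B. \<beta> (f x) \<noteq> \<one>\<^bsub>K\<^esub>}"
    using f(2) by (rule rev_finite_subset) (use b1 in auto)
  ultimately obtain h where h: "h \<in> cont_hom_fin S T K" "\<And>x. x \<in> B \<Longrightarrow> h (emb x) = \<beta> (f x)"
    using free K(1,2) unfolding free_profinite_def by meson
  have "(\<lambda>x. \<gamma> (h x)) \<in> cont_hom_fin S T H"
    using cont_hom_fin_compose[OF h(1) iso_imp_homomorphism[OF \<gamma>]] .
  moreover have "\<gamma> (h (emb x)) = f x" if "x \<in> B" for x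
  proof -
    have "f x \<in> carrier H" using f(1) that by auto
    then show ?thesis using h(2)[OF that] bij by (simp add: \<gamma>_def bij_betw_def)
  qed
  ultimately show thesis using that by blast
qed

lemma extend_unique:
  fixes H :: "'c monoid"
  assumes H: "group H" "finite (carrier H)" and h: "h \<in> cont_hom_fin S T H" "h' \<in> cont_hom_fin S T H"
    and eq: "\<And>x. x \<in> B \<Longrightarrow> h (emb x) = h' (emb x)" and s: "s \<in> carrier S"
  shows "h s = h' s"
proof -
  interpret H: group H by fact
  obtain K :: "nat monoid" and \<beta> where K: "group K" "finite (carrier K)" "\<beta> \<in> iso H K"
    using H.nat_copy[OF H(2)] by blast
  have hom: "\<beta> \<in> hom H K" using K(3) by (rule iso_imp_homomorphism)
  have c: "(\<lambda>x. \<beta> (h x)) \<in> cont_hom_fin S T K" "(\<lambda>x. \<beta> (h' x)) \<in> cont_hom_fin S T K"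
    using cont_hom_fin_compose h hom by blast+
  have "(\<lambda>x. \<beta> (h (emb x))) \<in> B \<rightarrow> carrier K"
    using cont_hom_finD(1)[OF c(1)] emb_carrier by (auto simp: hom_def)
  moreover have "finite {x \<in> B. \<beta> (h (emb x)) \<noteq> \<one>\<^bsub>K\<^esub>}"
    using support_finite[OF K(1) c(1)] .
  ultimately have "\<exists>g\<in>cont_hom_fin S T K. (\<forall>x\<in>B. g (emb x) = \<beta> (h (emb x)))
      \<and> (\<forall>h'\<in>cont_hom_fin S T K. (\<forall>x\<in>B. h' (emb x) = \<beta> (h (emb x))) \<longrightarrow> (\<forall>s\<in>carrier S. h' s = g s))"
    using free K(1,2) unfolding free_profinite_def by (elim conjE allE[of _ K] allE[of _ "\<lambda>x. \<beta> (h (emb x))"]) auto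
  then obtain g where g: "\<And>k. k \<in> cont_hom_fin S T K \<Longrightarrow> (\<And>x. x \<in> B \<Longrightarrow> k (emb x) = \<beta> (h (emb x))) \<Longrightarrow> k s = g s"
    using s by blast
  have "\<beta> (h s) = \<beta> (h' s)" using g[OF c(1)] g[OF c(2)] eq by simp
  moreover have "h s \<in> carrier H" "h' s \<in> carrier H"
    using cont_hom_finD(1)[OF h(1)] cont_hom_finD(1)[OF h(2)] s by (auto simp: hom_def)
  ultimately show ?thesis using K(3) by (auto simp: iso_def bij_betw_def inj_on_def)
qed

text \<open>The values on the basis extend to a homomorphism into \<open>K\<close>, and uniqueness
  identifies it with \<open>h\<close>. This takes the place of the density of the subgroup generated
  by the basis.\<close>

lemma image_in_subgroup:
  fixes H :: "'c monoid"
  assumes H: "group H" "finite (carrier H)" and h: "h \<in> cont_hom_fin S T H"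
    and K: "subgroup K H" "\<And>x. x \<in> B \<Longrightarrow> h (emb x) \<in> K" and s: "s \<in> carrier S"
  shows "h s \<in> K"
proof -
  let ?K = "H\<lparr>carrier := K\<rparr>"
  have sub: "K \<subseteq> carrier H" using K(1) by (rule subgroup.subset)
  have "group ?K" using K(1) H(1) by (rule subgroup.subgroup_is_group)
  moreover have "finite (carrier ?K)" using finite_subset[OF sub H(2)] by simp
  moreover have "(\<lambda>x. h (emb x)) \<in> B \<rightarrow> carrier ?K" using K(2) by simp
  moreover have "finite {x \<in> B. h (emb x) \<noteq> \<one>\<^bsub>?K\<^esub>}" using support_finite[OF H(1) h] by simp
  ultimately obtain g where g: "g \<in> cont_hom_fin S T ?K" "\<And>x. x \<in> B \<Longrightarrow> g (emb x) = h (emb x)"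
    by (rule extend) blast
  have "(\<lambda>x. x) \<in> hom ?K H" using sub by (auto simp: hom_def)
  from cont_hom_fin_compose[OF g(1) this] have "g \<in> cont_hom_fin S T H" by simp
  then have "h s = g s" by (rule extend_unique[OF H h _ _ s]) (simp add: g(2))
  moreover have "g s \<in> K" using cont_hom_finD(1)[OF g(1)] s by (auto simp: hom_def)
  ultimately show ?thesis by simp
qed

end

section \<open>Taylor expansion\<close>

lemma (in group) finite_submonoid_subgroup:
  assumes "finite (carrier G)" "K \<subseteq> carrier G" "\<one> \<in> K" "\<And>x y. x \<in> K \<Longrightarrow> y \<in> K \<Longrightarrow> x \<otimes> y \<in> K"
  shows "subgroup K G"
proof (rule subgroupI)
  fix x assume x: "x \<in> K"
  have "inj_on (\<lambda>y. x \<otimes> y) K" using assms x by (intro inj_onI) (metis l_cancel subsetD)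
  moreover have "(\<lambda>y. x \<otimes> y) ` K \<subseteq> K" using assms x by auto
  ultimately have "(\<lambda>y. x \<otimes> y) ` K = K"
    using finite_subset[OF assms(2,1)] by (simp add: endo_inj_surj)
  then obtain y where y: "y \<in> K" "\<one> = x \<otimes> y" using assms(3) by (metis imageE)
  then have "inv x = y" using x assms(2) by (metis inv_equality inv_comm subsetD)
  then show "inv x \<in> K" using y by simp
qed (use assms in auto)

lemma mod_sum_cong:
  fixes f g :: "'i \<Rightarrow> int"
  assumes "\<And>i. i \<in> A \<Longrightarrow> f i mod m = g i mod m" shows "sum f A mod m = sum g A mod m"
proof -
  have "(\<Sum>i\<in>A. f i mod m) = (\<Sum>i\<in>A. g i mod m)"
    using assms by (intro sum.cong) auto
  then have "(\<Sum>i\<in>A. f i mod m) mod m = (\<Sum>i\<in>A. g i mod m) mod m" by simp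
  then show ?thesis by (simp add: mod_sum_eq)
qed

text \<open>A series ending at \<open>Suc N\<close> goes with words of length at most
  \<open>N\<close>: a function of degree less than \<open>Suc N\<close> is killed by more than
  \<open>N\<close> differences along letters, each of which has weight 1.\<close>

locale taylor = np_series G p "Suc N" L + magnus_words p N Y
  for G (structure) and p N L and Y :: "'c set" +
  fixes \<gamma> :: "'c \<Rightarrow> 'a"
  assumes \<gamma>: "b \<in> Y \<Longrightarrow> \<gamma> b \<in> carrier G"
begin

definition Dw :: "'c list \<Rightarrow> ('a \<Rightarrow> int) \<Rightarrow> 'a \<Rightarrow> int" where
  "Dw w = Dl (map (\<lambda>b. (\<gamma> b, 1)) w)"

definition words :: "'c list set" where "words = {w. set w \<subseteq> Y \<and> length w \<le> N}"

lemma finite_words: "finite words"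
  unfolding words_def using finite_lists_length_le[OF fin_Y] by simp

lemma Dw_append: "Dw (w @ v) f = Dw w (Dw v f)"
  by (simp add: Dw_def)

lemma wl_word: "set w \<subseteq> Y \<Longrightarrow> map (\<lambda>b. (\<gamma> b, 1)) w \<in> wl (carrier G)"
  using \<gamma> L1 by (auto simp: wl_def)

lemma wt_word: "wt (map (\<lambda>b. (\<gamma> b, 1)) w) = int (length w)"
  by (induction w) auto

lemma Dw_zero: "f \<in> Fl (carrier G) (int (Suc N)) \<Longrightarrow> set w \<subseteq> Y \<Longrightarrow> N < length w \<Longrightarrow> x \<in> carrier G \<Longrightarrow>
    Dw w f x mod int p = 0"
  unfolding Dw_def using FlD[OF _ wl_word, of f _ w x] wt_word[of w] by (simp add: dvd_imp_mod_0)

lemma Dl_sum: "Dl hs (\<lambda>x. \<Sum>v\<in>V. c v * F v x) = (\<lambda>x. \<Sum>v\<in>V. c v * Dl hs (F v) x)"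
proof (induction hs)
  case (Cons a hs)
  then show ?case
    by (cases a) (simp add: fdiff_def fun_eq_iff sum_subtractf right_diff_distrib)
qed simp

text \<open>Right translation by \<open>s\<close> acts on functions of degree at most
  \<open>N\<close> as the noncommutative polynomial \<open>a\<close> in the differences along the
  letters. For a letter this is 1 plus the difference, which is Magnus' substitution.\<close>

definition expands :: "('c list \<Rightarrow> int) \<Rightarrow> 'a \<Rightarrow> bool" where
  "expands a s \<longleftrightarrow> (\<forall>f \<in> Fl (carrier G) (int (Suc N)). \<forall>x\<in>carrier G.
     f (x \<otimes> s) mod int p = (\<Sum>w\<in>words. a w * Dw w f x) mod int p)"

lemma sum_words_split:
  fixes F :: "'c list \<Rightarrow> 'c list \<Rightarrow> int"
  shows "(\<Sum>(w, v) \<in> {(w, v). w \<in> words \<and> v \<in> words \<and> length w + length v \<le> N}. F w v)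
    = (\<Sum>u\<in>words. \<Sum>k\<le>length u. F (take k u) (drop k u))"
proof -
  have "(\<Sum>u\<in>words. \<Sum>k\<le>length u. F (take k u) (drop k u))
      = (\<Sum>(u, k) \<in> Sigma words (\<lambda>u. {..length u}). F (take k u) (drop k u))"
    using finite_words by (simp add: sum.Sigma)
  also have "\<dots> = (\<Sum>(w, v) \<in> {(w, v). w \<in> words \<and> v \<in> words \<and> length w + length v \<le> N}. F w v)"
    by (rule sum.reindex_bij_witness[of _ "\<lambda>(w, v). (w @ v, length w)" "\<lambda>(u, k). (take k u, drop k u)"])
       (auto simp: words_def dest: in_set_takeD in_set_dropD)
  finally show ?thesis by simp
qed

lemma expands_mult:
  assumes a: "a \<in> carrier W" and b: "b \<in> carrier W" and s: "s \<in> carrier G" and t: "t \<in> carrier G"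
    and as: "expands a s" and bt: "expands b t"
  shows "expands (a \<otimes>\<^bsub>W\<^esub> b) (s \<otimes> t)"
  unfolding expands_def
proof (intro ballI)
  fix f x assume f: "f \<in> Fl (carrier G) (int (Suc N))" and x: "x \<in> carrier G"
  \<comment> \<open>This is the translate of \<open>f\<close> by \<open>t\<close>, written so that
    closure of \<open>Fl\<close> under sums and under differences of weight 0 bounds its
    degree.\<close>
  define g where "g = (\<lambda>y. f y + fdiff G t f y)"
  have "fdiff G t f \<in> Fl (carrier G) (int (Suc N) - int 0)" using f t L0 by (intro Fl_fdiff) auto
  then have g: "g \<in> Fl (carrier G) (int (Suc N))" unfolding g_def using f by (intro Fl_add) auto
  define F where "F = (\<lambda>w v. a w * (b v * Dw (w @ v) f x))"
  have Dg: "Dw w g x mod int p = (\<Sum>v\<in>words. b v * Dw (w @ v) f x) mod int p" if "w \<in> words" for w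
  proof -
    have "int p dvd Dw w g x - Dw w (\<lambda>y. \<Sum>v\<in>words. b v * Dw v f y) x"
      unfolding Dw_def[of w]
    proof (rule Dl_cong[OF subgroup_self wl_word _ x])
      show "set w \<subseteq> Y" using that by (simp add: words_def)
      fix y assume "y \<in> carrier G"
      then have "f (y \<otimes> t) mod int p = (\<Sum>v\<in>words. b v * Dw v f y) mod int p"
        using bt f unfolding expands_def by blast
      then show "int p dvd g y - (\<Sum>v\<in>words. b v * Dw v f y)"
        by (simp add: g_def fdiff_def mod_eq_dvd_iff)
    qed
    then show ?thesis by (simp add: mod_eq_dvd_iff Dw_append) (simp add: Dw_def Dl_sum)
  qed
  have "f (x \<otimes> (s \<otimes> t)) mod int p = g (x \<otimes> s) mod int p"
    using x s t by (simp add: g_def fdiff_def m_assoc)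
  also have "\<dots> = (\<Sum>w\<in>words. a w * Dw w g x) mod int p"
    using as g x unfolding expands_def by blast
  also have "\<dots> = (\<Sum>w\<in>words. \<Sum>v\<in>words. F w v) mod int p"
  proof (rule mod_sum_cong)
    fix w assume "w \<in> words"
    have "a w * (\<Sum>v\<in>words. b v * Dw (w @ v) f x) = (\<Sum>v\<in>words. F w v)"
      unfolding F_def by (rule sum_distrib_left)
    then show "a w * Dw w g x mod int p = (\<Sum>v\<in>words. F w v) mod int p"
      using mod_mult_cong[OF refl Dg[OF \<open>w \<in> words\<close>], of "a w"] by (simp only:)
  qed
  also have "(\<Sum>w\<in>words. \<Sum>v\<in>words. F w v) = (\<Sum>(w, v) \<in> words \<times> words. F w v)"
    by (simp add: sum.cartesian_product)
  \<comment> \<open>Concatenations longer than \<open>N\<close> contribute 0, which matches the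
    truncation in the product of \<open>magnus\<close>.\<close>
  also have "\<dots> mod int p = (\<Sum>(w, v) \<in> words \<times> words. if length w + length v \<le> N then F w v else 0) mod int p"
  proof (rule mod_sum_cong, clarify)
    fix w v assume *: "w \<in> words" "v \<in> words"
    show "F w v mod int p = (if length w + length v \<le> N then F w v else 0) mod int p"
    proof (cases "length w + length v \<le> N")
      case False
      then have "Dw (w @ v) f x mod int p = 0" using * f x by (intro Dw_zero) (auto simp: words_def)
      then have "int p dvd F w v" unfolding F_def by (intro dvd_mult) (simp add: mod_0_imp_dvd)
      then show ?thesis using False by (simp add: dvd_imp_mod_0)
    qed simp
  qed
  also have "(\<Sum>(w, v) \<in> words \<times> words. if length w + length v \<le> N then F w v else 0)
     = (\<Sum>(w, v) \<in> {(w, v). w \<in> words \<and> v \<in> words \<and> length w + length v \<le> N}. F w v)"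
    using finite_words by (intro sum.mono_neutral_cong_right) auto
  also have "\<dots> = (\<Sum>u\<in>words. \<Sum>k\<le>length u. F (take k u) (drop k u))" by (rule sum_words_split)
  also have "\<dots> mod int p = (\<Sum>u\<in>words. (a \<otimes>\<^bsub>W\<^esub> b) u * Dw u f x) mod int p"
  proof (rule mod_sum_cong)
    fix u assume u: "u \<in> words"
    have "(\<Sum>k\<le>length u. F (take k u) (drop k u)) = (\<Sum>k\<le>length u. a (take k u) * b (drop k u)) * Dw u f x"
      by (simp add: F_def sum_distrib_right mult.assoc)
    then show "(\<Sum>k\<le>length u. F (take k u) (drop k u)) mod int p = (a \<otimes>\<^bsub>W\<^esub> b) u * Dw u f x mod int p"
      using u by (simp add: magnus_mult words_def mod_simps)
  qed
  finally show "f (x \<otimes> (s \<otimes> t)) mod int p = (\<Sum>u\<in>words. (a \<otimes>\<^bsub>W\<^esub> b) u * Dw u f x) mod int p" .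
qed

lemma expands_one: "expands \<one>\<^bsub>W\<^esub> \<one>"
proof -
  have "(\<Sum>w\<in>words. \<one>\<^bsub>W\<^esub> w * Dw w f x) = (\<Sum>w\<in>{[]}. Dw w f x)" for f x
    using finite_words by (intro sum.mono_neutral_cong_right) (auto simp: magnus_one words_def)
  then show ?thesis by (simp add: expands_def Dw_def)
qed

definition letter :: "'c \<Rightarrow> 'c list \<Rightarrow> int" where
  "letter b = (\<lambda>w. if w = [] \<or> w = [b] then 1 else 0)"

lemma letter_carrier: "b \<in> Y \<Longrightarrow> 1 \<le> N \<Longrightarrow> letter b \<in> carrier W"
  using p1 by (auto simp: magnus_def letter_def)

lemma expands_letter: assumes "b \<in> Y" "1 \<le> N" shows "expands (letter b) (\<gamma> b)"
proof -
  have "(\<Sum>w\<in>words. letter b w * Dw w f x) = (\<Sum>w\<in>{[], [b]}. Dw w f x)" for f x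
    using finite_words assms by (intro sum.mono_neutral_cong_right) (auto simp: letter_def words_def)
  then show ?thesis by (simp add: expands_def Dw_def fdiff_def)
qed

text \<open>The ambient group is finite, so closure under products is enough and no expansion of an
  inverse has to be found.\<close>

lemma expands_subgroup: "subgroup {(a, s). a \<in> carrier W \<and> s \<in> carrier G \<and> expands a s} (W \<times>\<times> G)"
proof (rule group.finite_submonoid_subgroup)
  show "group (W \<times>\<times> G)" using group_magnus by (simp add: DirProd_group)
  show "finite (carrier (W \<times>\<times> G))" using finite_magnus fin by simp
qed (auto simp: expands_mult expands_one group.is_monoid[OF group_magnus] monoid.m_closed[OF group.is_monoid[OF group_magnus]] monoid.one_closed[OF group.is_monoid[OF group_magnus]])

text \<open>A trivial expansion says that every function of degree at most \<open>N\<close> has the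
  same value at \<open>s\<close> and at the identity. By \<open>separates\<close> this forces
  \<open>s = \<one>\<close>.\<close>

lemma expands_one_trivial: assumes "s \<in> carrier G" "expands \<one>\<^bsub>W\<^esub> s" shows "s = \<one>"
proof (rule ccontr)
  assume "s \<noteq> \<one>"
  then obtain f where f: "f \<in> Fl (carrier G) (int (Suc N))" "\<not> int p dvd f s - f \<one>"
    using separates assms(1) by blast
  have "f (\<one> \<otimes> s) mod int p = (\<Sum>w\<in>words. \<one>\<^bsub>W\<^esub> w * Dw w f \<one>) mod int p"
    using assms(2) f unfolding expands_def by blast
  also have "\<dots> = f (\<one> \<otimes> \<one>) mod int p"
    using expands_one f unfolding expands_def by fastforce
  finally show False using f(2) assms(1) by (simp add: mod_eq_dvd_iff)
qed

end

section \<open>Quotients and Magnus' theorem\<close>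

declare mult_FactGroup [simp del] one_FactGroup [simp del]

locale top_quotient = topological_group G T for G (structure) and T +
  fixes N :: "'a set"
  assumes norm: "N \<lhd> G"
begin

abbreviation Q where "Q \<equiv> G Mod N"
abbreviation TQ where "TQ \<equiv> quot_top G T N"
abbreviation pr where "pr \<equiv> (\<lambda>x. N #> x)"

lemma sub_N: "subgroup N G" using norm by (rule normal_imp_subgroup)

lemma group_Q: "group Q" using norm by (rule normal.factorgroup_is_group)

lemma carrier_Q: "carrier Q = pr ` carrier G" by (rule carrier_FactGroup)

lemma pr_hom: "pr \<in> hom G Q" using norm by (rule normal.r_coset_hom_Mod)

sublocale prh: group_hom G Q pr
  by (rule group_hom.intro[OF is_group group_Q group_hom_axioms.intro[OF pr_hom]])

lemma pr_mem: "x \<in> carrier G \<Longrightarrow> x \<in> pr x"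
  using rcos_self sub_N by auto

lemma pr_eq_iff: assumes "x \<in> carrier G" "y \<in> carrier G" shows "pr x = pr y \<longleftrightarrow> x \<otimes> inv y \<in> N"
proof
  assume "pr x = pr y"
  then have "x \<in> pr y" using pr_mem[OF assms(1)] by simp
  then show "x \<otimes> inv y \<in> N" using subgroup.rcos_module_imp[OF sub_N is_group assms(2)] by blast
next
  assume "x \<otimes> inv y \<in> N"
  then have "x \<in> pr y" using subgroup.rcos_module_rev[OF sub_N is_group assms(2,1)] by blast
  then show "pr x = pr y" using repr_independence[OF _ assms(2) sub_N] by simp
qed

lemma pr_one_iff: "x \<in> carrier G \<Longrightarrow> pr x = pr \<one> \<longleftrightarrow> x \<in> N"
  using pr_eq_iff[of x \<one>] by simp

lemma pr_N: "x \<in> N \<Longrightarrow> pr x = \<one>\<^bsub>Q\<^esub>"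
  using pr_one_iff[of x] sub_N prh.hom_one by (simp add: subgroup.mem_carrier)

lemma pr_eq_one_iff: "x \<in> carrier G \<Longrightarrow> pr x = \<one>\<^bsub>Q\<^esub> \<longleftrightarrow> x \<in> N"
  using pr_one_iff[of x] prh.hom_one by simp

lemma Union_cosets: assumes "U \<subseteq> carrier Q" shows "\<Union>U = {x \<in> carrier G. pr x \<in> U}"
proof (intro equalityI subsetI)
  fix x assume "x \<in> \<Union>U"
  then obtain C where C: "C \<in> U" "x \<in> C" by (rule UnionE)
  then have "C \<in> pr ` carrier G" using assms carrier_Q by auto
  then obtain a where a: "a \<in> carrier G" "pr a \<in> U" "x \<in> pr a" using C by auto
  then have "pr x = pr a" using repr_independence[OF a(3,1) sub_N] by simp
  moreover have "x \<in> carrier G" using a r_coset_subset_G[OF subgroup.subset[OF sub_N] a(1)] by auto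
  ultimately show "x \<in> {x \<in> carrier G. pr x \<in> U}" using a by simp
qed (use pr_mem in auto)

text \<open>The family that generates \<open>quot_top\<close> is already closed under finite
  intersections and unions, so it is the quotient topology itself.\<close>

lemma openin_TQ: "openin TQ U \<longleftrightarrow> U \<subseteq> carrier Q \<and> openin T {x \<in> carrier G. pr x \<in> U}"
proof -
  let ?S = "{U. U \<subseteq> carrier Q \<and> openin T {x \<in> carrier G. pr x \<in> U}}"
  have "carrier Q = rcosets N" by (simp add: FactGroup_def)
  then have TQ: "TQ = topology_generated_by ?S"
    unfolding quot_top_def using Union_cosets
    by (intro arg_cong[where f = "\<lambda>S. topology_generated_by S"] Collect_cong) auto
  have "istopology (\<lambda>U. U \<in> ?S)"
    unfolding istopology_def
  proof (intro conjI allI impI)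
    fix U V assume "U \<in> ?S" "V \<in> ?S"
    moreover have "{x \<in> carrier G. pr x \<in> U \<inter> V} = {x \<in> carrier G. pr x \<in> U} \<inter> {x \<in> carrier G. pr x \<in> V}" by auto
    ultimately show "U \<inter> V \<in> ?S" by auto
  next
    fix \<U> assume "\<forall>U\<in>\<U>. U \<in> ?S"
    moreover have "{x \<in> carrier G. pr x \<in> \<Union>\<U>} = (\<Union>U\<in>\<U>. {x \<in> carrier G. pr x \<in> U})" by auto
    ultimately show "\<Union>\<U> \<in> ?S" by auto
  qed
  then have "generate_topology_on ?S U \<longleftrightarrow> U \<in> ?S" for U
    using generate_topology_on_coarsest[of "\<lambda>U. U \<in> ?S" ?S U] generate_topology_on.Basis[of U ?S] by iprover
  then show ?thesis unfolding TQ openin_topology_generated_by_iff by simp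
qed

lemma topspace_TQ: "topspace TQ = carrier Q"
proof -
  have "{x \<in> carrier G. pr x \<in> carrier Q} = topspace T" by (auto simp: topspace_T carrier_Q)
  then have "openin TQ (carrier Q)" unfolding openin_TQ by simp
  then show ?thesis using openin_subset openin_TQ[of "topspace TQ"] by blast
qed

lemma quotient_map_pr: "quotient_map T TQ pr"
  unfolding quotient_map_def topspace_TQ topspace_T
  using carrier_Q by (auto simp: openin_TQ)

lemma pr_cont: "continuous_map T TQ pr"
  using quotient_map_pr by (rule quotient_imp_continuous_map)

lemma left_translation_open: assumes "openin T U" "a \<in> carrier G" shows "openin T {x \<in> carrier G. a \<otimes> x \<in> U}"
  using openin_continuous_map_preimage[OF left_translation_cont[OF assms(2)] assms(1)] by (simp add: topspace_T)

lemma open_map_pr: assumes "openin T U" shows "openin TQ (pr ` U)"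
proof -
  have U: "U \<subseteq> carrier G" using openin_subset[OF assms] topspace_T by simp
  have "{x \<in> carrier G. pr x \<in> pr ` U} = (\<Union>a\<in>N. {x \<in> carrier G. a \<otimes> x \<in> U})"
  proof (intro equalityI subsetI)
    fix x assume "x \<in> {x \<in> carrier G. pr x \<in> pr ` U}"
    then obtain y where x: "x \<in> carrier G" "y \<in> U" "pr y = pr x" by auto
    then have "y \<otimes> inv x \<in> N" "(y \<otimes> inv x) \<otimes> x = y" using pr_eq_iff[of y x] U by (auto simp: m_assoc)
    then show "x \<in> (\<Union>a\<in>N. {x \<in> carrier G. a \<otimes> x \<in> U})" using x by (intro UN_I[of "y \<otimes> inv x"]) auto
  next
    fix x assume "x \<in> (\<Union>a\<in>N. {x \<in> carrier G. a \<otimes> x \<in> U})"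
    then obtain a where a: "a \<in> N" "x \<in> carrier G" "a \<otimes> x \<in> U" by auto
    then have "pr (a \<otimes> x) = pr x" using sub_N pr_eq_iff[of "a \<otimes> x" x] by (auto simp: subgroup.mem_carrier m_assoc)
    then show "x \<in> {x \<in> carrier G. pr x \<in> pr ` U}" using a by (metis (mono_tags, lifting) imageI mem_Collect_eq)
  qed
  moreover have "openin T (\<Union>a\<in>N. {x \<in> carrier G. a \<otimes> x \<in> U})"
    using sub_N assms by (intro openin_Union) (auto intro!: left_translation_open simp: subgroup.mem_carrier)
  ultimately show ?thesis using U carrier_Q by (auto simp: openin_TQ)
qed

lemma inv_cont_Q: "continuous_map TQ TQ (\<lambda>x. inv\<^bsub>Q\<^esub> x)"
proof (rule continuous_compose_quotient_map[OF quotient_map_pr])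
  have "continuous_map T TQ (\<lambda>x. pr (inv x))"
    using continuous_map_compose[OF inv_cont pr_cont] by (simp add: o_def)
  then show "continuous_map T TQ ((\<lambda>x. inv\<^bsub>Q\<^esub> x) \<circ> pr)"
    by (rule continuous_map_eq) (simp add: topspace_T)
qed

text \<open>A product of quotient maps need not be a quotient map. The argument goes through
  neighbourhoods instead, using that \<open>pr\<close> is open.\<close>

lemma mult_cont_Q: "continuous_map (prod_topology TQ TQ) TQ (\<lambda>(x, y). x \<otimes>\<^bsub>Q\<^esub> y)"
  unfolding continuous_map_def
proof (intro conjI allI impI)
  show "(\<lambda>(x, y). x \<otimes>\<^bsub>Q\<^esub> y) \<in> topspace (prod_topology TQ TQ) \<rightarrow> topspace TQ"
    using group.is_monoid[OF group_Q] by (auto simp: topspace_TQ intro: monoid.m_closed)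
next
  fix V assume V: "openin TQ V"
  let ?S = "{z \<in> topspace (prod_topology TQ TQ). (case z of (x, y) \<Rightarrow> x \<otimes>\<^bsub>Q\<^esub> y) \<in> V}"
  have pre: "openin (prod_topology T T) {z \<in> topspace (prod_topology T T). pr (fst z \<otimes> snd z) \<in> V}"
  proof -
    have "continuous_map (prod_topology T T) TQ (\<lambda>z. pr (fst z \<otimes> snd z))"
      using continuous_map_compose[OF mult_cont pr_cont] by (simp add: o_def case_prod_unfold)
    then show ?thesis using V by (rule openin_continuous_map_preimage)
  qed
  show "openin (prod_topology TQ TQ) ?S"
    unfolding openin_prod_topology_alt
  proof (intro allI impI)
    fix c d assume "(c, d) \<in> ?S"
    then obtain a b where ab: "a \<in> carrier G" "b \<in> carrier G" "c = pr a" "d = pr b" "pr a \<otimes>\<^bsub>Q\<^esub> pr b \<in> V"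
      by (auto simp: topspace_TQ carrier_Q)
    then have "(a, b) \<in> {z \<in> topspace (prod_topology T T). pr (fst z \<otimes> snd z) \<in> V}"
      using prh.hom_mult[of a b] by (simp add: topspace_T)
    note pre[unfolded openin_prod_topology_alt, THEN spec, THEN spec, THEN mp, OF this]
    then obtain U U' where U: "openin T U" "openin T U'" "a \<in> U" "b \<in> U'"
        "U \<times> U' \<subseteq> {z \<in> topspace (prod_topology T T). pr (fst z \<otimes> snd z) \<in> V}"
      by (elim exE conjE) (rule that)
    have "pr ` U \<times> pr ` U' \<subseteq> ?S"
    proof
      fix z assume "z \<in> pr ` U \<times> pr ` U'"
      then obtain x y where xy: "x \<in> U" "y \<in> U'" "z = (pr x, pr y)" by auto
      then have *: "(x, y) \<in> {z \<in> topspace (prod_topology T T). pr (fst z \<otimes> snd z) \<in> V}" using U(5) by auto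
      then have "x \<in> carrier G" "y \<in> carrier G" by (auto simp: topspace_T)
      moreover have "pr (x \<otimes> y) \<in> V" using * by simp
      ultimately show "z \<in> ?S" using xy(3) prh.hom_mult[of x y]
        by (simp add: topspace_TQ carrier_Q)
    qed
    then show "\<exists>U V. openin TQ U \<and> openin TQ V \<and> c \<in> U \<and> d \<in> V \<and> U \<times> V \<subseteq> ?S"
      using open_map_pr U ab by blast
  qed
qed

lemma topological_group_Q: "topological_group Q TQ"
  unfolding topological_group_def topological_group_axioms_def topgroup_def
  using group_Q topspace_TQ mult_cont_Q inv_cont_Q by auto

lemma descend_cont:
  assumes f: "continuous_map T (discrete_topology D) f"
    and const: "\<And>x y. x \<in> carrier G \<Longrightarrow> y \<in> N \<Longrightarrow> f (y \<otimes> x) = f x"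
  obtains g where "continuous_map TQ (discrete_topology D) g" "\<And>x. x \<in> carrier G \<Longrightarrow> g (pr x) = f x"
proof -
  define g where "g = (\<lambda>c. f (SOME x. x \<in> carrier G \<and> pr x = c))"
  have g: "g (pr x) = f x" if x: "x \<in> carrier G" for x
  proof -
    define y where "y = (SOME y. y \<in> carrier G \<and> pr y = pr x)"
    have y: "y \<in> carrier G \<and> pr y = pr x" unfolding y_def by (rule someI[of _ x]) (use x in simp)
    then have "y \<otimes> inv x \<in> N" "(y \<otimes> inv x) \<otimes> x = y" using x pr_eq_iff[of y x] by (auto simp: m_assoc)
    then have "f y = f x" using const[OF x, of "y \<otimes> inv x"] by simp
    then show ?thesis by (simp add: g_def y_def)
  qed
  have "continuous_map T (discrete_topology D) (g \<circ> pr)"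
    using f by (rule continuous_map_eq) (simp add: topspace_T g)
  then have "continuous_map TQ (discrete_topology D) g"
    by (rule continuous_compose_quotient_map[OF quotient_map_pr])
  then show thesis using that g by blast
qed

lemma cont_hom_lift: "h \<in> cont_hom_fin Q TQ H \<Longrightarrow> (\<lambda>x. h (pr x)) \<in> cont_hom_fin G T H"
  using Group.hom_compose[OF pr_hom, of h H] continuous_map_compose[OF pr_cont, of _ h]
  by (simp add: cont_hom_fin_def o_def)

lemma cont_hom_descend:
  assumes H: "group H" and h: "h \<in> cont_hom_fin G T H" and kill: "\<And>x. x \<in> N \<Longrightarrow> h x = \<one>\<^bsub>H\<^esub>"
  obtains g where "g \<in> cont_hom_fin Q TQ H" "\<And>x. x \<in> carrier G \<Longrightarrow> g (pr x) = h x"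
proof -
  note h' = cont_hom_finD[OF h]
  interpret H: group H by fact
  have hc: "h x \<in> carrier H" if "x \<in> carrier G" for x using h'(1) that by (auto simp: hom_def)
  have hm: "h (x \<otimes> y) = h x \<otimes>\<^bsub>H\<^esub> h y" if "x \<in> carrier G" "y \<in> carrier G" for x y
    using h'(1) that by (simp add: hom_mult)
  have "h (y \<otimes> x) = h x" if "x \<in> carrier G" "y \<in> N" for x y
    using hm[of y x] kill[of y] that sub_N hc by (simp add: subgroup.mem_carrier)
  then obtain g where g: "continuous_map TQ (discrete_topology (carrier H)) g" "\<And>x. x \<in> carrier G \<Longrightarrow> g (pr x) = h x"
    using descend_cont[OF h'(2)] by metis
  have "g \<in> hom Q H"
  proof (rule homI)
    fix c assume "c \<in> carrier Q" then show "g c \<in> carrier H" using g(2) hc by (auto simp: carrier_Q)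
  next
    fix c d assume "c \<in> carrier Q" "d \<in> carrier Q"
    then obtain x y where xy: "x \<in> carrier G" "y \<in> carrier G" "c = pr x" "d = pr y" by (auto simp: carrier_Q)
    have "g (c \<otimes>\<^bsub>Q\<^esub> d) = g (pr (x \<otimes> y))" using xy by simp
    also have "\<dots> = g c \<otimes>\<^bsub>H\<^esub> g d" using xy g(2) hm by (simp del: prh.hom_mult)
    finally show "g (c \<otimes>\<^bsub>Q\<^esub> d) = g c \<otimes>\<^bsub>H\<^esub> g d" .
  qed
  then show thesis using that g by (simp add: cont_hom_fin_def)
qed

end

text \<open>The preimages of the groups \<open>uf m\<close> are closed and obey the power and
  commutator laws, so minimality of the filtration applies. At \<open>m = Suc N\<close> the
  conclusion is that \<open>x\<close> lies in the kernel of \<open>h\<close>.\<close>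

lemma (in top_carrier) zass_kernel_uf:
  assumes p: "Factorial_Ring.prime p" and h: "h \<in> cont_hom_fin G T (unip p N)"
    and x: "x \<in> Z m"
  shows "h x \<in> unitriangular.uf p N m"
proof -
  interpret u: unitriangular p N by unfold_locales (use p2 in simp)
  interpret gh: group_hom G "unip p N" h
    using cont_hom_finD(1)[OF h] by unfold_locales
  define F where "F = (\<lambda>m. {x \<in> carrier G. h x \<in> u.uf m})"
  have "Z m \<subseteq> F m"
  proof (rule zass_least)
    fix m
    show "subgroup (F m) G"
      using u.uf_subgroup[of m]
      by (intro subgroupI) (auto simp: F_def subgroup.m_closed subgroup.m_inv_closed subgroup.one_closed intro: exI[of _ \<one>])
    have "closedin T {x \<in> topspace T. h x \<in> u.uf m}"
      using cont_hom_finD(2)[OF h] u.uf_carrier by (intro closedin_continuous_map_preimage) auto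
    then show "closedin T (F m)" by (simp add: F_def topspace_T)
    show "F m = carrier G" if "m \<le> 1"
    proof -
      have "m = 0 \<or> m = Suc 0" using that by linarith
      then have "u.uf m = carrier (unip p N)" using u.uf_0 u.uf_1 by (elim disjE) (simp_all only:)
      then show ?thesis by (intro equalityI subsetI) (simp_all add: F_def)
    qed
  next
    fix m x assume m: "2 \<le> m" and x: "x \<in> F ((m + p - 1) div p)"
    then have "h x [^]\<^bsub>unip p N\<^esub> p \<in> u.uf (p * ((m + p - 1) div p))" by (simp add: F_def u.uf_pow[OF p])
    moreover have "u.uf (p * ((m + p - 1) div p)) \<subseteq> u.uf m"
      using ceil_div(2)[OF p2, of m] by (auto simp: u.uf_def u.agree_def)
    ultimately show "x [^] p \<in> F m" using x by (auto simp: F_def gh.hom_nat_pow)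
  next
    fix i j x y assume "x \<in> F i" "y \<in> F j"
    then show "x \<otimes> y \<otimes> inv x \<otimes> inv y \<in> F (i + j)" by (auto simp: F_def u.uf_comm)
  qed
  then show ?thesis using x by (auto simp: F_def)
qed

section \<open>Magnus' theorem for free profinite groups\<close>

locale free_pro_prime = free_pro S T B emb for S (structure) and T and B :: "'x set" and emb +
  fixes p :: nat
  assumes p: "Factorial_Ring.prime p"
begin

lemma p2: "2 \<le> p" using p by (rule prime_ge_2_nat)

sublocale zs: top_carrier S T p
  by unfold_locales (auto simp: topspace_T p2)

abbreviation "Z \<equiv> zass S T p"

text \<open>Magnus' theorem: an element on which all Magnus coefficients of length at most \<open>N\<close> vanish fixes, by Taylor expansion,
  every polynomial function of degree at most \<open>N\<close> on every finite quotient killing \<open>S_(N+1)\<close>.\<close>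
theorem TU_subset_zass:
  assumes N: "1 \<le> N" and \<sigma>: "\<sigma> \<in> TU S T (unip p N)" shows "\<sigma> \<in> Z (Suc N)"
proof (rule ccontr)
  assume not: "\<sigma> \<notin> Z (Suc N)"
  have \<sigma>c: "\<sigma> \<in> carrier S" using \<sigma> by (simp add: TU_def)
  \<comment> \<open>\<open>Z (Suc N)\<close> is closed, so all small translates of
    \<open>\<sigma>\<close> avoid it.\<close>
  define V where "V = {x \<in> topspace T. \<sigma> \<otimes> x \<in> topspace T - Z (Suc N)}"
  have "openin T V" unfolding V_def
    using left_translation_cont[OF \<sigma>c] by (rule openin_continuous_map_preimage) (use zs.zass_props in auto)
  moreover have "\<one> \<in> V" using \<sigma>c not by (simp add: V_def topspace_T)
  ultimately obtain K0 where K0: "K0 \<lhd> S" "openin T K0" "K0 \<subseteq> V" by (rule open_normal_base)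
  interpret q0: top_quotient S T K0
    by (rule top_quotient.intro[OF topological_group_axioms top_quotient_axioms.intro[OF K0(1)]])
  \<comment> \<open>This is the product of \<open>K0\<close> and \<open>Z (Suc N)\<close>: open and
    normal, still without \<open>\<sigma>\<close>, and large enough for the filtration of the
    quotient to end at \<open>Suc N\<close>.\<close>
  define K where "K = {x \<in> carrier S. q0.pr x \<in> q0.pr ` Z (Suc N)}"
  have L0n: "q0.pr ` Z (Suc N) \<lhd> q0.Q"
    using normal.surj_hom_normal_subgroup[OF zs.zass_normal q0.prh.group_hom_axioms] q0.carrier_Q by auto
  have norm_K: "K \<lhd> S"
  proof (rule normal_invI)
    note sub = normal_imp_subgroup[OF L0n]
    show "subgroup K S"
      by (rule subgroupI)
         (use sub in \<open>auto simp: K_def subgroup.m_closed subgroup.m_inv_closed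
            intro!: exI[of _ \<one>] imageI subgroup.one_closed[OF zs.zass_props(1)]\<close>)
    fix x h assume x: "x \<in> carrier S" and h: "h \<in> K"
    have "q0.pr x \<otimes>\<^bsub>q0.Q\<^esub> q0.pr h \<otimes>\<^bsub>q0.Q\<^esub> inv\<^bsub>q0.Q\<^esub> (q0.pr x) \<in> q0.pr ` Z (Suc N)"
      using normal.inv_op_closed2[OF L0n] x h by (simp add: K_def)
    then show "x \<otimes> h \<otimes> inv x \<in> K" using x h by (simp add: K_def)
  qed
  have "openin T K"
  proof -
    have "openin T (\<Union>(q0.pr ` Z (Suc N)))"
      using open_subgroup_cosets_finite(2)[OF compact_T q0.sub_N K0(2)] zs.zass_carrier
      by (intro openin_Union) (auto simp: RCOSETS_def)
    moreover have "\<Union>(q0.pr ` Z (Suc N)) = K"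
      unfolding K_def using zs.zass_carrier by (intro q0.Union_cosets) (auto simp: q0.carrier_Q)
    ultimately show ?thesis by simp
  qed
  have \<sigma>K: "\<sigma> \<notin> K"
  proof
    assume "\<sigma> \<in> K"
    then obtain z where z: "z \<in> Z (Suc N)" "q0.pr \<sigma> = q0.pr z" by (auto simp: K_def)
    have zc: "z \<in> carrier S" using z zs.zass_carrier by blast
    have "z \<otimes> inv \<sigma> \<in> K0" using q0.pr_eq_iff[OF zc \<sigma>c] z(2) by simp
    then have "inv \<sigma> \<otimes> (z \<otimes> inv \<sigma>) \<otimes> \<sigma> \<in> K0" using normal.inv_op_closed1[OF K0(1) \<sigma>c] by blast
    then have "inv \<sigma> \<otimes> z \<in> V" using K0(3) zc \<sigma>c by (auto simp: m_assoc)
    then have "\<sigma> \<otimes> (inv \<sigma> \<otimes> z) \<notin> Z (Suc N)" by (simp add: V_def)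
    then show False using z zc \<sigma>c by (simp add: m_assoc[symmetric])
  qed
  interpret q: top_quotient S T K
    by (rule top_quotient.intro[OF topological_group_axioms top_quotient_axioms.intro[OF norm_K]])
  have carr_rc: "carrier q.Q = rcosets K" by (simp add: FactGroup_def)
  have fin_Q: "finite (carrier q.Q)"
    unfolding carr_rc using open_subgroup_cosets_finite(1)[OF compact_T q.sub_N \<open>openin T K\<close>] .
  have pr_disc: "continuous_map T (discrete_topology (carrier q.Q)) q.pr"
    unfolding continuous_map_def
  proof (intro conjI allI impI)
    fix U assume U: "openin (discrete_topology (carrier q.Q)) U"
    then have "openin T (\<Union>U)"
      using open_subgroup_cosets_finite(2)[OF compact_T q.sub_N \<open>openin T K\<close>]
      by (intro openin_Union) (auto simp: carr_rc)
    then show "openin T {x \<in> topspace T. q.pr x \<in> U}" using q.Union_cosets U by (simp add: topspace_T)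
  qed (auto simp: topspace_T q.carrier_Q)
  then have pr_ch: "q.pr \<in> cont_hom_fin S T q.Q" using q.pr_hom by (simp add: cont_hom_fin_def)
  define L where "L = (\<lambda>i. q.pr ` Z i)"
  \<comment> \<open>Only finitely many basis elements survive in the finite quotient, because the
    basis converges to the identity. They serve as letters, and the other basis elements are sent to
    the unit of the Magnus group.\<close>
  define Y where "Y = {b \<in> B. q.pr (emb b) \<noteq> \<one>\<^bsub>q.Q\<^esub>}"
  have fin_Y: "finite Y" unfolding Y_def by (rule support_finite[OF q.group_Q pr_ch])
  have "taylor q.Q p N L Y (\<lambda>b. q.pr (emb b))"
  proof (unfold taylor_def np_series_def np_series_axioms_def magnus_words_def magnus_words_axioms_def
      unitriangular_def taylor_axioms_def, intro conjI allI impI q.group_Q p fin_Q fin_Y)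
    show "subgroup (L i) q.Q" for i
      unfolding L_def using zs.zass_props(1) by (rule q.prh.subgroup_img_is_subgroup)
    show "L 0 = carrier q.Q" "L 1 = carrier q.Q" by (simp_all add: L_def zs.zass_01 q.carrier_Q)
    show "L (Suc i) \<subseteq> L i" for i unfolding L_def using zs.zass_Suc by (intro image_mono)
    show "1 < p" using p2 by simp
    show "b \<in> Y \<Longrightarrow> q.pr (emb b) \<in> carrier q.Q" for b
      using emb_carrier by (auto simp: Y_def q.carrier_Q)
    have "q.pr z = \<one>\<^bsub>q.Q\<^esub>" if "z \<in> Z (Suc N)" for z
      using that zs.zass_carrier by (intro q.pr_N) (auto simp: K_def)
    moreover have "\<one> \<in> Z (Suc N)" using zs.zass_props(1) by (rule subgroup.one_closed)
    ultimately show "L (Suc N) = {\<one>\<^bsub>q.Q\<^esub>}" unfolding L_def by force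
  next
    fix i j x y assume "x \<in> L i" "y \<in> L j"
    then obtain a b where ab: "a \<in> Z i" "b \<in> Z j" "x = q.pr a" "y = q.pr b" by (auto simp: L_def)
    have abc: "a \<in> carrier S" "b \<in> carrier S" using ab zs.zass_carrier by auto
    have "q.pr (a \<otimes> b \<otimes> inv a \<otimes> inv b) \<in> L (i + j)"
      unfolding L_def using zs.zass_commutator0[OF ab(1,2)] by (rule imageI)
    then show "x \<otimes>\<^bsub>q.Q\<^esub> y \<otimes>\<^bsub>q.Q\<^esub> inv\<^bsub>q.Q\<^esub> x \<otimes>\<^bsub>q.Q\<^esub> inv\<^bsub>q.Q\<^esub> y \<in> L (i + j)"
      using ab abc by simp
  next
    fix i x assume "x \<in> L i"
    then obtain a where a: "a \<in> Z i" "x = q.pr a" by (auto simp: L_def)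
    have "q.pr (a [^] p) \<in> L (p * i)" unfolding L_def using zs.zass_power[OF a(1)] by (rule imageI)
    then show "x [^]\<^bsub>q.Q\<^esub> p \<in> L (p * i)"
      using a zs.zass_carrier[OF a(1)] by (simp add: q.prh.hom_nat_pow)
  qed
  then interpret ta: taylor q.Q p N L Y "\<lambda>b. q.pr (emb b)" .
  interpret W: group ta.W by (rule ta.group_magnus)
  define f where "f = (\<lambda>b. if b \<in> Y then ta.letter b else \<one>\<^bsub>ta.W\<^esub>)"
  have "f \<in> B \<rightarrow> carrier ta.W" using ta.letter_carrier N by (auto simp: f_def)
  moreover have "finite {x \<in> B. f x \<noteq> \<one>\<^bsub>ta.W\<^esub>}" using fin_Y by (rule rev_finite_subset) (auto simp: f_def)
  ultimately obtain h where h: "h \<in> cont_hom_fin S T ta.W" "\<And>b. b \<in> B \<Longrightarrow> h (emb b) = f b"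
    by (rule extend[OF ta.group_magnus ta.finite_magnus]) blast
  have "h \<sigma> = \<one>\<^bsub>ta.W\<^esub>"
  proof (rule ta.eq_if_subword_matrix_eq)
    show "h \<sigma> \<in> carrier ta.W" using cont_hom_finD(1)[OF h(1)] \<sigma>c by (auto simp: hom_def)
    show "\<one>\<^bsub>ta.W\<^esub> \<in> carrier ta.W" by simp
    fix w :: "'x list" assume w: "length w = N" "set w \<subseteq> Y"
    have "(\<lambda>s. subword_matrix w (h s)) \<in> cont_hom_fin S T (unip p N)"
      using cont_hom_fin_compose[OF h(1) ta.subword_matrix_hom[OF w]] .
    then have "\<sigma> \<in> kernel S (unip p N) (\<lambda>s. subword_matrix w (h s))" using \<sigma> by (auto simp: TU_def)
    then show "subword_matrix w (h \<sigma>) = subword_matrix w \<one>\<^bsub>ta.W\<^esub>"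
      using w by (simp add: kernel_def ta.subword_matrix_one)
  qed
  \<comment> \<open>The pairs in which the series expands the translation form a subgroup, and the
    homomorphism \<open>(h, pr)\<close> maps the basis into it, hence all of
    \<open>S\<close>.\<close>
  moreover have "(h \<sigma>, q.pr \<sigma>) \<in> {(a, s). a \<in> carrier ta.W \<and> s \<in> carrier q.Q \<and> ta.expands a s}"
  proof (rule image_in_subgroup[OF _ _ _ ta.expands_subgroup _ \<sigma>c])
    show "group (ta.W \<times>\<times> q.Q)" using ta.group_magnus q.group_Q by (rule DirProd_group)
    show "finite (carrier (ta.W \<times>\<times> q.Q))" using ta.finite_magnus fin_Q by simp
    show "(\<lambda>s. (h s, q.pr s)) \<in> cont_hom_fin S T (ta.W \<times>\<times> q.Q)"
      using cont_hom_finD[OF h(1)] cont_hom_finD[OF pr_ch]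
      by (simp add: cont_hom_fin_def hom_paired prod_topology_discrete_topology continuous_map_paired)
    fix b assume b: "b \<in> B"
    show "(h (emb b), q.pr (emb b)) \<in> {(a, s). a \<in> carrier ta.W \<and> s \<in> carrier q.Q \<and> ta.expands a s}"
    proof (cases "b \<in> Y")
      case True
      then show ?thesis using h(2)[OF b] ta.letter_carrier ta.expands_letter N ta.\<gamma> by (simp add: f_def)
    next
      case False
      then have "q.pr (emb b) = \<one>\<^bsub>q.Q\<^esub>" using b by (simp add: Y_def)
      then show ?thesis using h(2)[OF b] ta.expands_one False group.is_monoid[OF q.group_Q]
        by (simp add: f_def monoid.one_closed)
    qed
  qed
  ultimately have "q.pr \<sigma> = \<one>\<^bsub>q.Q\<^esub>" by (intro ta.expands_one_trivial) auto
  then show False using q.pr_eq_one_iff[OF \<sigma>c] \<sigma>K by simp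
qed

end

section \<open>Duality and cohomology in degree two\<close>

text \<open>The additive subgroup generated by \<open>Y\<close>. It mirrors \<open>generate\<close>
  on the cohomology side; reduction modulo p makes it the span over Z/p.\<close>

inductive_set zspan :: "('a \<Rightarrow> int) set \<Rightarrow> ('a \<Rightarrow> int) set" for Y where
  zero: "(\<lambda>x. 0) \<in> zspan Y"
| incl: "\<phi> \<in> Y \<Longrightarrow> \<phi> \<in> zspan Y"
| diff: "\<phi> \<in> zspan Y \<Longrightarrow> \<psi> \<in> zspan Y \<Longrightarrow> (\<lambda>x. \<phi> x - \<psi> x) \<in> zspan Y"

lemma zspan_neg: "\<phi> \<in> zspan Y \<Longrightarrow> (\<lambda>x. - \<phi> x) \<in> zspan Y"
  using zspan.diff[OF zspan.zero] by fastforce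

lemma zspan_add: "\<phi> \<in> zspan Y \<Longrightarrow> \<psi> \<in> zspan Y \<Longrightarrow> (\<lambda>x. \<phi> x + \<psi> x) \<in> zspan Y"
  using zspan.diff[OF _ zspan_neg] by fastforce

lemma zspan_mult: "\<phi> \<in> zspan Y \<Longrightarrow> (\<lambda>x. int k * \<phi> x) \<in> zspan Y"
proof (induction k)
  case (Suc k)
  then show ?case using zspan_add[of "\<lambda>x. int k * \<phi> x" Y \<phi>] by (simp add: distrib_right add.commute)
qed (simp add: zspan.zero)

lemma zspan_mono: "Y \<subseteq> Y' \<Longrightarrow> zspan Y \<subseteq> zspan Y'"
proof
  fix \<phi> assume "\<phi> \<in> zspan Y" "Y \<subseteq> Y'"
  then show "\<phi> \<in> zspan Y'" by induction (auto intro: zspan.intros)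
qed

lemma zspan_dvd: "\<phi> \<in> zspan Y \<Longrightarrow> (\<And>\<psi>. \<psi> \<in> Y \<Longrightarrow> m dvd \<psi> x) \<Longrightarrow> m dvd \<phi> x"
  by (induction rule: zspan.induct) auto

text \<open>The solution is taken as a natural number because it serves both as a coefficient and as
  an exponent of group elements.\<close>

lemma prime_solve:
  fixes a b :: int
  assumes "Factorial_Ring.prime p" "\<not> int p dvd a" obtains k :: nat where "int p dvd int k * a - b"
proof -
  have pp: "Factorial_Ring.prime (int p)" using assms by simp
  then have "coprime (int p) a" using assms(2) by (rule prime_imp_coprime)
  then obtain u v where uv: "u * a + v * int p = 1"
    using bezout_int[of a "int p"] by (metis coprime_commute coprime_imp_gcd_eq_1)
  define k where "k = nat ((b * u) mod int p)"
  have "int p > 0" using assms(1) prime_gt_0_nat by simp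
  then have k: "int k = (b * u) mod int p" by (simp add: k_def)
  have "int k * a - b = (int k - b * u) * a + b * (u * a - 1)" by (simp add: algebra_simps)
  moreover have "u * a - 1 = - v * int p" using uv by (simp add: algebra_simps)
  moreover have "int p dvd int k - b * u" by (simp add: k mod_eq_dvd_iff[symmetric])
  ultimately have "int p dvd int k * a - b" by simp
  then show thesis by (rule that)
qed

section \<open>Duality for homomorphisms to Z/p\<close>

locale mod_homs = group G for G (structure) +
  fixes p :: nat and A :: "'a set"
  assumes p: "Factorial_Ring.prime p" and A: "subgroup A G"
begin

text \<open>An integer lift of a homomorphism from \<open>A\<close> to Z/p.\<close>

definition additive :: "('a \<Rightarrow> int) \<Rightarrow> bool" where
  "additive \<phi> \<longleftrightarrow> (\<forall>x\<in>A. \<forall>y\<in>A. int p dvd \<phi> (x \<otimes> y) - (\<phi> x + \<phi> y))"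

lemma A_carrier: "x \<in> A \<Longrightarrow> x \<in> carrier G" using A subgroup.mem_carrier by metis

lemma A_pow: "x \<in> A \<Longrightarrow> x [^] (k::nat) \<in> A"
  by (induction k) (simp_all add: A subgroup.one_closed subgroup.m_closed)

lemma additiveD: "additive \<phi> \<Longrightarrow> x \<in> A \<Longrightarrow> y \<in> A \<Longrightarrow> int p dvd \<phi> (x \<otimes> y) - (\<phi> x + \<phi> y)"
  by (simp add: additive_def)

lemma additive_mult_iff: "additive \<phi> \<Longrightarrow> x \<in> A \<Longrightarrow> y \<in> A \<Longrightarrow> int p dvd \<phi> (x \<otimes> y) + c \<longleftrightarrow> int p dvd \<phi> x + \<phi> y + c"
  using additiveD[of \<phi> x y] dvd_add_right_iff[of "int p" "\<phi> (x \<otimes> y) - (\<phi> x + \<phi> y)" "\<phi> x + \<phi> y + c"]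
  by (simp add: algebra_simps)

lemma additive_one: "additive \<phi> \<Longrightarrow> int p dvd \<phi> \<one>"
  using additiveD[of \<phi> \<one> \<one>] subgroup.one_closed[OF A] by simp

lemma additive_pow: "additive \<phi> \<Longrightarrow> x \<in> A \<Longrightarrow> int p dvd \<phi> (x [^] (k::nat)) - int k * \<phi> x"
proof (induction k)
  case 0 then show ?case using additive_one by simp
next
  case (Suc k)
  have "int p dvd \<phi> (x [^] k \<otimes> x) - (\<phi> (x [^] k) + \<phi> x)" using additiveD Suc A_pow by blast
  from dvd_add[OF this Suc.IH[OF Suc.prems]] show ?case by (simp add: algebra_simps)
qed

lemma additive_inv: assumes "additive \<phi>" "x \<in> A" shows "int p dvd \<phi> (inv x) + \<phi> x"
  using additive_mult_iff[OF assms(1,2) subgroup.m_inv_closed[OF A assms(2)], of 0] additive_one[OF assms(1)]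
    A_carrier[OF assms(2)] by (simp add: add.commute)

lemma kernel_subgroup:
  assumes \<phi>: "additive \<phi>" and N: "subgroup N G" "N \<subseteq> A"
  shows "subgroup {\<mu> \<in> N. int p dvd \<phi> \<mu>} G"
proof (rule subgroupI)
  show "{\<mu> \<in> N. int p dvd \<phi> \<mu>} \<subseteq> carrier G" using A_carrier N(2) by auto
  have "\<one> \<in> {\<mu> \<in> N. int p dvd \<phi> \<mu>}" using additive_one[OF \<phi>] subgroup.one_closed[OF N(1)] by simp
  then show "{\<mu> \<in> N. int p dvd \<phi> \<mu>} \<noteq> {}" by blast
next
  fix a assume "a \<in> {\<mu> \<in> N. int p dvd \<phi> \<mu>}"
  then have a: "a \<in> N" "a \<in> A" "int p dvd \<phi> a" using N(2) by auto
  then show "inv a \<in> {\<mu> \<in> N. int p dvd \<phi> \<mu>}"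
    using additive_inv[OF \<phi> a(2)] subgroup.m_inv_closed[OF N(1)] by (simp add: dvd_add_left_iff)
next
  fix a b assume "a \<in> {\<mu> \<in> N. int p dvd \<phi> \<mu>}" "b \<in> {\<mu> \<in> N. int p dvd \<phi> \<mu>}"
  then have ab: "a \<in> N" "b \<in> N" "a \<in> A" "b \<in> A" "int p dvd \<phi> a" "int p dvd \<phi> b" using N(2) by auto
  then show "a \<otimes> b \<in> {\<mu> \<in> N. int p dvd \<phi> \<mu>}"
    using additive_mult_iff[OF \<phi> ab(3,4), of 0] subgroup.m_closed[OF N(1)] by simp
qed

lemma additive_diff: assumes "additive \<phi>" "additive \<psi>" shows "additive (\<lambda>x. \<phi> x - \<psi> x)"
  unfolding additive_def
proof (intro ballI)
  fix x y assume "x \<in> A" "y \<in> A"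
  then have "int p dvd \<phi> (x \<otimes> y) - (\<phi> x + \<phi> y)" "int p dvd \<psi> (x \<otimes> y) - (\<psi> x + \<psi> y)"
    using assms additiveD by auto
  from dvd_diff[OF this] show "int p dvd \<phi> (x \<otimes> y) - \<psi> (x \<otimes> y) - (\<phi> x - \<psi> x + (\<phi> y - \<psi> y))"
    by (simp add: algebra_simps)
qed

lemma additive_zspan: "\<phi> \<in> zspan Y \<Longrightarrow> (\<And>\<psi>. \<psi> \<in> Y \<Longrightarrow> additive \<psi>) \<Longrightarrow> additive \<phi>"
  by (induction rule: zspan.induct) (auto simp: additive_diff, simp add: additive_def)

text \<open>A Hahn-Banach statement over Z/p: if the coset of \<open>\<sigma>\<close> misses the
  common kernel of the family, some combination vanishes on \<open>N\<close> but not at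
  \<open>\<sigma>\<close>. When the new functional is nonzero on \<open>N\<close>, the induction
  passes to its kernel in \<open>N\<close> and replaces \<open>\<sigma>\<close> by a point of the
  same coset where it vanishes.\<close>

lemma separate_functional:
  assumes "finite F" "\<And>\<psi>. \<psi> \<in> F \<Longrightarrow> additive \<psi>" "subgroup N G" "N \<subseteq> A" "\<sigma> \<in> A"
    and "\<And>\<nu>. \<nu> \<in> N \<Longrightarrow> \<exists>\<psi>\<in>F. \<not> int p dvd \<psi> (\<sigma> \<otimes> \<nu>)"
  shows "\<exists>\<phi>\<in>zspan F. (\<forall>\<nu>\<in>N. int p dvd \<phi> \<nu>) \<and> \<not> int p dvd \<phi> \<sigma>"
  using assms
proof (induction F arbitrary: N \<sigma> rule: finite_induct)
  case empty
  then show ?case using subgroup.one_closed[OF empty(2)] by blast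
next
  case (insert \<phi> F)
  have add: "additive \<phi>" using insert by simp
  have addF: "additive \<psi>" if "\<psi> \<in> F" for \<psi> using insert that by simp
  note N = insert.prems(2,3) and \<sigma> = insert.prems(4)
  show ?case
  proof (cases "\<forall>\<nu>\<in>N. int p dvd \<phi> \<nu>")
    case True
    show ?thesis
    proof (cases "int p dvd \<phi> \<sigma>")
      case False
      then show ?thesis using True zspan.incl[of \<phi> "insert \<phi> F"] by blast
    next
      case \<sigma>0: True
      have "\<exists>\<psi>\<in>F. \<not> int p dvd \<psi> (\<sigma> \<otimes> \<nu>)" if "\<nu> \<in> N" for \<nu>
      proof -
        have "int p dvd \<phi> (\<sigma> \<otimes> \<nu>)"
          using additive_mult_iff[OF add \<sigma>, of \<nu> 0] True \<sigma>0 that N(2) by auto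
        then show ?thesis using insert.prems(5)[OF that] by auto
      qed
      then obtain \<psi> where "\<psi> \<in> zspan F" "\<forall>\<nu>\<in>N. int p dvd \<psi> \<nu>" "\<not> int p dvd \<psi> \<sigma>"
        using insert.IH[OF addF N \<sigma>] by blast
      then show ?thesis using zspan_mono[of F "insert \<phi> F"] by blast
    qed
  next
    case False
    then obtain \<nu> where \<nu>: "\<nu> \<in> N" "\<not> int p dvd \<phi> \<nu>" by blast
    have \<nu>A: "\<nu> \<in> A" using \<nu> N by auto
    have powN: "\<nu> [^] (k::nat) \<in> N" for k
      by (induction k) (simp_all add: \<nu> subgroup.one_closed[OF N(1)] subgroup.m_closed[OF N(1)])
    define N' where "N' = {\<mu> \<in> N. int p dvd \<phi> \<mu>}"
    \<comment> \<open>\<open>k\<close> is chosen such that \<open>\<phi>\<close> vanishes at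
      \<open>\<sigma> \<otimes> \<nu> [^] k\<close>.\<close>
    obtain k where k: "int p dvd int k * \<phi> \<nu> - (- \<phi> \<sigma>)" using prime_solve[OF p \<nu>(2)] by blast
    define \<sigma>' where "\<sigma>' = \<sigma> \<otimes> \<nu> [^] k"
    have \<sigma>'A: "\<sigma>' \<in> A" unfolding \<sigma>'_def using \<sigma> A_pow[OF \<nu>A] A by (simp add: subgroup.m_closed)
    have \<phi>\<sigma>': "int p dvd \<phi> \<sigma>'"
    proof -
      have "int p dvd \<phi> (\<nu> [^] k) - int k * \<phi> \<nu>" by (rule additive_pow[OF add \<nu>A])
      from dvd_add[OF this k] have "int p dvd \<phi> \<sigma> + \<phi> (\<nu> [^] k) + 0" by (simp add: algebra_simps)
      then show ?thesis unfolding \<sigma>'_def using additive_mult_iff[OF add \<sigma> A_pow[OF \<nu>A], of k 0] by simp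
    qed
    have N': "subgroup N' G" unfolding N'_def by (rule kernel_subgroup[OF add N])
    have "\<exists>\<psi>\<in>F. \<not> int p dvd \<psi> (\<sigma>' \<otimes> \<mu>)" if \<mu>: "\<mu> \<in> N'" for \<mu>
    proof -
      have \<mu>N: "\<mu> \<in> N" "\<mu> \<in> A" "int p dvd \<phi> \<mu>" using \<mu> N by (auto simp: N'_def)
      have "\<sigma>' \<otimes> \<mu> = \<sigma> \<otimes> (\<nu> [^] k \<otimes> \<mu>)"
        unfolding \<sigma>'_def using A_carrier \<sigma> \<nu>A \<mu>N by (simp add: m_assoc)
      moreover have "\<nu> [^] k \<otimes> \<mu> \<in> N" using powN \<mu>N subgroup.m_closed[OF N(1)] by blast
      ultimately have "\<exists>\<psi>\<in>insert \<phi> F. \<not> int p dvd \<psi> (\<sigma>' \<otimes> \<mu>)" using insert.prems(5) by simp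
      moreover have "int p dvd \<phi> (\<sigma>' \<otimes> \<mu>)"
        using additive_mult_iff[OF add \<sigma>'A \<mu>N(2), of 0] \<phi>\<sigma>' \<mu>N(3) by simp
      ultimately show ?thesis by auto
    qed
    moreover have "N' \<subseteq> A" using N by (auto simp: N'_def)
    ultimately obtain \<psi> where \<psi>: "\<psi> \<in> zspan F" "\<And>\<mu>. \<mu> \<in> N' \<Longrightarrow> int p dvd \<psi> \<mu>" "\<not> int p dvd \<psi> \<sigma>'"
      using insert.IH[OF addF N' _ \<sigma>'A] by blast
    \<comment> \<open>Subtracting \<open>c\<close> times \<open>\<phi>\<close> makes the functional
      vanish at \<open>\<nu>\<close>, hence on \<open>N\<close>, which \<open>\<nu>\<close> and
      \<open>N'\<close> generate. At \<open>\<sigma>'\<close>, where \<open>\<phi>\<close> is zero,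
      nothing changes, and \<open>\<sigma>\<close> differs from \<open>\<sigma>'\<close> by a power
      of \<open>\<nu>\<close>.\<close>
    obtain c where c: "int p dvd int c * \<phi> \<nu> - \<psi> \<nu>" using prime_solve[OF p \<nu>(2)] by blast
    define \<psi>' where "\<psi>' = (\<lambda>x. \<psi> x - int c * \<phi> x)"
    have span: "\<psi>' \<in> zspan (insert \<phi> F)" unfolding \<psi>'_def
      using \<psi>(1) zspan_mono[of F "insert \<phi> F"] zspan_mult[OF zspan.incl[of \<phi> "insert \<phi> F"], of c]
      by (intro zspan.diff) auto
    have add': "additive \<psi>'" using additive_zspan[OF span] insert.prems(1) by blast
    have \<psi>'\<nu>: "int p dvd \<psi>' \<nu>" using c by (simp add: \<psi>'_def dvd_diff_commute)
    have \<psi>'pow: "int p dvd \<psi>' (\<nu> [^] j)" for j :: nat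
    proof -
      have "int p dvd int j * \<psi>' \<nu>" using \<psi>'\<nu> by simp
      from dvd_add[OF additive_pow[OF add' \<nu>A, of j] this] show ?thesis by simp
    qed
    have "int p dvd \<psi>' \<mu>" if \<mu>: "\<mu> \<in> N" for \<mu>
    proof -
      obtain j where j: "int p dvd int j * \<phi> \<nu> - \<phi> \<mu>" using prime_solve[OF p \<nu>(2)] by blast
      define \<mu>' where "\<mu>' = inv (\<nu> [^] j) \<otimes> \<mu>"
      have \<mu>'N: "\<mu>' \<in> N" unfolding \<mu>'_def using \<mu> powN N(1) by (simp add: subgroup.m_closed subgroup.m_inv_closed)
      then have \<mu>'A: "\<mu>' \<in> A" using N by auto
      have eq: "\<mu> = \<nu> [^] j \<otimes> \<mu>'" unfolding \<mu>'_def
        using \<mu> N(2) A_carrier \<nu>A by (simp add: m_assoc[symmetric] subset_iff)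
      have "int p dvd \<phi> (\<nu> [^] j \<otimes> \<mu>') + (- \<phi> \<mu>)" using eq by simp
      then have 1: "int p dvd \<phi> (\<nu> [^] j) + \<phi> \<mu>' + (- \<phi> \<mu>)"
        using additive_mult_iff[OF add A_pow[OF \<nu>A] \<mu>'A] by blast
      have "int p dvd \<phi> (\<nu> [^] j) - int j * \<phi> \<nu>" by (rule additive_pow[OF add \<nu>A])
      from dvd_diff[OF 1 dvd_add[OF this j]] have "int p dvd \<phi> \<mu>'" by (simp add: algebra_simps)
      then have "\<mu>' \<in> N'" using \<mu>'N by (simp add: N'_def)
      then have "int p dvd \<psi>' \<mu>'" using \<psi>(2) \<open>int p dvd \<phi> \<mu>'\<close> by (simp add: \<psi>'_def)
      then have "int p dvd \<psi>' (\<nu> [^] j) + \<psi>' \<mu>' + 0" using \<psi>'pow by simp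
      then show ?thesis using additive_mult_iff[OF add' A_pow[OF \<nu>A] \<mu>'A, of j 0] eq by simp
    qed
    moreover have "\<not> int p dvd \<psi>' \<sigma>"
    proof
      assume "int p dvd \<psi>' \<sigma>"
      then have "int p dvd \<psi>' \<sigma> + \<psi>' (\<nu> [^] k) + 0" using \<psi>'pow by simp
      then have "int p dvd \<psi>' \<sigma>'" unfolding \<sigma>'_def
        using additive_mult_iff[OF add' \<sigma> A_pow[OF \<nu>A], of k 0] by simp
      moreover have "int p dvd int c * \<phi> \<sigma>'" using \<phi>\<sigma>' by simp
      ultimately have "int p dvd \<psi> \<sigma>'" using dvd_add[of "int p" "\<psi>' \<sigma>'" "int c * \<phi> \<sigma>'"] by (simp add: \<psi>'_def)
      then show False using \<psi>(3) by simp
    qed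
    ultimately show ?thesis using span by blast
  qed
qed

text \<open>Apply separation to the kernel of \<open>\<phi>\<close> and a point \<open>s\<close>
  outside it. The functional obtained vanishes on the kernel but not at \<open>s\<close>, and as the
  kernel has index p, \<open>\<phi>\<close> is a multiple of it.\<close>

lemma span_if_kernels:
  assumes F: "finite F" "\<And>\<psi>. \<psi> \<in> F \<Longrightarrow> additive \<psi>" and \<phi>: "additive \<phi>"
    and ker: "\<And>\<sigma>. \<sigma> \<in> A \<Longrightarrow> (\<And>\<psi>. \<psi> \<in> F \<Longrightarrow> int p dvd \<psi> \<sigma>) \<Longrightarrow> int p dvd \<phi> \<sigma>"
  shows "\<exists>\<phi>'\<in>zspan F. \<forall>x\<in>A. int p dvd \<phi> x - \<phi>' x"
proof (cases "\<forall>x\<in>A. int p dvd \<phi> x")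
  case True
  then show ?thesis using zspan.zero[of F] by (intro bexI[of _ "\<lambda>x. 0"]) auto
next
  case False
  then obtain s where s: "s \<in> A" "\<not> int p dvd \<phi> s" by blast
  define N where "N = {\<mu> \<in> A. int p dvd \<phi> \<mu>}"
  have N: "subgroup N G" unfolding N_def by (rule kernel_subgroup[OF \<phi> A order_refl])
  have "\<exists>\<psi>\<in>F. \<not> int p dvd \<psi> (s \<otimes> \<nu>)" if \<nu>: "\<nu> \<in> N" for \<nu>
  proof (rule ccontr)
    assume "\<not> ?thesis"
    then have "int p dvd \<phi> (s \<otimes> \<nu>) + 0"
      using ker[of "s \<otimes> \<nu>"] \<nu> s subgroup.m_closed[OF A] by (auto simp: N_def)
    then have "int p dvd \<phi> s + \<phi> \<nu> + 0" using additive_mult_iff[OF \<phi> s(1), of \<nu> 0] \<nu> by (simp add: N_def)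
    then show False using s(2) \<nu> by (simp add: N_def dvd_add_left_iff)
  qed
  moreover have "N \<subseteq> A" by (auto simp: N_def)
  ultimately obtain \<phi>1 where \<phi>1: "\<phi>1 \<in> zspan F" "\<And>\<nu>. \<nu> \<in> N \<Longrightarrow> int p dvd \<phi>1 \<nu>" "\<not> int p dvd \<phi>1 s"
    using separate_functional[OF F N _ s(1)] by blast
  obtain k where k: "int p dvd int k * \<phi>1 s - \<phi> s" using prime_solve[OF p \<phi>1(3)] by blast
  define \<phi>' where "\<phi>' = (\<lambda>x. int k * \<phi>1 x)"
  have span: "\<phi>' \<in> zspan F" unfolding \<phi>'_def by (rule zspan_mult[OF \<phi>1(1)])
  have add': "additive \<phi>'" using additive_zspan[OF span] F by blast
  have "int p dvd \<phi> x - \<phi>' x" if x: "x \<in> A" for x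
  proof -
    obtain j where j: "int p dvd int j * \<phi> s - \<phi> x" using prime_solve[OF p s(2)] by blast
    define \<nu> where "\<nu> = inv (s [^] j) \<otimes> x"
    have \<nu>A: "\<nu> \<in> A" unfolding \<nu>_def using x A_pow[OF s(1)] A by (simp add: subgroup.m_closed subgroup.m_inv_closed)
    have eq: "x = s [^] j \<otimes> \<nu>" unfolding \<nu>_def using x A_carrier s by (simp add: m_assoc[symmetric])
    have "int p dvd \<phi> (s [^] j \<otimes> \<nu>) + (- \<phi> x)" using eq by simp
    then have 1: "int p dvd \<phi> (s [^] j) + \<phi> \<nu> + (- \<phi> x)"
      using additive_mult_iff[OF \<phi> A_pow[OF s(1)] \<nu>A] by blast
    from dvd_diff[OF 1 dvd_add[OF additive_pow[OF \<phi> s(1), of j] j]] have "int p dvd \<phi> \<nu>"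
      by (simp add: algebra_simps)
    then have "\<nu> \<in> N" using \<nu>A by (simp add: N_def)
    then have \<nu>': "int p dvd \<phi>' \<nu>" using \<phi>1(2) by (simp add: \<phi>'_def)
    have "int p dvd \<phi>' (s [^] j \<otimes> \<nu>) + (- \<phi>' x)" using eq by simp
    then have "int p dvd \<phi>' (s [^] j) + \<phi>' \<nu> + (- \<phi>' x)"
      using additive_mult_iff[OF add' A_pow[OF s(1)] \<nu>A] by blast
    from dvd_diff[OF dvd_diff[OF this \<nu>'] additive_pow[OF add' s(1), of j]]
    have 2: "int p dvd int j * \<phi>' s - \<phi>' x" by (simp add: algebra_simps)
    have "int p dvd int j * (\<phi>' s - \<phi> s)" using k by (simp add: \<phi>'_def)
    from dvd_diff[OF dvd_diff[OF 2 this] j] show ?thesis by (simp add: algebra_simps dvd_diff_commute)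
  qed
  then show ?thesis using span by blast
qed

end

lemma (in topological_group) unrestrict_cont:
  assumes "continuous_map (prod_topology T T) (discrete_topology D) F"
  shows "continuous_map (prod_topology T T) (discrete_topology D) (restrict F (carrier G \<times> carrier G))"
  using assms by (rule continuous_map_eq) (auto simp: topspace_T)

section \<open>Degree two cohomology through explicit continuous cocycles\<close>

locale cohomology = topological_group G T for G (structure) and T +
  fixes p :: nat
  assumes p1: "1 < p"
begin

abbreviation "C \<equiv> cocycles2 p G T"
abbreviation "D \<equiv> coboundaries2 p G T"
abbreviation "ZZ \<equiv> Z2grp p G T"
abbreviation "HH \<equiv> H2 p G T"
abbreviation "lc \<equiv> continuous_map T (discrete_topology (UNIV :: int set))"

definition cocycle_id :: "('a \<times> 'a \<Rightarrow> int) \<Rightarrow> bool" where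
  "cocycle_id F \<longleftrightarrow> (\<forall>x\<in>carrier G. \<forall>y\<in>carrier G. \<forall>z\<in>carrier G.
     int p dvd F (y, z) - F (x \<otimes> y, z) + F (x, y \<otimes> z) - F (x, y))"

text \<open>The normal form demanded by \<open>cocycles2\<close>: residues, undefined off the
  carrier. Identities are verified as divisibilities for unreduced cochains and transferred by
  \<open>red_cong\<close>.\<close>

definition red :: "('a \<times> 'a \<Rightarrow> int) \<Rightarrow> ('a \<times> 'a \<Rightarrow> int)" where
  "red F = restrict (\<lambda>xy. F xy mod int p) (carrier G \<times> carrier G)"

lemma red_eq: "x \<in> carrier G \<Longrightarrow> y \<in> carrier G \<Longrightarrow> red F (x, y) = F (x, y) mod int p"
  by (simp add: red_def)

lemma red_dvd: "x \<in> carrier G \<Longrightarrow> y \<in> carrier G \<Longrightarrow> int p dvd red F (x, y) - F (x, y)"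
  by (simp add: red_eq mod_eq_dvd_iff[symmetric])

lemma red_cong: "(\<And>x y. x \<in> carrier G \<Longrightarrow> y \<in> carrier G \<Longrightarrow> int p dvd F (x, y) - F' (x, y)) \<Longrightarrow> red F = red F'"
  unfolding red_def by (intro restrict_ext) (auto simp: mod_eq_dvd_iff)

lemma cocycleD:
  assumes "c \<in> C"
  shows "cocycle_id c" "continuous_map (prod_topology T T) (discrete_topology UNIV) c" "red c = c"
    "x \<in> carrier G \<Longrightarrow> y \<in> carrier G \<Longrightarrow> c (x, y) \<in> {0..<int p}"
proof -
  have c: "c \<in> PiE (carrier G \<times> carrier G) (\<lambda>_. {0..<int p})"
    "continuous_map (prod_topology T T) (discrete_topology {0..<int p}) c"
    using assms by (auto simp: cocycles2_def)
  show "cocycle_id c" using assms by (simp add: cocycles2_def cocycle_id_def mod_eq_0_iff_dvd)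
  show "continuous_map (prod_topology T T) (discrete_topology UNIV) c"
    using locally_const_compose[OF c(2), of "\<lambda>a. a" UNIV] by simp
  show *: "c (x, y) \<in> {0..<int p}" if "x \<in> carrier G" "y \<in> carrier G" for x y
    using c(1) that by (auto simp: PiE_iff)
  show "red c = c"
  proof
    fix z show "red c z = c z"
    proof (cases "z \<in> carrier G \<times> carrier G")
      case True
      then show ?thesis using *[of "fst z" "snd z"] by (cases z) (simp add: red_eq)
    next
      case False
      then show ?thesis using PiE_arb[OF c(1) False] by (simp add: red_def)
    qed
  qed
qed

lemma red_cocycle:
  assumes "cocycle_id F" "continuous_map (prod_topology T T) (discrete_topology UNIV) F"
  shows "red F \<in> C"
proof -
  have "red F \<in> PiE (carrier G \<times> carrier G) (\<lambda>_. {0..<int p})" using p1 by (auto simp: red_def)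
  moreover have "continuous_map (prod_topology T T) (discrete_topology {0..<int p}) (red F)"
    unfolding red_def using p1 by (intro unrestrict_cont locally_const_compose[OF assms(2)]) auto
  moreover have "(red F (y, z) - red F (x \<otimes> y, z) + red F (x, y \<otimes> z) - red F (x, y)) mod int p = 0"
    if "x \<in> carrier G" "y \<in> carrier G" "z \<in> carrier G" for x y z
  proof -
    have "int p dvd F (y, z) - F (x \<otimes> y, z) + F (x, y \<otimes> z) - F (x, y)"
      using assms(1) that by (simp add: cocycle_id_def)
    from dvd_diff[OF dvd_add[OF dvd_diff[OF dvd_add[OF this red_dvd[OF that(2,3), of F]]
          red_dvd[OF m_closed[OF that(1,2)] that(3), of F]]
          red_dvd[OF that(1) m_closed[OF that(2,3)], of F]] red_dvd[OF that(1,2), of F]]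
    show ?thesis using that by (simp add: algebra_simps mod_eq_0_iff_dvd)
  qed
  ultimately show ?thesis by (simp add: cocycles2_def)
qed

lemma ZZ_mult: "c \<otimes>\<^bsub>ZZ\<^esub> d = red (\<lambda>xy. c xy + d xy)" by (simp add: Z2grp_def red_def)
lemma ZZ_one: "\<one>\<^bsub>ZZ\<^esub> = red (\<lambda>xy. 0)" by (simp add: Z2grp_def red_def)
lemma ZZ_carrier: "carrier ZZ = C" by (simp add: Z2grp_def)

lemma add_cocycle: assumes "c \<in> C" "d \<in> C" shows "red (\<lambda>xy. c xy + d xy) \<in> C"
proof (rule red_cocycle)
  show "cocycle_id (\<lambda>xy. c xy + d xy)" unfolding cocycle_id_def
  proof (intro ballI)
    fix x y z assume xyz: "x \<in> carrier G" "y \<in> carrier G" "z \<in> carrier G"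
    have "int p dvd c (y, z) - c (x \<otimes> y, z) + c (x, y \<otimes> z) - c (x, y)"
      "int p dvd d (y, z) - d (x \<otimes> y, z) + d (x, y \<otimes> z) - d (x, y)"
      using cocycleD(1)[OF assms(1)] cocycleD(1)[OF assms(2)] xyz by (auto simp: cocycle_id_def)
    from dvd_add[OF this] show "int p dvd c (y, z) + d (y, z) - (c (x \<otimes> y, z) + d (x \<otimes> y, z))
        + (c (x, y \<otimes> z) + d (x, y \<otimes> z)) - (c (x, y) + d (x, y))" by (simp add: algebra_simps)
  qed
qed (use cocycleD(2)[OF assms(1)] cocycleD(2)[OF assms(2)] in \<open>auto intro: locally_const_combine\<close>)

lemma neg_cocycle: assumes "c \<in> C" shows "red (\<lambda>xy. - c xy) \<in> C"
proof (rule red_cocycle)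
  show "cocycle_id (\<lambda>xy. - c xy)" unfolding cocycle_id_def
  proof (intro ballI)
    fix x y z assume xyz: "x \<in> carrier G" "y \<in> carrier G" "z \<in> carrier G"
    have "int p dvd c (y, z) - c (x \<otimes> y, z) + c (x, y \<otimes> z) - c (x, y)"
      using cocycleD(1)[OF assms(1)] xyz by (auto simp: cocycle_id_def)
    then have "int p dvd - (c (y, z) - c (x \<otimes> y, z) + c (x, y \<otimes> z) - c (x, y))" by (simp only: dvd_minus_iff)
    then show "int p dvd - c (y, z) - - c (x \<otimes> y, z) + - c (x, y \<otimes> z) - - c (x, y)" by (simp add: algebra_simps)
  qed
qed (use cocycleD(2)[OF assms(1)] in \<open>auto intro: locally_const_compose\<close>)

lemma group_ZZ: "comm_group ZZ"
proof (rule comm_groupI; unfold ZZ_carrier ZZ_mult ZZ_one)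
  show "red (\<lambda>xy. 0) \<in> C" by (rule red_cocycle) (auto simp: cocycle_id_def)
  fix c assume c: "c \<in> C"
  have "red (\<lambda>xy. red (\<lambda>xy. 0) xy + c xy) = red c" by (rule red_cong) (simp add: red_eq)
  then show "red (\<lambda>xy. red (\<lambda>xy. 0) xy + c xy) = c" using cocycleD(3)[OF c] by simp
  show "\<exists>d\<in>C. red (\<lambda>xy. d xy + c xy) = red (\<lambda>xy. 0)"
    by (intro bexI[OF _ neg_cocycle[OF c]] red_cong) (use red_dvd[of _ _ "\<lambda>xy. - c xy"] in simp)
  fix d assume d: "d \<in> C"
  show "red (\<lambda>xy. c xy + d xy) \<in> C" using c d by (rule add_cocycle)
  show "red (\<lambda>xy. c xy + d xy) = red (\<lambda>xy. d xy + c xy)" by (simp add: add.commute)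
  fix e assume "e \<in> C"
  show "red (\<lambda>xy. red (\<lambda>xy. c xy + d xy) xy + e xy) = red (\<lambda>xy. c xy + red (\<lambda>xy. d xy + e xy) xy)"
    by (rule red_cong) (simp add: red_eq mod_eq_dvd_iff[symmetric] mod_simps add.assoc)
qed

lemma lc_mult: "lc f \<Longrightarrow> continuous_map (prod_topology T T) (discrete_topology UNIV) (\<lambda>xy. f (fst xy \<otimes> snd xy))"
  using continuous_map_compose[OF mult_cont, of "discrete_topology UNIV" f] by (simp add: o_def case_prod_unfold)

lemma coboundaryI:
  assumes f: "lc f" and c: "red c = c"
    and eq: "\<And>x y. x \<in> carrier G \<Longrightarrow> y \<in> carrier G \<Longrightarrow> int p dvd c (x, y) - (f y - f (x \<otimes> y) + f x)"
  shows "c \<in> D"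
proof -
  define g where "g = (\<lambda>x. f x mod int p)"
  have "continuous_map T (discrete_topology {0..<int p}) g"
    unfolding g_def using p1 by (intro locally_const_compose[OF f]) auto
  moreover have "g \<in> carrier G \<rightarrow> {0..<int p}" using p1 by (auto simp: g_def)
  moreover have "c = restrict (\<lambda>(x, y). (g y - g (x \<otimes> y) + g x) mod int p) (carrier G \<times> carrier G)"
  proof -
    have "red c = red (\<lambda>(x, y). f y - f (x \<otimes> y) + f x)" by (rule red_cong) (simp add: eq)
    also have "\<dots> = red (\<lambda>(x, y). g y - g (x \<otimes> y) + g x)"
    proof (rule red_cong)
      fix x y
      have gd: "int p dvd f t - g t" for t by (simp add: g_def mod_eq_dvd_iff[symmetric])
      from dvd_add[OF dvd_diff[OF gd[of y] gd[of "x \<otimes> y"]] gd[of x]]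
      show "int p dvd (case (x, y) of (x, y) \<Rightarrow> f y - f (x \<otimes> y) + f x) - (case (x, y) of (x, y) \<Rightarrow> g y - g (x \<otimes> y) + g x)"
        by (simp add: algebra_simps)
    qed
    finally have "c = red (\<lambda>(x, y). g y - g (x \<otimes> y) + g x)" using c by simp
    then show ?thesis unfolding red_def by (simp only: case_prod_unfold)
  qed
  ultimately show ?thesis unfolding coboundaries2_def by blast
qed

lemma coboundaryD:
  assumes "c \<in> D"
  obtains f where "lc f" "\<And>x y. x \<in> carrier G \<Longrightarrow> y \<in> carrier G \<Longrightarrow> int p dvd c (x, y) - (f y - f (x \<otimes> y) + f x)"
proof -
  obtain f where f: "c = restrict (\<lambda>(x, y). (f y - f (x \<otimes> y) + f x) mod int p) (carrier G \<times> carrier G)"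
    "continuous_map T (discrete_topology {0..<int p}) f"
    using assms unfolding coboundaries2_def by blast
  have "lc f" using locally_const_compose[OF f(2), of "\<lambda>a. a" UNIV] by simp
  moreover have "int p dvd c (x, y) - (f y - f (x \<otimes> y) + f x)" if "x \<in> carrier G" "y \<in> carrier G" for x y
    using that by (simp add: f(1) mod_eq_dvd_iff[symmetric])
  ultimately show thesis using that by blast
qed

lemma coboundary_red: "c \<in> D \<Longrightarrow> red c = c"
  unfolding coboundaries2_def by (auto simp: red_def fun_eq_iff restrict_def)

lemma coboundary_cocycle: assumes "c \<in> D" shows "c \<in> C"
proof -
  obtain f where f: "lc f" "\<And>x y. x \<in> carrier G \<Longrightarrow> y \<in> carrier G \<Longrightarrow> int p dvd c (x, y) - (f y - f (x \<otimes> y) + f x)"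
    using coboundaryD[OF assms] by blast
  define F where "F = (\<lambda>xy. f (snd xy) - f (fst xy \<otimes> snd xy) + f (fst xy))"
  have s: "continuous_map (prod_topology T T) (discrete_topology UNIV) (\<lambda>xy. f (snd xy))"
      "continuous_map (prod_topology T T) (discrete_topology UNIV) (\<lambda>xy. f (fst xy))"
    using continuous_map_compose[OF continuous_map_snd f(1)] continuous_map_compose[OF continuous_map_fst f(1)]
    by (auto simp: o_def)
  have "continuous_map (prod_topology T T) (discrete_topology UNIV) F" unfolding F_def
    by (rule locally_const_combine[OF locally_const_combine[OF s(1) lc_mult[OF f(1)]] s(2)]) auto
  moreover have "cocycle_id F" unfolding cocycle_id_def F_def by (auto simp: m_assoc)
  ultimately have "red F \<in> C" by (rule red_cocycle[rotated])
  moreover have "red F = red c" using f(2) by (intro red_cong) (simp add: F_def dvd_diff_commute)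
  ultimately show ?thesis using coboundary_red[OF assms] by simp
qed

lemma subgroup_D: "subgroup D ZZ"
proof -
  interpret Zg: comm_group ZZ by (rule group_ZZ)
  have zero: "red (\<lambda>xy. 0) \<in> D"
    by (rule coboundaryI[of "\<lambda>x. 0"]) (auto simp: red_def fun_eq_iff restrict_def)
  have diff: "red (\<lambda>xy. c xy - d xy) \<in> D" if cd: "c \<in> D" "d \<in> D" for c d
  proof -
    obtain f where f: "lc f" "\<And>x y. x \<in> carrier G \<Longrightarrow> y \<in> carrier G \<Longrightarrow> int p dvd c (x, y) - (f y - f (x \<otimes> y) + f x)"
      using coboundaryD[OF cd(1)] by blast
    obtain g where g: "lc g" "\<And>x y. x \<in> carrier G \<Longrightarrow> y \<in> carrier G \<Longrightarrow> int p dvd d (x, y) - (g y - g (x \<otimes> y) + g x)"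
      using coboundaryD[OF cd(2)] by blast
    show ?thesis
    proof (rule coboundaryI[of "\<lambda>x. f x - g x"])
      show "lc (\<lambda>x. f x - g x)" using f g by (auto intro: locally_const_combine)
      show "red (red (\<lambda>xy. c xy - d xy)) = red (\<lambda>xy. c xy - d xy)" by (auto simp: red_def fun_eq_iff restrict_def)
      fix x y assume xy: "x \<in> carrier G" "y \<in> carrier G"
      have "int p dvd red (\<lambda>xy. c xy - d xy) (x, y) - (c (x, y) - d (x, y))"
        using xy by (simp add: red_eq mod_eq_dvd_iff[symmetric])
      from dvd_add[OF this dvd_diff[OF f(2)[OF xy] g(2)[OF xy]]]
      show "int p dvd red (\<lambda>xy. c xy - d xy) (x, y) - (f y - g y - (f (x \<otimes> y) - g (x \<otimes> y)) + (f x - g x))"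
        by (simp add: algebra_simps)
    qed
  qed
  have neg: "red (\<lambda>xy. - c xy) \<in> D" if "c \<in> D" for c
  proof -
    have "red (\<lambda>xy. - c xy) = red (\<lambda>xy. red (\<lambda>xy. 0) xy - c xy)" by (rule red_cong) (simp add: red_eq)
    then show ?thesis using diff[OF zero that] by simp
  qed
  show ?thesis
  proof (rule Zg.subgroupI)
    show "D \<subseteq> carrier ZZ" using coboundary_cocycle by (auto simp: ZZ_carrier)
    show "D \<noteq> {}" using zero by auto
  next
    fix c assume c: "c \<in> D"
    have cC: "c \<in> C" using coboundary_cocycle c .
    have "inv\<^bsub>ZZ\<^esub> c = red (\<lambda>xy. - c xy)"
    proof (rule Zg.inv_equality)
      show "red (\<lambda>xy. - c xy) \<otimes>\<^bsub>ZZ\<^esub> c = \<one>\<^bsub>ZZ\<^esub>" unfolding ZZ_mult ZZ_one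
        by (rule red_cong) (use red_dvd[of _ _ "\<lambda>xy. - c xy"] in simp)
    qed (use cC neg_cocycle ZZ_carrier in auto)
    then show "inv\<^bsub>ZZ\<^esub> c \<in> D" using neg c by simp
  next
    fix c d assume cd: "c \<in> D" "d \<in> D"
    have "c \<otimes>\<^bsub>ZZ\<^esub> d = red (\<lambda>xy. c xy - red (\<lambda>xy. - d xy) xy)" unfolding ZZ_mult
      by (rule red_cong) (use red_dvd[of _ _ "\<lambda>xy. - d xy"] in \<open>simp add: add.commute\<close>)
    then show "c \<otimes>\<^bsub>ZZ\<^esub> d \<in> D" using diff[OF cd(1) neg[OF cd(2)]] by simp
  qed
qed

lemma normal_D: "D \<lhd> ZZ"
  using comm_group.normal_iff_subgroup[OF group_ZZ] subgroup_D by blast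

lemma group_HH: "group HH" unfolding H2_def using normal_D by (rule normal.factorgroup_is_group)

abbreviation "cl \<equiv> cls p G T"

lemma carrier_HH: "carrier HH = cl ` C"
  by (simp add: H2_def carrier_FactGroup ZZ_carrier cls_def)

lemma one_HH: "\<one>\<^bsub>HH\<^esub> = D" by (simp add: H2_def one_FactGroup)

lemma cl_mult: "c \<in> C \<Longrightarrow> d \<in> C \<Longrightarrow> cl c \<otimes>\<^bsub>HH\<^esub> cl d = cl (red (\<lambda>xy. c xy + d xy))"
  unfolding H2_def cls_def ZZ_mult[symmetric]
  using hom_mult[OF normal.r_coset_hom_Mod[OF normal_D], of c d] by (simp add: ZZ_carrier)

lemma cl_self: "c \<in> C \<Longrightarrow> c \<in> cl c"
  unfolding cls_def using comm_group.axioms(2)[OF group_ZZ] subgroup_D group.rcos_self[of ZZ c D] ZZ_carrier by simp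

text \<open>Gives control of the representative that \<open>pullH\<close> chooses from a
  class.\<close>

lemma cl_rep: assumes "c \<in> C" "d \<in> cl c" shows "d \<in> C" "cl d = cl c"
proof -
  have g: "group ZZ" using comm_group.axioms(2)[OF group_ZZ] .
  show "d \<in> C" using monoid.r_coset_subset_G[OF group.is_monoid[OF g] subgroup.subset[OF subgroup_D], of c] assms by (auto simp: cls_def ZZ_carrier)
  show "cl d = cl c" unfolding cls_def
    using group.repr_independence[OF g _ _ subgroup_D, of d c] assms by (simp add: cls_def ZZ_carrier)
qed

lemma cl_eqI:
  assumes c: "c \<in> C" and d: "d \<in> C" and f: "lc f"
    and eq: "\<And>x y. x \<in> carrier G \<Longrightarrow> y \<in> carrier G \<Longrightarrow> int p dvd c (x, y) - d (x, y) - (f y - f (x \<otimes> y) + f x)"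
  shows "cl c = cl d"
proof -
  have "red (\<lambda>xy. c xy - d xy) \<in> D"
  proof (rule coboundaryI[OF f])
    show "red (red (\<lambda>xy. c xy - d xy)) = red (\<lambda>xy. c xy - d xy)" by (auto simp: red_def fun_eq_iff restrict_def)
    fix x y assume xy: "x \<in> carrier G" "y \<in> carrier G"
    have "int p dvd red (\<lambda>xy. c xy - d xy) (x, y) - (c (x, y) - d (x, y))"
      using xy by (simp add: red_eq mod_eq_dvd_iff[symmetric])
    from dvd_add[OF this eq[OF xy]] show "int p dvd red (\<lambda>xy. c xy - d xy) (x, y) - (f y - f (x \<otimes> y) + f x)"
      by (simp add: algebra_simps)
  qed
  moreover have "red (\<lambda>xy. c xy - d xy) \<otimes>\<^bsub>ZZ\<^esub> d = c"
  proof -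
    have "red (\<lambda>xy. red (\<lambda>xy. c xy - d xy) xy + d xy) = red c"
      by (rule red_cong) (simp add: red_eq mod_eq_dvd_iff[symmetric] mod_simps)
    then show ?thesis by (simp add: ZZ_mult cocycleD(3)[OF c])
  qed
  ultimately have "c \<in> cl d" unfolding cls_def r_coset_def
    by (intro UN_I[of "red (\<lambda>xy. c xy - d xy)"]) simp_all
  then show ?thesis using cl_rep[OF d] by simp
qed

lemma cl_eqD:
  assumes c: "c \<in> C" and d: "d \<in> C" and eq: "cl c = cl d"
  obtains f where "lc f" "\<And>x y. x \<in> carrier G \<Longrightarrow> y \<in> carrier G \<Longrightarrow> int p dvd c (x, y) - d (x, y) - (f y - f (x \<otimes> y) + f x)"
proof -
  have "c \<in> cl d" using cl_self[OF c] eq by simp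
  then obtain e where e: "e \<in> D" "c = e \<otimes>\<^bsub>ZZ\<^esub> d" unfolding cls_def r_coset_def by auto
  obtain f where f: "lc f" "\<And>x y. x \<in> carrier G \<Longrightarrow> y \<in> carrier G \<Longrightarrow> int p dvd e (x, y) - (f y - f (x \<otimes> y) + f x)"
    using coboundaryD[OF e(1)] by blast
  have "int p dvd c (x, y) - d (x, y) - (f y - f (x \<otimes> y) + f x)" if xy: "x \<in> carrier G" "y \<in> carrier G" for x y
  proof -
    have "int p dvd c (x, y) - (e (x, y) + d (x, y))"
      using xy e(2) by (simp add: ZZ_mult red_eq mod_eq_dvd_iff[symmetric])
    from dvd_add[OF this f(2)[OF xy]] show ?thesis by (simp add: algebra_simps)
  qed
  then show thesis using that f(1) by blast
qed

lemma cl_eq_one_iff: "c \<in> C \<Longrightarrow> cl c = \<one>\<^bsub>HH\<^esub> \<longleftrightarrow> c \<in> D"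
proof -
  assume c: "c \<in> C"
  have g: "group ZZ" using comm_group.axioms(2)[OF group_ZZ] .
  show ?thesis unfolding one_HH cls_def
    using group.coset_join1[OF g _ _ subgroup_D, of c]
      group.coset_join2[OF g _ subgroup_D, of c] c by (auto simp: ZZ_carrier)
qed

end

section \<open>Transgression\<close>

context unitriangular
begin

lemma corner_zero:
  assumes n: "1 \<le> n" and A: "A \<in> uf n" "int p dvd A 0 n" shows "A = \<one>\<^bsub>U\<^esub>"
proof -
  have Ac: "A \<in> carrier U" using A by (simp add: uf_def)
  have z: "A 0 n = 0" using A(2) carrierD(1,2)[OF Ac, of 0 n] by (auto dest: zdvd_imp_le)
  have "A i j = \<one>\<^bsub>U\<^esub> i j" if ij: "j < i + Suc n" for i j
  proof (cases "j < i + n")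
    case True then show ?thesis using A by (simp add: uf_def agree_def)
  next
    case False
    then have "j = i + n" using ij by simp
    then show ?thesis using z n carrierD(6)[OF Ac, of j i] by (cases "i = 0") (auto simp: one_entry)
  qed
  then have "A \<in> uf (Suc n)" using Ac by (simp add: uf_def agree_def)
  then show ?thesis using uf_top by simp
qed

lemma corner_additive:
  assumes n: "1 \<le> n" and A: "A \<in> uf n" and B: "B \<in> uf n"
  shows "int p dvd (A \<otimes>\<^bsub>U\<^esub> B) 0 n - (A 0 n + B 0 n)"
  using corner_mult[OF n, of A "\<one>\<^bsub>U\<^esub>" B "\<one>\<^bsub>U\<^esub>"] A B n by (simp add: uf_def one_entry)

text \<open>Writing \<open>A\<close> as \<open>z\<close> times \<open>E\<close> with
  \<open>z\<close> in \<open>uf n\<close> turns the corner of a quotient into one of a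
  product.\<close>

lemma corner_quotient:
  assumes n: "1 \<le> n" and A: "A \<in> carrier U" and E: "E \<in> carrier U" and agr: "agree n A E"
  shows "int p dvd (A \<otimes>\<^bsub>U\<^esub> inv\<^bsub>U\<^esub> E) 0 n - (A 0 n - E 0 n)"
proof -
  define z where "z = A \<otimes>\<^bsub>U\<^esub> inv\<^bsub>U\<^esub> E"
  have z: "z \<in> uf n" unfolding z_def using uf_iff_agree[OF A E] agr by simp
  have "z \<otimes>\<^bsub>U\<^esub> E = A" using A E by (simp add: z_def U.m_assoc)
  moreover have "int p dvd ((z \<otimes>\<^bsub>U\<^esub> E) 0 n - (\<one>\<^bsub>U\<^esub> \<otimes>\<^bsub>U\<^esub> E) 0 n) - ((z 0 n - \<one>\<^bsub>U\<^esub> 0 n) + (E 0 n - E 0 n))"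
    by (rule corner_mult[OF n]) (use z E agree_refl in \<open>auto simp: uf_def\<close>)
  ultimately have "int p dvd (A 0 n - E 0 n) - z 0 n" using E n by (simp add: one_entry)
  then show ?thesis by (simp add: z_def dvd_diff_commute)
qed

end

locale massey_setup = free_pro_prime S T B emb p for S (structure) and T and B :: "'x set" and emb and p +
  fixes N :: "'a set" and n :: nat
  assumes n2: "2 \<le> n" and norm_N: "N \<lhd> S" and closed_N: "closedin T N" and N_Z: "N \<subseteq> zass S T p n"
begin

sublocale u: unitriangular p n using p2 by unfold_locales simp

lemma n1: "1 \<le> n" using n2 by simp

abbreviation "UU \<equiv> unip p n"

sublocale q: top_quotient S T N
  by (rule top_quotient.intro[OF topological_group_axioms top_quotient_axioms.intro[OF norm_N]])

abbreviation "GG \<equiv> S Mod N"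
abbreviation "TG \<equiv> quot_top S T N"
abbreviation "ZG \<equiv> zass GG TG p"

sublocale gz: top_carrier GG TG p
  by (rule top_carrier.intro[OF q.group_Q top_carrier_axioms.intro[OF q.topspace_TQ p2]])

sublocale r: top_quotient GG TG "zass GG TG p n"
  by (rule top_quotient.intro[OF q.topological_group_Q top_quotient_axioms.intro[OF gz.zass_normal]])

abbreviation "KK \<equiv> GG Mod (ZG n)"
abbreviation "TK \<equiv> quot_top GG TG (ZG n)"

sublocale cg: cohomology GG TG p
  by (rule cohomology.intro[OF q.topological_group_Q cohomology_axioms.intro]) (use p2 in simp)

sublocale ck: cohomology KK TK p
  by (rule cohomology.intro[OF r.topological_group_Q cohomology_axioms.intro]) (use p2 in simp)

lemma compact_N: "compactin T N"
  using closed_N compact_T by (rule closedin_compact_space[rotated])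

text \<open>Each inclusion is an instance of minimality: preimages of the terms for the quotient
  satisfy the laws in \<open>S\<close>, and images of the terms of \<open>S\<close> satisfy them in
  the quotient. Only closedness of the images needs more than algebra.\<close>

lemma ZG_eq: "ZG m = q.pr ` Z m"
proof
  define F where "F = (\<lambda>m. {x \<in> carrier S. q.pr x \<in> ZG m})"
  have "Z m \<subseteq> F m"
  proof (rule zs.zass_least)
    fix m
    note sub = gz.zass_props(1)[of m]
    show "subgroup (F m) S"
    proof (rule subgroupI)
      show "F m \<subseteq> carrier S" by (auto simp: F_def)
      have "\<one> \<in> F m" using subgroup.one_closed[OF sub] q.prh.hom_one by (simp add: F_def)
      then show "F m \<noteq> {}" by blast
      show "inv x \<in> F m" if "x \<in> F m" for x
        using that subgroup.m_inv_closed[OF sub] q.prh.hom_inv[of x] by (simp add: F_def)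
      show "x \<otimes> y \<in> F m" if "x \<in> F m" "y \<in> F m" for x y
        using that subgroup.m_closed[OF sub] q.prh.hom_mult[of x y] by (simp add: F_def)
    qed
    show "closedin T (F m)"
      using closedin_continuous_map_preimage[OF q.pr_cont gz.zass_props(2)[of m]] by (simp add: F_def topspace_T)
    show "F m = carrier S" if "m \<le> 1" using that q.prh.hom_closed by (auto simp: F_def gz.zass_01)
  next
    fix m x assume "2 \<le> m" "x \<in> F ((m + p - 1) div p)"
    then show "x [^] p \<in> F m" using gz.zass_power_ceil[of m "q.pr x"] by (simp add: F_def q.prh.hom_nat_pow)
  next
    fix i j :: nat and x y assume "1 \<le> i" "1 \<le> j" "x \<in> F i" "y \<in> F j"
    then show "x \<otimes> y \<otimes> inv x \<otimes> inv y \<in> F (i + j)"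
      using gz.zass_commutator[of i j "q.pr x" "q.pr y"] by (simp add: F_def)
  qed
  then show "q.pr ` Z m \<subseteq> ZG m" by (auto simp: F_def)
next
  show "ZG m \<subseteq> q.pr ` Z m"
  proof (rule gz.zass_least)
    fix m
    show "subgroup (q.pr ` Z m) GG" using zs.zass_props(1) by (rule q.prh.subgroup_img_is_subgroup)
    have ZC: "Z m \<subseteq> carrier S" using zs.zass_carrier by blast
    have "{x \<in> carrier S. q.pr x \<in> q.pr ` Z m} = (\<lambda>(a, b). a \<otimes> b) ` (N \<times> Z m)"
    proof (intro equalityI subsetI)
      fix x assume "x \<in> {x \<in> carrier S. q.pr x \<in> q.pr ` Z m}"
      then obtain z where z: "x \<in> carrier S" "z \<in> Z m" "q.pr x = q.pr z" by auto
      then have "x \<otimes> inv z \<in> N" "x = (x \<otimes> inv z) \<otimes> z" using q.pr_eq_iff[of x z] ZC by (auto simp: m_assoc)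
      then show "x \<in> (\<lambda>(a, b). a \<otimes> b) ` (N \<times> Z m)" using z by force
    next
      fix x assume "x \<in> (\<lambda>(a, b). a \<otimes> b) ` (N \<times> Z m)"
      then obtain a z where az: "a \<in> N" "z \<in> Z m" "x = a \<otimes> z" by auto
      have c: "a \<in> carrier S" "z \<in> carrier S" using az ZC subgroup.mem_carrier[OF q.sub_N] by auto
      then have "q.pr x = q.pr z" using q.pr_eq_iff[of x z] az by (simp add: m_assoc)
      then show "x \<in> {x \<in> carrier S. q.pr x \<in> q.pr ` Z m}" using az c by (metis (mono_tags, lifting) imageI m_closed mem_Collect_eq)
    qed
    \<comment> \<open>The saturation of \<open>Z m\<close> is the product set of \<open>N\<close>
      and \<open>Z m\<close>, the image of a compact set and hence closed in a Hausdorff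
      space.\<close>
    moreover have "compactin T ((\<lambda>(a, b). a \<otimes> b) ` (N \<times> Z m))"
      using compact_N zs.zass_props(2) compact_T mult_cont
      by (intro image_compactin[of "prod_topology T T"]) (auto simp: compactin_Times closedin_compact_space)
    ultimately have cl: "closedin T {x \<in> carrier S. q.pr x \<in> q.pr ` Z m}"
      using compactin_imp_closedin[OF Hausdorff_T] by simp
    have "{x \<in> carrier S. q.pr x \<in> carrier GG - q.pr ` Z m} = topspace T - {x \<in> carrier S. q.pr x \<in> q.pr ` Z m}"
      using q.prh.hom_closed by (auto simp: topspace_T)
    then have "openin TG (carrier GG - q.pr ` Z m)" using cl by (simp add: q.openin_TQ openin_diff)
    moreover have "q.pr ` Z m \<subseteq> carrier GG" using ZC by (auto simp: q.carrier_Q)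
    ultimately show "closedin TG (q.pr ` Z m)" by (simp add: closedin_def q.topspace_TQ)
    show "q.pr ` Z m = carrier GG" if "m \<le> 1" using that by (simp add: zs.zass_01 q.carrier_Q)
  next
    fix m x assume m: "2 \<le> m" and "x \<in> q.pr ` Z ((m + p - 1) div p)"
    then obtain a where a: "a \<in> Z ((m + p - 1) div p)" "x = q.pr a" by blast
    have "q.pr (a [^] p) \<in> q.pr ` Z m" using zs.zass_power_ceil[OF m a(1)] by (rule imageI)
    then show "x [^]\<^bsub>GG\<^esub> p \<in> q.pr ` Z m" using a zs.zass_carrier[OF a(1)] by (simp add: q.prh.hom_nat_pow)
  next
    fix i j :: nat and x y assume ij: "1 \<le> i" "1 \<le> j" and "x \<in> q.pr ` Z i" "y \<in> q.pr ` Z j"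
    then obtain a b where ab: "a \<in> Z i" "b \<in> Z j" "x = q.pr a" "y = q.pr b" by blast
    have "q.pr (a \<otimes> b \<otimes> inv a \<otimes> inv b) \<in> q.pr ` Z (i + j)"
      using zs.zass_commutator[OF ij ab(1,2)] by (rule imageI)
    then show "x \<otimes>\<^bsub>GG\<^esub> y \<otimes>\<^bsub>GG\<^esub> inv\<^bsub>GG\<^esub> x \<otimes>\<^bsub>GG\<^esub> inv\<^bsub>GG\<^esub> y \<in> q.pr ` Z (i + j)"
      using ab zs.zass_carrier[OF ab(1)] zs.zass_carrier[OF ab(2)] by simp
  qed
qed

lemma pr_in_ZG_iff: assumes "x \<in> carrier S" shows "q.pr x \<in> ZG n \<longleftrightarrow> x \<in> Z n"
proof
  assume "q.pr x \<in> ZG n"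
  then obtain z where z: "z \<in> Z n" "q.pr x = q.pr z" by (auto simp: ZG_eq)
  have zc: "z \<in> carrier S" using zs.zass_carrier z by blast
  have "x \<otimes> inv z \<in> Z n" using q.pr_eq_iff[OF assms zc] z N_Z by auto
  from subgroup.m_closed[OF zs.zass_props(1) this z(1)] show "x \<in> Z n" using assms zc by (simp add: m_assoc)
qed (simp add: ZG_eq)

text \<open>Because \<open>N \<subseteq> Z n\<close>, the group \<open>KK\<close> is S/S_(n,p), and
  \<open>\<kappa>\<close> plays the role of its projection from \<open>S\<close>;
  \<open>kappa_eq_iff\<close> is all that is left of \<open>N\<close>.\<close>

definition \<kappa> :: "'a \<Rightarrow> 'a set set" where "\<kappa> x = r.pr (q.pr x)"

lemma kappa_mult: "x \<in> carrier S \<Longrightarrow> y \<in> carrier S \<Longrightarrow> \<kappa> (x \<otimes> y) = \<kappa> x \<otimes>\<^bsub>KK\<^esub> \<kappa> y"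
  by (simp add: \<kappa>_def)

lemma kappa_carrier: "x \<in> carrier S \<Longrightarrow> \<kappa> x \<in> carrier KK"
  using q.prh.hom_closed r.prh.hom_closed by (simp add: \<kappa>_def)

lemma kappa_surj: assumes "c \<in> carrier KK" obtains x where "x \<in> carrier S" "c = \<kappa> x"
  using assms by (auto simp: \<kappa>_def r.carrier_Q q.carrier_Q)

lemma kappa_eq_iff: assumes "x \<in> carrier S" "y \<in> carrier S" shows "\<kappa> x = \<kappa> y \<longleftrightarrow> x \<otimes> inv y \<in> Z n"
  using r.pr_eq_iff[of "q.pr x" "q.pr y"] pr_in_ZG_iff[of "x \<otimes> inv y"] assms q.prh.hom_closed
  by (simp add: \<kappa>_def)

lemma kappa_Z: "z \<in> Z n \<Longrightarrow> \<kappa> z = \<kappa> \<one>"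
  using kappa_eq_iff[of z \<one>] zs.zass_carrier[of z] by simp

lemma kappa_cont: "continuous_map T TK \<kappa>"
  using continuous_map_compose[OF q.pr_cont r.pr_cont] by (simp add: o_def \<kappa>_def[abs_def])

lemma kappa_descend:
  assumes f: "continuous_map T (discrete_topology D) f"
    and const: "\<And>x z. x \<in> carrier S \<Longrightarrow> z \<in> Z n \<Longrightarrow> f (z \<otimes> x) = f x"
  obtains g where "continuous_map TK (discrete_topology D) g" "\<And>x. x \<in> carrier S \<Longrightarrow> g (\<kappa> x) = f x"
proof -
  have "f (y \<otimes> x) = f x" if "x \<in> carrier S" "y \<in> N" for x y using const that N_Z by blast
  then obtain h where h: "continuous_map TG (discrete_topology D) h" "\<And>x. x \<in> carrier S \<Longrightarrow> h (q.pr x) = f x"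
    using q.descend_cont[OF f] by metis
  have "h (d \<otimes>\<^bsub>GG\<^esub> c) = h c" if cd: "c \<in> carrier GG" "d \<in> ZG n" for c d
  proof -
    obtain x z where xz: "x \<in> carrier S" "c = q.pr x" "z \<in> Z n" "d = q.pr z"
      using cd by (auto simp: q.carrier_Q ZG_eq)
    then have "d \<otimes>\<^bsub>GG\<^esub> c = q.pr (z \<otimes> x)" using zs.zass_carrier[of z n] by simp
    then show ?thesis using xz h(2) const zs.zass_carrier[of z n] by (simp del: q.prh.hom_mult)
  qed
  then obtain g where "continuous_map TK (discrete_topology D) g" "\<And>c. c \<in> carrier GG \<Longrightarrow> g (r.pr c) = h c"
    using r.descend_cont[OF h(1)] by metis
  then show thesis using that h(2) q.prh.hom_closed by (simp add: \<kappa>_def)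
qed

lemma hom_kills_Z:
  assumes "\<rho> \<in> cont_hom_fin S T (unip p m)" "x \<in> Z (Suc m)" shows "\<rho> x = \<one>\<^bsub>unip p m\<^esub>"
proof -
  interpret v: unitriangular p m using p2 by unfold_locales simp
  show ?thesis using zs.zass_kernel_uf[OF p assms] v.uf_top by simp
qed

text \<open>Homomorphisms from \<open>S\<close> to U_(n-1) kill S_(n,p) and thus \<open>N\<close>,
  so \<open>S\<close> and its quotient have the same ones and Magnus' theorem in degree
  \<open>n - 1\<close> applies.\<close>

theorem TU_quotient: "TU GG TG (unip p (n - 1)) = ZG n"
proof (intro equalityI subsetI)
  fix c assume c: "c \<in> TU GG TG (unip p (n - 1))"
  then obtain x where x: "x \<in> carrier S" "c = q.pr x" by (auto simp: TU_def q.carrier_Q)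
  interpret v: unitriangular p "n - 1" using p2 by unfold_locales simp
  have "\<rho> x = \<one>\<^bsub>unip p (n - 1)\<^esub>" if \<rho>: "\<rho> \<in> cont_hom_fin S T (unip p (n - 1))" for \<rho>
  proof -
    have "\<rho> y = \<one>\<^bsub>unip p (n - 1)\<^esub>" if "y \<in> N" for y
      using hom_kills_Z[OF \<rho>] that N_Z n1 by auto
    then obtain g where g: "g \<in> cont_hom_fin GG TG (unip p (n - 1))" "\<And>x. x \<in> carrier S \<Longrightarrow> g (q.pr x) = \<rho> x"
      using q.cont_hom_descend[OF v.U.is_group \<rho>] by metis
    have "c \<in> kernel GG (unip p (n - 1)) g" using c g(1) unfolding TU_def by blast
    then show ?thesis using g(2)[OF x(1)] x(2) by (simp add: kernel_def)
  qed
  then have "x \<in> TU S T (unip p (n - 1))" using x by (auto simp: TU_def kernel_def)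
  from TU_subset_zass[OF _ this] have "x \<in> Z n" using n2 by simp
  then show "c \<in> ZG n" using x by (simp add: ZG_eq)
next
  fix c assume c: "c \<in> ZG n"
  interpret v: unitriangular p "n - 1" using p2 by unfold_locales simp
  have "g c = \<one>\<^bsub>unip p (n - 1)\<^esub>" if "g \<in> cont_hom_fin GG TG (unip p (n - 1))" for g
    using gz.zass_kernel_uf[OF p that c] v.uf_top n1 by simp
  then show "c \<in> TU GG TG (unip p (n - 1))" using gz.zass_carrier[OF c] by (auto simp: TU_def kernel_def)
qed

sublocale mZ: mod_homs S p "zass S T p n"
  by (rule mod_homs.intro[OF is_group mod_homs_axioms.intro[OF p zs.zass_props(1)]])

abbreviation "lcS \<equiv> continuous_map T (discrete_topology (UNIV :: int set))"

text \<open>A homomorphism to Z/p kills p-th powers and commutators, hence every term of the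
  filtration from level 2 on; this uses \<open>2 \<le> n\<close>.\<close>

lemma additive_vanishes:
  assumes f: "lcS f" and add: "\<And>x y. x \<in> carrier S \<Longrightarrow> y \<in> carrier S \<Longrightarrow> int p dvd f (x \<otimes> y) - (f x + f y)"
    and z: "z \<in> Z n"
  shows "int p dvd f z"
proof -
  interpret m: mod_homs S p "carrier S"
    by (rule mod_homs.intro[OF is_group mod_homs_axioms.intro[OF p subgroup_self]])
  have ad: "m.additive f" using add by (simp add: m.additive_def)
  define F where "F = (\<lambda>m :: nat. if m \<le> 1 then carrier S else {x \<in> carrier S. int p dvd f x})"
  have "Z n \<subseteq> F n"
  proof (rule zs.zass_least)
    fix m
    show "subgroup (F m) S" using m.kernel_subgroup[OF ad subgroup_self] subgroup_self by (simp add: F_def)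
    have "closedin T {x \<in> topspace T. f x \<in> {k. int p dvd k}}" using f by (rule closedin_continuous_map_preimage) simp
    then show "closedin T (F m)" using closedin_topspace[of T] by (simp add: F_def topspace_T)
    show "F m = carrier S" if "m \<le> 1" using that by (simp add: F_def)
  next
    fix m x assume m: "2 \<le> m" and x: "x \<in> Z ((m + p - 1) div p)"
    have xc: "x \<in> carrier S" using zs.zass_carrier[OF x] .
    have "int p dvd f (x [^] p)" using m.additive_pow[OF ad xc, of p] by (simp add: dvd_diff_left_iff)
    then show "x [^] p \<in> F m" using xc m by (simp add: F_def)
  next
    fix i j :: nat and x y assume ij: "1 \<le> i" "1 \<le> j" and "x \<in> Z i" "y \<in> Z j"
    then have c: "x \<in> carrier S" "y \<in> carrier S" using zs.zass_carrier by auto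
    have c': "inv x \<in> carrier S" "inv y \<in> carrier S" "x \<otimes> y \<in> carrier S" "x \<otimes> y \<otimes> inv x \<in> carrier S"
      using c by auto
    from dvd_add[OF dvd_add[OF dvd_add[OF dvd_add[OF add[OF c'(4,2)] add[OF c'(3,1)]] add[OF c]] m.additive_inv[OF ad c(1)]] m.additive_inv[OF ad c(2)]]
    have "int p dvd f (x \<otimes> y \<otimes> inv x \<otimes> inv y)" by (simp add: algebra_simps)
    then show "x \<otimes> y \<otimes> inv x \<otimes> inv y \<in> F (i + j)" using ij c by (simp add: F_def)
  qed
  then show ?thesis using z n2 by (auto simp: F_def)
qed

text \<open>\<open>splits c f \<phi>\<close>: the inflation of \<open>c\<close> to the free group \<open>S\<close> is the coboundary of \<open>f\<close>, and \<open>\<phi>\<close> is (up to sign)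
  the homomorphism on \<open>S_(n,p)\<close> whose transgression is the class of \<open>c\<close>.\<close>
definition splits :: "('a set set \<times> 'a set set \<Rightarrow> int) \<Rightarrow> ('a \<Rightarrow> int) \<Rightarrow> ('a \<Rightarrow> int) \<Rightarrow> bool" where
  "splits c f \<phi> \<longleftrightarrow> c \<in> ck.C \<and> lcS f
     \<and> (\<forall>s\<in>carrier S. \<forall>t\<in>carrier S. int p dvd c (\<kappa> s, \<kappa> t) - (f s + f t - f (s \<otimes> t)))
     \<and> (\<forall>s\<in>Z n. int p dvd \<phi> s - (f \<one> - f s))"

text \<open>The graph of the transgression, up to congruence on \<open>Z n\<close>. The lemmas below
  make it functional in both directions and additive, which is what the transgression is used
  for.\<close>

definition rel :: "('a set set \<times> 'a set set \<Rightarrow> int) set \<Rightarrow> ('a \<Rightarrow> int) \<Rightarrow> bool" where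
  "rel x \<phi> \<longleftrightarrow> (\<exists>c f. x = ck.cl c \<and> splits c f \<phi>)"

lemma splitsD:
  assumes "splits c f \<phi>"
  shows "c \<in> ck.C" "lcS f"
    "s \<in> carrier S \<Longrightarrow> t \<in> carrier S \<Longrightarrow> int p dvd c (\<kappa> s, \<kappa> t) - (f s + f t - f (s \<otimes> t))"
    "s \<in> Z n \<Longrightarrow> int p dvd \<phi> s - (f \<one> - f s)"
  using assms by (auto simp: splits_def)

lemma lc_kappa: "ck.lc g \<Longrightarrow> lcS (\<lambda>s. g (\<kappa> s))"
  using continuous_map_compose[OF kappa_cont] by (simp add: o_def)

text \<open>Another cocycle of the class changes \<open>f\<close> by a cochain pulled back from
  \<open>KK\<close>, which is constant on \<open>Z n\<close> and leaves \<open>\<phi>\<close> as it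
  is.\<close>

lemma splits_rep:
  assumes "rel x \<phi>" "c' \<in> ck.C" "x = ck.cl c'" obtains f' where "splits c' f' \<phi>"
proof -
  obtain c f where cf: "x = ck.cl c" "splits c f \<phi>" using assms by (auto simp: rel_def)
  note sp = splitsD[OF cf(2)]
  have "ck.cl c' = ck.cl c" using cf assms by simp
  then obtain g where g: "ck.lc g"
    "\<And>x y. x \<in> carrier KK \<Longrightarrow> y \<in> carrier KK \<Longrightarrow> int p dvd c' (x, y) - c (x, y) - (g y - g (x \<otimes>\<^bsub>KK\<^esub> y) + g x)"
    using ck.cl_eqD[OF assms(2) sp(1)] by metis
  define f' where "f' = (\<lambda>s. f s + g (\<kappa> s))"
  have "lcS f'" unfolding f'_def using sp(2) lc_kappa[OF g(1)] by (rule locally_const_combine) simp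
  moreover have "int p dvd c' (\<kappa> s, \<kappa> t) - (f' s + f' t - f' (s \<otimes> t))" if st: "s \<in> carrier S" "t \<in> carrier S" for s t
  proof -
    have "int p dvd c' (\<kappa> s, \<kappa> t) - c (\<kappa> s, \<kappa> t) - (g (\<kappa> t) - g (\<kappa> s \<otimes>\<^bsub>KK\<^esub> \<kappa> t) + g (\<kappa> s))"
      using g(2) st kappa_carrier by blast
    from dvd_add[OF this sp(3)[OF st]] show ?thesis using st by (simp add: f'_def kappa_mult algebra_simps)
  qed
  moreover have "int p dvd \<phi> s - (f' \<one> - f' s)" if "s \<in> Z n" for s
    using sp(4)[OF that] kappa_Z[OF that] by (simp add: f'_def)
  ultimately have "splits c' f' \<phi>" using assms(2) by (simp add: splits_def)
  then show thesis by (rule that)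
qed

text \<open>Cocycles are not normalised. The identity at (1, 1, s) gives c(1, s) = c(1, 1) = f(1),
  and this is the reason for the term \<open>f \<one>\<close> in \<open>splits\<close>.\<close>

lemma splits_translate:
  assumes sp: "splits c f \<phi>" and z: "z \<in> Z n" and s: "s \<in> carrier S"
  shows "int p dvd f (z \<otimes> s) - (f s - \<phi> z)"
proof -
  have zc: "z \<in> carrier S" using zs.zass_carrier[OF z] .
  have k1: "\<kappa> \<one> \<in> carrier KK" "\<kappa> s \<in> carrier KK" using kappa_carrier s by auto
  have k11: "\<kappa> \<one> \<otimes>\<^bsub>KK\<^esub> \<kappa> s = \<kappa> s" "\<kappa> \<one> \<otimes>\<^bsub>KK\<^esub> \<kappa> \<one> = \<kappa> \<one>"
    using kappa_mult[of \<one> s] kappa_mult[of \<one> \<one>] s by auto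
  have "int p dvd c (\<kappa> \<one>, \<kappa> s) - c (\<kappa> \<one> \<otimes>\<^bsub>KK\<^esub> \<kappa> \<one>, \<kappa> s) + c (\<kappa> \<one>, \<kappa> \<one> \<otimes>\<^bsub>KK\<^esub> \<kappa> s) - c (\<kappa> \<one>, \<kappa> \<one>)"
    using ck.cocycleD(1)[OF splitsD(1)[OF sp]] k1 unfolding ck.cocycle_id_def by blast
  then have 1: "int p dvd c (\<kappa> \<one>, \<kappa> s) - c (\<kappa> \<one>, \<kappa> \<one>)" by (simp add: k11)
  have 2: "int p dvd c (\<kappa> \<one>, \<kappa> \<one>) - f \<one>" using splitsD(3)[OF sp, of \<one> \<one>] by simp
  have 3: "int p dvd c (\<kappa> \<one>, \<kappa> s) - (f z + f s - f (z \<otimes> s))"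
    using splitsD(3)[OF sp zc s] kappa_Z[OF z] by simp
  have 4: "int p dvd \<phi> z - (f \<one> - f z)" by (rule splitsD(4)[OF sp z])
  from dvd_add[OF dvd_diff[OF dvd_diff[OF 3 1] 2] 4] show ?thesis by (simp add: algebra_simps)
qed

lemma rel_carrier: "rel x \<phi> \<Longrightarrow> x \<in> carrier ck.HH"
  using splitsD(1) by (auto simp: rel_def ck.carrier_HH)

text \<open>Two splittings of one cocycle differ by a homomorphism from \<open>S\<close> to Z/p, and
  such a homomorphism vanishes on \<open>Z n\<close>.\<close>

lemma rel_fun:
  assumes "rel x \<phi>" "rel x \<psi>" "z \<in> Z n" shows "int p dvd \<phi> z - \<psi> z"
proof -
  obtain c f where cf: "x = ck.cl c" "splits c f \<phi>" using assms(1) by (auto simp: rel_def)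
  obtain f' where f': "splits c f' \<psi>" using splits_rep[OF assms(2) splitsD(1)[OF cf(2)] cf(1)] by blast
  define h where "h = (\<lambda>s. f s - f' s)"
  have "lcS h" unfolding h_def using splitsD(2)[OF cf(2)] splitsD(2)[OF f'] by (rule locally_const_combine) simp
  moreover have "int p dvd h (s \<otimes> t) - (h s + h t)" if "s \<in> carrier S" "t \<in> carrier S" for s t
    using dvd_diff[OF splitsD(3)[OF cf(2) that] splitsD(3)[OF f' that]] by (simp add: h_def algebra_simps)
  ultimately have van: "int p dvd h y" if "y \<in> Z n" for y using additive_vanishes that by blast
  have "\<one> \<in> Z n" using zs.zass_props(1) by (rule subgroup.one_closed)
  from dvd_diff[OF dvd_add[OF dvd_diff[OF splitsD(4)[OF cf(2) assms(3)] splitsD(4)[OF f' assms(3)]] van[OF this]] van[OF assms(3)]]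
  show ?thesis by (simp add: h_def algebra_simps)
qed

text \<open>If the functionals coincide, the difference of the two splittings is constant modulo p
  on cosets of \<open>Z n\<close>. It descends to \<open>KK\<close> and bounds the difference of the
  cocycles.\<close>

lemma rel_inj:
  assumes "rel x \<phi>" "rel y \<phi>" shows "x = y"
proof -
  obtain c f where cf: "x = ck.cl c" "splits c f \<phi>" using assms(1) by (auto simp: rel_def)
  obtain d f' where df: "y = ck.cl d" "splits d f' \<phi>" using assms(2) by (auto simp: rel_def)
  define h where "h = (\<lambda>s. (f s - f' s) mod int p)"
  have "lcS h" unfolding h_def using splitsD(2)[OF cf(2)] splitsD(2)[OF df(2)] by (rule locally_const_combine) simp
  moreover have "h (z \<otimes> s) = h s" if "s \<in> carrier S" "z \<in> Z n" for s z
    using dvd_diff[OF splits_translate[OF cf(2) that(2,1)] splits_translate[OF df(2) that(2,1)]]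
    by (simp add: h_def mod_eq_dvd_iff algebra_simps)
  ultimately obtain g where g: "ck.lc g" "\<And>s. s \<in> carrier S \<Longrightarrow> g (\<kappa> s) = h s" using kappa_descend by metis
  have "ck.cl c = ck.cl d"
  proof (rule ck.cl_eqI[OF splitsD(1)[OF cf(2)] splitsD(1)[OF df(2)] g(1)])
    fix a b assume ab: "a \<in> carrier KK" "b \<in> carrier KK"
    obtain s where s: "s \<in> carrier S" "a = \<kappa> s" using kappa_surj[OF ab(1)] .
    obtain t where t: "t \<in> carrier S" "b = \<kappa> t" using kappa_surj[OF ab(2)] .
    have st: "s \<otimes> t \<in> carrier S" using s t by simp
    have hd: "int p dvd (f y - f' y) - h y" for y by (simp add: h_def mod_eq_dvd_iff[symmetric])
    from dvd_diff[OF dvd_add[OF dvd_add[OF dvd_diff[OF splitsD(3)[OF cf(2) s(1) t(1)] splitsD(3)[OF df(2) s(1) t(1)]]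
        hd[of s]] hd[of t]] hd[of "s \<otimes> t"]]
    have "int p dvd c (a, b) - d (a, b) - (h t - h (s \<otimes> t) + h s)"
      unfolding s(2) t(2) by (simp add: algebra_simps)
    moreover have "g (a \<otimes>\<^bsub>KK\<^esub> b) = h (s \<otimes> t)"
      using g(2)[OF st] unfolding kappa_mult[OF s(1) t(1)] s(2) t(2) .
    moreover have "g a = h s" "g b = h t" using g(2) s t by auto
    ultimately show "int p dvd c (a, b) - d (a, b) - (g b - g (a \<otimes>\<^bsub>KK\<^esub> b) + g a)" by simp
  qed
  then show ?thesis using cf df by simp
qed

lemma rel_cong: "rel x \<phi> \<Longrightarrow> (\<And>z. z \<in> Z n \<Longrightarrow> int p dvd \<phi> z - \<psi> z) \<Longrightarrow> rel x \<psi>"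
proof -
  assume "rel x \<phi>" and eq: "\<And>z. z \<in> Z n \<Longrightarrow> int p dvd \<phi> z - \<psi> z"
  then obtain c f where cf: "x = ck.cl c" "splits c f \<phi>" by (auto simp: rel_def)
  have "int p dvd \<psi> z - (f \<one> - f z)" if "z \<in> Z n" for z
    using dvd_diff[OF splitsD(4)[OF cf(2) that] eq[OF that]] by (simp add: algebra_simps)
  then have "splits c f \<psi>" using cf(2) by (simp add: splits_def)
  then show "rel x \<psi>" using cf(1) by (auto simp: rel_def)
qed

lemma rel_one: "rel \<one>\<^bsub>ck.HH\<^esub> (\<lambda>z. 0)"
proof -
  let ?c = "ck.red (\<lambda>xy. 0)"
  have c: "?c \<in> ck.D"
    by (rule ck.coboundaryI[of "\<lambda>x. 0"]) (auto simp: ck.red_def fun_eq_iff restrict_def)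
  have cC: "?c \<in> ck.C" using ck.coboundary_cocycle[OF c] .
  then have "ck.cl ?c = \<one>\<^bsub>ck.HH\<^esub>" using ck.cl_eq_one_iff[of ?c] c by simp
  moreover have "splits ?c (\<lambda>s. 0) (\<lambda>z. 0)"
    using cC kappa_carrier by (auto simp: splits_def ck.red_eq)
  ultimately show ?thesis unfolding rel_def by metis
qed

lemma rel_diff:
  assumes "rel x \<phi>" "rel y \<psi>" shows "rel (x \<otimes>\<^bsub>ck.HH\<^esub> inv\<^bsub>ck.HH\<^esub> y) (\<lambda>z. \<phi> z - \<psi> z)"
proof -
  interpret H: group ck.HH by (rule ck.group_HH)
  obtain c f where cf: "x = ck.cl c" "splits c f \<phi>" using assms(1) by (auto simp: rel_def)
  obtain d f' where df: "y = ck.cl d" "splits d f' \<psi>" using assms(2) by (auto simp: rel_def)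
  note c = splitsD(1)[OF cf(2)] and d = splitsD(1)[OF df(2)]
  let ?e = "ck.red (\<lambda>xy. c xy + ck.red (\<lambda>xy. - d xy) xy)"
  have e: "?e \<in> ck.C" by (rule ck.add_cocycle[OF c ck.neg_cocycle[OF d]])
  have ed: "int p dvd ?e (a, b) - (c (a, b) - d (a, b))" if "a \<in> carrier KK" "b \<in> carrier KK" for a b
    using dvd_add[OF ck.red_dvd[OF that, of "\<lambda>xy. c xy + ck.red (\<lambda>xy. - d xy) xy"] ck.red_dvd[OF that, of "\<lambda>xy. - d xy"]]
    by (simp add: algebra_simps)
  have "ck.red (\<lambda>xy. ?e xy + d xy) = ck.red c"
    by (rule ck.red_cong) (use ed in \<open>simp add: algebra_simps\<close>)
  then have "ck.cl ?e \<otimes>\<^bsub>ck.HH\<^esub> y = x" using ck.cl_mult[OF e d] ck.cocycleD(3)[OF c] cf df by simp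
  moreover have "ck.cl ?e \<in> carrier ck.HH" using e by (simp add: ck.carrier_HH)
  ultimately have eq: "x \<otimes>\<^bsub>ck.HH\<^esub> inv\<^bsub>ck.HH\<^esub> y = ck.cl ?e"
    using rel_carrier[OF assms(2)] H.inv_solve_right[of "ck.cl ?e" x y] rel_carrier[OF assms(1)] by simp
  have "splits ?e (\<lambda>s. f s - f' s) (\<lambda>z. \<phi> z - \<psi> z)"
    unfolding splits_def
  proof (intro conjI ballI e)
    show "lcS (\<lambda>s. f s - f' s)" using splitsD(2)[OF cf(2)] splitsD(2)[OF df(2)] by (rule locally_const_combine) simp
    fix s t assume st: "s \<in> carrier S" "t \<in> carrier S"
    from dvd_add[OF ed[OF kappa_carrier[OF st(1)] kappa_carrier[OF st(2)]]
        dvd_diff[OF splitsD(3)[OF cf(2) st] splitsD(3)[OF df(2) st]]]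
    show "int p dvd ?e (\<kappa> s, \<kappa> t) - (f s - f' s + (f t - f' t) - (f (s \<otimes> t) - f' (s \<otimes> t)))"
      by (simp add: algebra_simps)
  next
    fix s assume s: "s \<in> Z n"
    from dvd_diff[OF splitsD(4)[OF cf(2) s] splitsD(4)[OF df(2) s]]
    show "int p dvd \<phi> s - \<psi> s - (f \<one> - f' \<one> - (f s - f' s))" by (simp add: algebra_simps)
  qed
  with eq show ?thesis unfolding rel_def by (intro exI conjI)
qed

text \<open>Together with \<open>rel_zspan\<close> this is the dictionary between generated
  subgroups of cohomology and spans of functionals.\<close>

lemma rel_generate:
  assumes "x \<in> generate ck.HH A" "\<And>x. x \<in> A \<Longrightarrow> \<exists>\<phi>\<in>Y. rel x \<phi>"
  shows "\<exists>\<phi>\<in>zspan Y. rel x \<phi>"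
proof -
  interpret H: group ck.HH by (rule ck.group_HH)
  have inv_rel: "\<exists>\<phi>\<in>zspan Y. rel (inv\<^bsub>ck.HH\<^esub> y) \<phi>" if y: "\<exists>\<phi>\<in>zspan Y. rel y \<phi>" for y
  proof -
    obtain \<phi> where \<phi>: "\<phi> \<in> zspan Y" "rel y \<phi>" using y by blast
    have "rel (\<one>\<^bsub>ck.HH\<^esub> \<otimes>\<^bsub>ck.HH\<^esub> inv\<^bsub>ck.HH\<^esub> y) (\<lambda>z. 0 - \<phi> z)" by (rule rel_diff[OF rel_one \<phi>(2)])
    then have "rel (inv\<^bsub>ck.HH\<^esub> y) (\<lambda>z. 0 - \<phi> z)" using rel_carrier[OF \<phi>(2)] by simp
    then show ?thesis using zspan.diff[OF zspan.zero \<phi>(1)] by blast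
  qed
  show ?thesis using assms(1)
  proof (induction rule: generate.induct)
    case one
    then show ?case using rel_one zspan.zero by blast
  next
    case (incl h)
    then show ?case using assms(2) zspan.incl by blast
  next
    case (inv h)
    have "\<exists>\<phi>\<in>zspan Y. rel h \<phi>" using assms(2)[OF inv] zspan.incl by blast
    then show ?case by (rule inv_rel)
  next
    case (eng x y)
    obtain \<phi> where \<phi>: "\<phi> \<in> zspan Y" "rel x \<phi>" using eng by blast
    have y: "\<exists>\<psi>\<in>zspan Y. rel y \<psi>" by (rule eng.IH(2))
    obtain \<psi> where \<psi>: "\<psi> \<in> zspan Y" "rel (inv\<^bsub>ck.HH\<^esub> y) \<psi>" using inv_rel[OF y] by blast
    have "inv\<^bsub>ck.HH\<^esub> (inv\<^bsub>ck.HH\<^esub> y) = y" using y by (elim bexE) (rule H.inv_inv[OF rel_carrier])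
    then have "rel (x \<otimes>\<^bsub>ck.HH\<^esub> y) (\<lambda>z. \<phi> z - \<psi> z)" using rel_diff[OF \<phi>(2) \<psi>(2)] by (simp only:)
    then show ?case using zspan.diff[OF \<phi>(1) \<psi>(1)] by (rule bexI)
  qed
qed

lemma rel_zspan:
  assumes "\<phi> \<in> zspan Y" "\<And>\<phi>. \<phi> \<in> Y \<Longrightarrow> \<exists>x\<in>A. rel x \<phi>" "A \<subseteq> carrier ck.HH"
  shows "\<exists>x\<in>generate ck.HH A. rel x \<phi>"
  using assms(1)
proof (induction rule: zspan.induct)
  case zero
  then show ?case using rel_one generate.one by blast
next
  case (incl \<phi>)
  then show ?case using assms(2) generate.incl by metis
next
  case (diff \<phi> \<psi>)
  note sub = group.generate_is_subgroup[OF ck.group_HH assms(3)]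
  obtain x y where xy: "x \<in> generate ck.HH A" "rel x \<phi>" "y \<in> generate ck.HH A" "rel y \<psi>" using diff by blast
  have "x \<otimes>\<^bsub>ck.HH\<^esub> inv\<^bsub>ck.HH\<^esub> y \<in> generate ck.HH A"
    using subgroup.m_closed[OF sub xy(1) subgroup.m_inv_closed[OF sub xy(3)]] .
  then show ?case using rel_diff[OF xy(2,4)] by blast
qed

text \<open>Over \<open>S\<close> the cocycle is the coboundary of \<open>f\<close>, and by
  \<open>splits_translate\<close> the function \<open>f\<close> descends modulo p to S/N exactly
  when \<open>\<phi>\<close> vanishes on \<open>N\<close>. Correcting \<open>f\<close> by a
  homomorphism of \<open>S\<close> does not help, since it is zero on \<open>Z n\<close>.\<close>

lemma inflation_iff:
  assumes "rel x \<phi>"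
  shows "pullH p GG TG r.pr x = \<one>\<^bsub>H2 p GG TG\<^esub> \<longleftrightarrow> (\<forall>s\<in>N. int p dvd \<phi> s)"
proof -
  obtain c0 f0 where c0: "x = ck.cl c0" "splits c0 f0 \<phi>" using assms by (auto simp: rel_def)
  have c0C: "c0 \<in> ck.C" using splitsD(1)[OF c0(2)] .
  define c where "c = (SOME c. c \<in> x)"
  have "c \<in> x" unfolding c_def using ck.cl_self[OF c0C] c0(1) by (intro someI[of "\<lambda>c. c \<in> x" c0]) simp
  then have cC: "c \<in> ck.C" and xc: "x = ck.cl c" using ck.cl_rep[OF c0C, of c] c0(1) by auto
  obtain f where f: "splits c f \<phi>" using splits_rep[OF assms cC xc] by blast
  define d where "d = pullc GG r.pr c"
  have d_eq: "d (a, b) = c (r.pr a, r.pr b)" if "a \<in> carrier GG" "b \<in> carrier GG" for a b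
    using that by (simp add: d_def pullc_def)
  have red_d: "cg.red (\<lambda>(a, b). c (r.pr a, r.pr b)) = d"
    unfolding d_def pullc_def cg.red_def
  proof (rule restrict_ext)
    fix ab assume ab: "ab \<in> carrier GG \<times> carrier GG"
    then have "c (r.pr (fst ab), r.pr (snd ab)) \<in> {0..<int p}"
      using ck.cocycleD(4)[OF cC] r.prh.hom_closed by auto
    then show "(case ab of (a, b) \<Rightarrow> c (r.pr a, r.pr b)) mod int p = (case ab of (x, y) \<Rightarrow> c (r.pr x, r.pr y))"
      by (simp add: case_prod_unfold)
  qed
  have dC: "d \<in> cg.C" unfolding red_d[symmetric]
  proof (rule cg.red_cocycle)
    have "continuous_map (prod_topology TG TG) (prod_topology TK TK) (\<lambda>ab. (r.pr (fst ab), r.pr (snd ab)))"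
      using continuous_map_compose[OF continuous_map_fst r.pr_cont, of TG] continuous_map_compose[OF continuous_map_snd r.pr_cont, of TG]
      unfolding continuous_map_paired o_def by (rule conjI)
    from continuous_map_compose[OF this ck.cocycleD(2)[OF cC]]
    show "continuous_map (prod_topology TG TG) (discrete_topology UNIV) (\<lambda>(a, b). c (r.pr a, r.pr b))"
      by (simp add: o_def case_prod_unfold)
    show "cg.cocycle_id (\<lambda>(a, b). c (r.pr a, r.pr b))" unfolding cg.cocycle_id_def
    proof (intro ballI)
      fix x y z assume xyz: "x \<in> carrier GG" "y \<in> carrier GG" "z \<in> carrier GG"
      then have "r.pr x \<in> carrier KK" "r.pr y \<in> carrier KK" "r.pr z \<in> carrier KK" using r.prh.hom_closed by auto
      then have "int p dvd c (r.pr y, r.pr z) - c (r.pr x \<otimes>\<^bsub>KK\<^esub> r.pr y, r.pr z)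
          + c (r.pr x, r.pr y \<otimes>\<^bsub>KK\<^esub> r.pr z) - c (r.pr x, r.pr y)"
        using ck.cocycleD(1)[OF cC] unfolding ck.cocycle_id_def by blast
      then show "int p dvd (case (y, z) of (a, b) \<Rightarrow> c (r.pr a, r.pr b)) - (case (x \<otimes>\<^bsub>GG\<^esub> y, z) of (a, b) \<Rightarrow> c (r.pr a, r.pr b))
          + (case (x, y \<otimes>\<^bsub>GG\<^esub> z) of (a, b) \<Rightarrow> c (r.pr a, r.pr b)) - (case (x, y) of (a, b) \<Rightarrow> c (r.pr a, r.pr b))"
        using xyz by simp
    qed
  qed
  have "pullH p GG TG r.pr x = cg.cl d" by (simp add: pullH_def c_def d_def)
  then have "pullH p GG TG r.pr x = \<one>\<^bsub>H2 p GG TG\<^esub> \<longleftrightarrow> d \<in> cg.D" using cg.cl_eq_one_iff[OF dC] by simp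
  also have "\<dots> \<longleftrightarrow> (\<forall>s\<in>N. int p dvd \<phi> s)"
  proof
    assume "d \<in> cg.D"
    then obtain g where g: "cg.lc g"
      "\<And>a b. a \<in> carrier GG \<Longrightarrow> b \<in> carrier GG \<Longrightarrow> int p dvd d (a, b) - (g b - g (a \<otimes>\<^bsub>GG\<^esub> b) + g a)"
      using cg.coboundaryD by metis
    \<comment> \<open>Both terms split the same cocycle on \<open>S\<close>, so \<open>h\<close> is
      a homomorphism modulo p and vanishes on \<open>Z n\<close>. On \<open>N\<close> the function
      \<open>g\<close> is constant, hence so is \<open>f\<close>.\<close>
    define h where "h = (\<lambda>s. f s - g (q.pr s))"
    have gc: "lcS (\<lambda>s. g (q.pr s))" using continuous_map_compose[OF q.pr_cont g(1)] by (simp add: o_def)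
    have "lcS h" unfolding h_def using splitsD(2)[OF f] gc by (rule locally_const_combine) simp
    moreover have "int p dvd h (s \<otimes> t) - (h s + h t)" if st: "s \<in> carrier S" "t \<in> carrier S" for s t
    proof -
      have "int p dvd d (q.pr s, q.pr t) - (g (q.pr t) - g (q.pr s \<otimes>\<^bsub>GG\<^esub> q.pr t) + g (q.pr s))"
        by (rule g(2)) (use st q.prh.hom_closed in auto)
      moreover have "d (q.pr s, q.pr t) = c (\<kappa> s, \<kappa> t)"
        using d_eq st q.prh.hom_closed by (simp add: \<kappa>_def)
      ultimately have "int p dvd c (\<kappa> s, \<kappa> t) - (g (q.pr t) - g (q.pr (s \<otimes> t)) + g (q.pr s))" using st by simp
      from dvd_diff[OF splitsD(3)[OF f st] this] show ?thesis unfolding h_def by (simp add: algebra_simps del: q.prh.hom_mult)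
    qed
    ultimately have van: "int p dvd h y" if "y \<in> Z n" for y using additive_vanishes that by blast
    show "\<forall>s\<in>N. int p dvd \<phi> s"
    proof
      fix s assume s: "s \<in> N"
      have sZ: "s \<in> Z n" "\<one> \<in> Z n" using s N_Z subgroup.one_closed[OF zs.zass_props(1)] by auto
      have "q.pr s = q.pr \<one>" using q.pr_N[OF s] q.prh.hom_one by simp
      moreover note dvd_diff[OF dvd_add[OF splitsD(4)[OF f sZ(1)] van[OF sZ(2)]] van[OF sZ(1)]]
      ultimately show "int p dvd \<phi> s" by (simp add: h_def)
    qed
  next
    assume van: "\<forall>s\<in>N. int p dvd \<phi> s"
    \<comment> \<open>Reduction modulo p turns a congruence along cosets into an equality, as
      descent requires.\<close>
    define h where "h = (\<lambda>s. f s mod int p)"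
    have "lcS h" unfolding h_def using splitsD(2)[OF f] by (rule locally_const_compose) simp
    moreover have "h (y \<otimes> s) = h s" if "s \<in> carrier S" "y \<in> N" for s y
    proof -
      have "y \<in> Z n" using that N_Z by auto
      from dvd_diff[OF splits_translate[OF f this that(1)], of "\<phi> y"] show ?thesis
        using van that by (simp add: h_def mod_eq_dvd_iff)
    qed
    ultimately obtain g where g: "cg.lc g" "\<And>s. s \<in> carrier S \<Longrightarrow> g (q.pr s) = h s" using q.descend_cont by metis
    show "d \<in> cg.D"
    proof (rule cg.coboundaryI[OF g(1) cg.cocycleD(3)[OF dC]])
      fix a b assume ab: "a \<in> carrier GG" "b \<in> carrier GG"
      then obtain s t where st: "s \<in> carrier S" "a = q.pr s" "t \<in> carrier S" "b = q.pr t" by (auto simp: q.carrier_Q)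
      have gs: "g a = h s" "g b = h t" "g (a \<otimes>\<^bsub>GG\<^esub> b) = h (s \<otimes> t)"
        using g(2)[OF st(1)] g(2)[OF st(3)] g(2)[of "s \<otimes> t"] st by auto
      have hd: "int p dvd f y - h y" for y by (simp add: h_def mod_eq_dvd_iff[symmetric])
      note dvd_diff[OF dvd_add[OF dvd_add[OF splitsD(3)[OF f st(1,3)] hd[of s]] hd[of t]] hd[of "s \<otimes> t"]]
      moreover have "d (a, b) = c (\<kappa> s, \<kappa> t)" using d_eq[OF ab] st by (simp add: \<kappa>_def)
      ultimately show "int p dvd d (a, b) - (g b - g (a \<otimes>\<^bsub>GG\<^esub> b) + g a)" by (simp add: gs algebra_simps)
    qed
  qed
  finally show ?thesis .
qed

end

section \<open>Massey products\<close>

context unitriangular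
begin

abbreviation "bar A \<equiv> uf n #>\<^bsub>U\<^esub> A"

definition sec :: "(nat \<Rightarrow> nat \<Rightarrow> int) set \<Rightarrow> nat \<Rightarrow> nat \<Rightarrow> int" where
  "sec E = (SOME x. x \<in> E)"

lemma ubar_eq: "1 \<le> n \<Longrightarrow> ubar p n = U Mod uf n"
  by (simp add: ubar_def center_uf)

lemma group_ubar: "1 \<le> n \<Longrightarrow> group (ubar p n)"
  using normal.factorgroup_is_group[OF uf_normal] by (simp add: ubar_eq)

lemma carrier_ubar: "1 \<le> n \<Longrightarrow> carrier (ubar p n) = (\<lambda>A. bar A) ` carrier U"
  by (simp add: ubar_eq carrier_FactGroup)

lemma bar_hom: "1 \<le> n \<Longrightarrow> (\<lambda>A. bar A) \<in> hom U (ubar p n)"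
  using normal.r_coset_hom_Mod[OF uf_normal] by (simp add: ubar_eq)

lemma bar_mult: "1 \<le> n \<Longrightarrow> A \<in> carrier U \<Longrightarrow> B \<in> carrier U \<Longrightarrow> bar A \<otimes>\<^bsub>ubar p n\<^esub> bar B = bar (A \<otimes>\<^bsub>U\<^esub> B)"
  using hom_mult[OF bar_hom] by simp

lemma bar_one: "1 \<le> n \<Longrightarrow> A \<in> uf n \<Longrightarrow> bar A = \<one>\<^bsub>ubar p n\<^esub>"
  using U.coset_join2[OF uf_carrier uf_subgroup] by (simp add: ubar_eq one_FactGroup)

lemma sec_bar:
  assumes "A \<in> carrier U" shows "sec (bar A) \<in> carrier U" "agree n (sec (bar A)) A"
proof -
  have "A \<in> bar A" using assms by (simp add: coset_uf agree_refl)
  then have "sec (bar A) \<in> bar A" unfolding sec_def by (rule someI[of "\<lambda>x. x \<in> bar A"])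
  then show "sec (bar A) \<in> carrier U" "agree n (sec (bar A)) A" using assms by (auto simp: coset_uf)
qed

text \<open>On matrices the cocycle is the coboundary of the function that takes \<open>A\<close> to
  the corner of the chosen representative minus the corner of \<open>A\<close>. This holds for any
  choice, so nothing about \<open>SOME\<close> enters except membership in the coset.\<close>

lemma alpha_bar:
  assumes n: "1 \<le> n" and A: "A \<in> carrier U" and B: "B \<in> carrier U"
  shows "int p dvd alpha p n (bar A, bar B) - ((sec (bar A) 0 n - A 0 n) + (sec (bar B) 0 n - B 0 n)
      - (sec (bar (A \<otimes>\<^bsub>U\<^esub> B)) 0 n - (A \<otimes>\<^bsub>U\<^esub> B) 0 n))"
    and "alpha p n (bar A, bar B) \<in> {0..<int p}"
proof -
  define C where "C = sec (bar A)" define D where "D = sec (bar B)" define E where "E = sec (bar (A \<otimes>\<^bsub>U\<^esub> B))"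
  have AB: "A \<otimes>\<^bsub>U\<^esub> B \<in> carrier U" using A B by simp
  have c: "C \<in> carrier U" "D \<in> carrier U" "E \<in> carrier U"
    unfolding C_def D_def E_def using sec_bar(1) A B AB by blast+
  have ag: "agree n C A" "agree n D B" "agree n E (A \<otimes>\<^bsub>U\<^esub> B)"
    unfolding C_def D_def E_def using sec_bar(2) A B AB by blast+
  have alpha: "alpha p n (bar A, bar B) = (C \<otimes>\<^bsub>U\<^esub> D \<otimes>\<^bsub>U\<^esub> inv\<^bsub>U\<^esub> E) 0 n"
    unfolding alpha_def Let_def C_def D_def E_def sec_def bar_mult[OF n A B, symmetric] by simp
  show "alpha p n (bar A, bar B) \<in> {0..<int p}"
    unfolding alpha using carrierD(1,2)[of "C \<otimes>\<^bsub>U\<^esub> D \<otimes>\<^bsub>U\<^esub> inv\<^bsub>U\<^esub> E" 0 n] c by simp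
  have "agree n (C \<otimes>\<^bsub>U\<^esub> D) (A \<otimes>\<^bsub>U\<^esub> B)" using c A B ag by (intro agree_mult)
  then have "agree n (C \<otimes>\<^bsub>U\<^esub> D) E" using agree_sym[OF ag(3)] by (rule agree_trans)
  then have 1: "int p dvd (C \<otimes>\<^bsub>U\<^esub> D \<otimes>\<^bsub>U\<^esub> inv\<^bsub>U\<^esub> E) 0 n - ((C \<otimes>\<^bsub>U\<^esub> D) 0 n - E 0 n)"
    using c by (intro corner_quotient[OF n]) auto
  have 2: "int p dvd ((C \<otimes>\<^bsub>U\<^esub> D) 0 n - (A \<otimes>\<^bsub>U\<^esub> B) 0 n) - ((C 0 n - A 0 n) + (D 0 n - B 0 n))"
    by (rule corner_mult[OF n c(1) A c(2) B ag(1,2)])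
  from dvd_add[OF 1 2] show "int p dvd alpha p n (bar A, bar B) - ((sec (bar A) 0 n - A 0 n) + (sec (bar B) 0 n - B 0 n)
      - (sec (bar (A \<otimes>\<^bsub>U\<^esub> B)) 0 n - (A \<otimes>\<^bsub>U\<^esub> B) 0 n))"
    unfolding alpha C_def[symmetric] D_def[symmetric] E_def[symmetric] by (simp add: algebra_simps)
qed

end

context massey_setup
begin

abbreviation "Hom \<equiv> cont_hom_fin S T UU"

definition corner :: "('a \<Rightarrow> nat \<Rightarrow> nat \<Rightarrow> int) \<Rightarrow> 'a \<Rightarrow> int" where "corner \<rho> = (\<lambda>s. \<rho> s 0 n)"

lemma Hom_carrier: "\<rho> \<in> Hom \<Longrightarrow> s \<in> carrier S \<Longrightarrow> \<rho> s \<in> carrier UU"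
  using cont_hom_finD(1) by (fastforce simp: hom_def)

lemma Hom_mult: "\<rho> \<in> Hom \<Longrightarrow> s \<in> carrier S \<Longrightarrow> t \<in> carrier S \<Longrightarrow> \<rho> (s \<otimes> t) = \<rho> s \<otimes>\<^bsub>UU\<^esub> \<rho> t"
  using cont_hom_finD(1) hom_mult by metis

lemma Hom_Z: "\<rho> \<in> Hom \<Longrightarrow> s \<in> Z n \<Longrightarrow> \<rho> s \<in> u.uf n"
  by (rule zs.zass_kernel_uf[OF p])

lemma Hom_one: "\<rho> \<in> Hom \<Longrightarrow> \<rho> \<one> = \<one>\<^bsub>UU\<^esub>"
  using cont_hom_finD(1) hom_one[of \<rho> S UU] is_group u.U.is_group by blast

lemma corner_additive: assumes "\<rho> \<in> Hom" shows "mZ.additive (corner \<rho>)"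
  unfolding mZ.additive_def corner_def
  using u.corner_additive[OF n1] Hom_Z[OF assms] Hom_mult[OF assms] zs.zass_carrier by simp

lemma corner_lc: assumes "\<rho> \<in> Hom" shows "lcS (corner \<rho>)"
  unfolding corner_def using cont_hom_finD(2)[OF assms] by (rule locally_const_compose) simp

lemma corner_dvd_iff: assumes "\<rho> \<in> Hom" "s \<in> Z n" shows "int p dvd corner \<rho> s \<longleftrightarrow> \<rho> s = \<one>\<^bsub>UU\<^esub>"
  using u.corner_zero[OF n1 Hom_Z[OF assms]] n1 by (auto simp: corner_def u.one_entry)

text \<open>Freeness of \<open>S\<close> allows arbitrary preimages of the values on the basis;
  uniqueness of extensions then shows that the composite with the projection is
  \<open>h\<close>.\<close>

lemma lift_ubar:
  assumes h: "h \<in> cont_hom_fin S T (ubar p n)"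
  obtains \<rho> where "\<rho> \<in> Hom" "\<And>s. s \<in> carrier S \<Longrightarrow> u.bar (\<rho> s) = h s"
proof -
  have hc: "h (emb b) \<in> carrier (ubar p n)" if "b \<in> B" for b
    using cont_hom_finD(1)[OF h] emb_carrier[OF that] by (auto simp: hom_def)
  \<comment> \<open>A trivial value is lifted to the unit, so that the lift is still trivial at all
    but finitely many basis elements.\<close>
  define f where "f = (\<lambda>b. if h (emb b) = \<one>\<^bsub>ubar p n\<^esub> then \<one>\<^bsub>UU\<^esub>
     else (SOME A. A \<in> carrier UU \<and> u.bar A = h (emb b)))"
  have f: "f b \<in> carrier UU \<and> u.bar (f b) = h (emb b)" if b: "b \<in> B" for b
  proof (cases "h (emb b) = \<one>\<^bsub>ubar p n\<^esub>")
    case True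
    then show ?thesis using u.bar_one[OF n1, of "\<one>\<^bsub>UU\<^esub>"] subgroup.one_closed[OF u.uf_subgroup] by (simp add: f_def)
  next
    case False
    have "\<exists>A. A \<in> carrier UU \<and> u.bar A = h (emb b)" using hc[OF b] by (auto simp: u.carrier_ubar[OF n1])
    from someI_ex[OF this] show ?thesis using False by (simp add: f_def)
  qed
  have "f \<in> B \<rightarrow> carrier UU" using f by blast
  moreover have "finite {b \<in> B. f b \<noteq> \<one>\<^bsub>UU\<^esub>}"
    using support_finite[OF u.group_ubar[OF n1] h] by (rule rev_finite_subset) (auto simp: f_def)
  ultimately obtain \<rho> where \<rho>: "\<rho> \<in> Hom" "\<And>b. b \<in> B \<Longrightarrow> \<rho> (emb b) = f b"
    by (rule extend[OF u.U.is_group u.finite_carrier]) blast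
  have "u.bar (\<rho> s) = h s" if s: "s \<in> carrier S" for s
  proof (rule extend_unique[OF u.group_ubar[OF n1] _ cont_hom_fin_compose[OF \<rho>(1) u.bar_hom[OF n1]] h _ s])
    show "finite (carrier (ubar p n))" using u.finite_carrier by (simp add: u.carrier_ubar[OF n1])
  qed (use \<rho>(2) f in simp)
  then show thesis using that \<rho>(1) by blast
qed

lemma descend_ubar:
  assumes \<rho>: "\<rho> \<in> Hom"
  obtains \<rho>' where "\<rho>' \<in> cont_hom_fin KK TK (ubar p n)" "\<And>s. s \<in> carrier S \<Longrightarrow> \<rho>' (\<kappa> s) = u.bar (\<rho> s)"
proof -
  have b: "(\<lambda>s. u.bar (\<rho> s)) \<in> cont_hom_fin S T (ubar p n)"
    using cont_hom_fin_compose[OF \<rho> u.bar_hom[OF n1]] .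
  have kill: "u.bar (\<rho> s) = \<one>\<^bsub>ubar p n\<^esub>" if "s \<in> Z n" for s
    using u.bar_one[OF n1] Hom_Z[OF \<rho> that] by simp
  then have killN: "u.bar (\<rho> s) = \<one>\<^bsub>ubar p n\<^esub>" if "s \<in> N" for s using that N_Z by auto
  obtain g where g: "g \<in> cont_hom_fin GG TG (ubar p n)" "\<And>s. s \<in> carrier S \<Longrightarrow> g (q.pr s) = u.bar (\<rho> s)"
    using q.cont_hom_descend[OF u.group_ubar[OF n1] b killN] by metis
  have killZ: "g c = \<one>\<^bsub>ubar p n\<^esub>" if "c \<in> ZG n" for c
    using that g(2) kill zs.zass_carrier by (auto simp: ZG_eq)
  obtain \<rho>' where "\<rho>' \<in> cont_hom_fin KK TK (ubar p n)" "\<And>c. c \<in> carrier GG \<Longrightarrow> \<rho>' (r.pr c) = g c"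
    using r.cont_hom_descend[OF u.group_ubar[OF n1] g(1) killZ] by metis
  then show thesis using that g(2) q.prh.hom_closed by (simp add: \<kappa>_def)
qed

text \<open>The cochain from \<open>alpha_bar\<close>, evaluated along \<open>\<rho>\<close>, splits
  the pulled back cocycle over \<open>S\<close>. On \<open>Z n\<close> the matrices
  \<open>\<rho> s\<close> lie in a single coset, so the contribution of the section is constant and
  the corner of \<open>\<rho>\<close> remains.\<close>

lemma rel_pullback:
  assumes \<rho>': "\<rho>' \<in> cont_hom_fin KK TK (ubar p n)" and \<rho>: "\<rho> \<in> Hom"
    and eq: "\<And>s. s \<in> carrier S \<Longrightarrow> \<rho>' (\<kappa> s) = u.bar (\<rho> s)"
  shows "rel (ck.cl (pullc KK \<rho>' (alpha p n))) (corner \<rho>)"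
proof -
  define c where "c = pullc KK \<rho>' (alpha p n)"
  define F where "F = (\<lambda>ab. alpha p n (\<rho>' (fst ab), \<rho>' (snd ab)))"
  define f where "f = (\<lambda>s. u.sec (u.bar (\<rho> s)) 0 n - \<rho> s 0 n)"
  have F: "int p dvd F (\<kappa> s, \<kappa> t) - (f s + f t - f (s \<otimes> t))" "F (\<kappa> s, \<kappa> t) \<in> {0..<int p}"
    if st: "s \<in> carrier S" "t \<in> carrier S" for s t
    using u.alpha_bar[OF n1 Hom_carrier[OF \<rho> st(1)] Hom_carrier[OF \<rho> st(2)]] st
    by (simp_all add: F_def f_def eq Hom_mult[OF \<rho>])
  have c_eq: "c = ck.red F"
    unfolding c_def pullc_def ck.red_def
  proof (rule restrict_ext)
    fix ab assume ab: "ab \<in> carrier KK \<times> carrier KK"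
    have "fst ab \<in> carrier KK" "snd ab \<in> carrier KK" using ab by auto
    from kappa_surj[OF this(1)] kappa_surj[OF this(2)] obtain s t
      where s: "s \<in> carrier S" "fst ab = \<kappa> s" and t: "t \<in> carrier S" "snd ab = \<kappa> t" by metis
    have "F ab \<in> {0..<int p}" using F(2)[OF s(1) t(1)] s t by (simp add: F_def)
    then show "(case ab of (x, y) \<Rightarrow> alpha p n (\<rho>' x, \<rho>' y)) = F ab mod int p"
      by (simp add: F_def case_prod_unfold)
  qed
  have cC: "c \<in> ck.C" unfolding c_eq
  proof (rule ck.red_cocycle)
    have "continuous_map (prod_topology TK TK) (discrete_topology (carrier (ubar p n))) (\<lambda>ab. \<rho>' (fst ab))"
      "continuous_map (prod_topology TK TK) (discrete_topology (carrier (ubar p n))) (\<lambda>ab. \<rho>' (snd ab))"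
      using continuous_map_compose[OF continuous_map_fst cont_hom_finD(2)[OF \<rho>'], of TK]
        continuous_map_compose[OF continuous_map_snd cont_hom_finD(2)[OF \<rho>'], of TK]
      unfolding o_def .
    then show "continuous_map (prod_topology TK TK) (discrete_topology UNIV) F"
      unfolding F_def by (rule locally_const_combine) simp
    show "ck.cocycle_id F" unfolding ck.cocycle_id_def
    proof (intro ballI)
      fix x y z assume "x \<in> carrier KK" "y \<in> carrier KK" "z \<in> carrier KK"
      then obtain s t v where s: "s \<in> carrier S" "x = \<kappa> s" and t: "t \<in> carrier S" "y = \<kappa> t" and v: "v \<in> carrier S" "z = \<kappa> v"
        using kappa_surj by metis
      have st: "s \<otimes> t \<in> carrier S" "t \<otimes> v \<in> carrier S" using s t v by auto
      from dvd_diff[OF dvd_add[OF dvd_diff[OF F(1)[OF t(1) v(1)] F(1)[OF st(1) v(1)]] F(1)[OF s(1) st(2)]] F(1)[OF s(1) t(1)]]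
      have "int p dvd F (\<kappa> t, \<kappa> v) - F (\<kappa> (s \<otimes> t), \<kappa> v) + F (\<kappa> s, \<kappa> (t \<otimes> v)) - F (\<kappa> s, \<kappa> t)"
        using s t v by (simp add: m_assoc algebra_simps)
      then show "int p dvd F (y, z) - F (x \<otimes>\<^bsub>KK\<^esub> y, z) + F (x, y \<otimes>\<^bsub>KK\<^esub> z) - F (x, y)"
        unfolding s(2) t(2) v(2) kappa_mult[OF s(1) t(1)] kappa_mult[OF t(1) v(1)] .
    qed
  qed
  have "splits c f (corner \<rho>)" unfolding splits_def
  proof (intro conjI ballI cC)
    show "lcS f" unfolding f_def
      using cont_hom_finD(2)[OF \<rho>] by (rule locally_const_compose[where F = "\<lambda>A. u.sec (u.bar A) 0 n - A 0 n"]) simp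
    fix s t assume st: "s \<in> carrier S" "t \<in> carrier S"
    from dvd_add[OF ck.red_dvd[OF kappa_carrier[OF st(1)] kappa_carrier[OF st(2)], of F] F(1)[OF st]]
    show "int p dvd c (\<kappa> s, \<kappa> t) - (f s + f t - f (s \<otimes> t))" by (simp add: c_eq algebra_simps)
  next
    fix s assume s: "s \<in> Z n"
    have "u.bar (\<rho> s) = u.bar (\<rho> \<one>)"
      using eq[of s] eq[of \<one>] kappa_Z[OF s] zs.zass_carrier[OF s] by simp
    then have "corner \<rho> s = f \<one> - f s" using n1 by (simp add: f_def corner_def Hom_one[OF \<rho>] u.one_entry)
    then show "int p dvd corner \<rho> s - (f \<one> - f s)" by simp
  qed
  then show ?thesis unfolding rel_def c_def by blast
qed

definition gens where
  "gens = {ck.cl (pullc KK \<rho>' (alpha p n)) | \<rho>'. \<rho>' \<in> cont_hom_fin KK TK (ubar p n)}"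

abbreviation "inflation \<equiv> pullH p GG TG r.pr"

lemma massey_kernel_gen_iff:
  "massey_kernel_gen p n GG TG \<longleftrightarrow> {x \<in> generate ck.HH gens. inflation x = \<one>\<^bsub>cg.HH\<^esub>}
     = generate ck.HH {x \<in> gens. inflation x = \<one>\<^bsub>cg.HH\<^esub>}"
  unfolding massey_kernel_gen_def Let_def gens_def ..

definition corners where "corners = corner ` Hom"
text \<open>The homomorphisms trivial on \<open>N\<close> are those that come from the quotient S/N.
  By \<open>corner_vanishes_N_iff\<close> it suffices that the corner is zero on
  \<open>N\<close>.\<close>

definition corners_N where "corners_N = corner ` {\<rho> \<in> Hom. \<forall>x\<in>N. \<rho> x = \<one>\<^bsub>UU\<^esub>}"

lemma corner_vanishes_N_iff: "\<rho> \<in> Hom \<Longrightarrow> (\<forall>x\<in>N. int p dvd corner \<rho> x) \<longleftrightarrow> (\<forall>x\<in>N. \<rho> x = \<one>\<^bsub>UU\<^esub>)"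
  using corner_dvd_iff N_Z by blast

lemma gens_rel: assumes "x \<in> gens" obtains \<rho> where "\<rho> \<in> Hom" "rel x (corner \<rho>)"
proof -
  obtain \<rho>' where \<rho>': "\<rho>' \<in> cont_hom_fin KK TK (ubar p n)" "x = ck.cl (pullc KK \<rho>' (alpha p n))"
    using assms unfolding gens_def by blast
  have "(\<lambda>s. \<rho>' (\<kappa> s)) \<in> cont_hom_fin S T (ubar p n)"
    using q.cont_hom_lift[OF r.cont_hom_lift[OF \<rho>'(1)]] by (simp add: \<kappa>_def)
  then obtain \<rho> where \<rho>: "\<rho> \<in> Hom" "\<And>s. s \<in> carrier S \<Longrightarrow> u.bar (\<rho> s) = \<rho>' (\<kappa> s)" by (rule lift_ubar) blast
  have "rel x (corner \<rho>)" unfolding \<rho>'(2) by (rule rel_pullback[OF \<rho>'(1) \<rho>(1)]) (simp add: \<rho>(2))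
  then show thesis using that \<rho>(1) by blast
qed

lemma rel_gens: assumes "\<rho> \<in> Hom" obtains x where "x \<in> gens" "rel x (corner \<rho>)"
proof -
  obtain \<rho>' where \<rho>': "\<rho>' \<in> cont_hom_fin KK TK (ubar p n)" "\<And>s. s \<in> carrier S \<Longrightarrow> \<rho>' (\<kappa> s) = u.bar (\<rho> s)"
    using descend_ubar[OF assms] by blast
  show thesis by (rule that[OF _ rel_pullback[OF \<rho>'(1) assms \<rho>'(2)]]) (use \<rho>'(1) gens_def in auto)
qed

lemma gens_carrier: "gens \<subseteq> carrier ck.HH"
proof
  fix x assume "x \<in> gens" then show "x \<in> carrier ck.HH" by (rule gens_rel) (rule rel_carrier)
qed

lemma zspan_corners:
  assumes "\<phi> \<in> zspan corners" shows "lcS \<phi>" "mZ.additive \<phi>" "z \<in> Z (Suc n) \<Longrightarrow> int p dvd \<phi> z"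
proof -
  show "lcS \<phi>" using assms
    by (induction rule: zspan.induct) (auto simp: corners_def corner_lc intro: locally_const_combine)
  show "mZ.additive \<phi>"
  proof (rule mZ.additive_zspan[OF assms])
    fix \<psi> assume "\<psi> \<in> corners"
    then obtain \<rho> where "\<rho> \<in> Hom" "\<psi> = corner \<rho>" unfolding corners_def by (elim imageE)
    then show "mZ.additive \<psi>" using corner_additive by simp
  qed
  assume z: "z \<in> Z (Suc n)"
  then have zn: "z \<in> Z n" using zs.zass_Suc by blast
  show "int p dvd \<phi> z"
  proof (rule zspan_dvd[OF assms])
    fix \<psi> assume "\<psi> \<in> corners"
    then obtain \<rho> where "\<rho> \<in> Hom" "\<psi> = corner \<rho>" by (auto simp: corners_def)
    then show "int p dvd \<psi> z" using hom_kills_Z[OF _ z] corner_dvd_iff[OF _ zn] by simp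
  qed
qed

text \<open>Puts the elements in question into the image of \<open>Z n\<close>, where a homomorphism
  to \<open>UU\<close> is governed by its corner alone.\<close>

lemma TU_Suc_subset: "TU GG TG UU \<subseteq> ZG n"
proof -
  obtain m where m: "n = Suc m" using n1 by (cases n) auto
  have "TU GG TG UU \<subseteq> TU GG TG (unip p m)"
  proof
    fix c assume c: "c \<in> TU GG TG UU"
    have p1: "1 < p" using p2 by simp
    have "g c = \<one>\<^bsub>unip p m\<^esub>" if g: "g \<in> cont_hom_fin GG TG (unip p m)" for g
    proof (rule unip_ext(2)[OF p1])
      have cc: "c \<in> carrier GG" using c by (simp add: TU_def)
      show "g c \<in> carrier (unip p m)" using cont_hom_finD(1)[OF g] cc by (auto simp: hom_def)
      have "(\<lambda>x. unip_ext m (g x)) \<in> cont_hom_fin GG TG UU"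
        using cont_hom_fin_compose[OF g unip_ext(1)[OF p1]] by (simp add: m)
      then have "c \<in> kernel GG UU (\<lambda>x. unip_ext m (g x))" using c unfolding TU_def by blast
      then show "unip_ext m (g c) = \<one>\<^bsub>unip p (Suc m)\<^esub>" by (simp add: kernel_def m)
    qed
    then show "c \<in> TU GG TG (unip p m)" using c by (auto simp: TU_def kernel_def)
  qed
  then show ?thesis using TU_quotient m by simp
qed

text \<open>On \<open>Z n\<close> a homomorphism takes values in \<open>uf n\<close>, where
  triviality means a zero corner.\<close>

lemma TU_iff:
  assumes s: "s \<in> Z n" shows "q.pr s \<in> TU GG TG UU \<longleftrightarrow> (\<forall>\<phi>\<in>corners_N. int p dvd \<phi> s)"
proof -
  have sc: "s \<in> carrier S" using zs.zass_carrier[OF s] .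
  show ?thesis
  proof
    assume t: "q.pr s \<in> TU GG TG UU"
    show "\<forall>\<phi>\<in>corners_N. int p dvd \<phi> s"
    proof
      fix \<phi> assume "\<phi> \<in> corners_N"
      then obtain \<rho> where \<rho>: "\<rho> \<in> Hom" "\<And>x. x \<in> N \<Longrightarrow> \<rho> x = \<one>\<^bsub>UU\<^esub>" "\<phi> = corner \<rho>" by (auto simp: corners_N_def)
      obtain g where g: "g \<in> cont_hom_fin GG TG UU" "\<And>x. x \<in> carrier S \<Longrightarrow> g (q.pr x) = \<rho> x"
        using q.cont_hom_descend[OF u.U.is_group \<rho>(1,2)] by blast
      have "q.pr s \<in> kernel GG UU g" using t g(1) unfolding TU_def by blast
      then have "\<rho> s = \<one>\<^bsub>UU\<^esub>" using g(2)[OF sc] by (simp add: kernel_def)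
      then show "int p dvd \<phi> s" using corner_dvd_iff[OF \<rho>(1) s] \<rho>(3) by simp
    qed
  next
    assume v: "\<forall>\<phi>\<in>corners_N. int p dvd \<phi> s"
    have "g (q.pr s) = \<one>\<^bsub>UU\<^esub>" if g: "g \<in> cont_hom_fin GG TG UU" for g
    proof -
      have \<rho>: "(\<lambda>x. g (q.pr x)) \<in> Hom" using q.cont_hom_lift[OF g] .
      have "g (q.pr x) = \<one>\<^bsub>UU\<^esub>" if "x \<in> N" for x
        using q.pr_N[OF that] hom_one[OF cont_hom_finD(1)[OF g] q.group_Q u.U.is_group] by simp
      then have "corner (\<lambda>x. g (q.pr x)) \<in> corners_N" using \<rho> unfolding corners_N_def by blast
      then show ?thesis using v corner_dvd_iff[OF \<rho> s] by blast
    qed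
    then show "q.pr s \<in> TU GG TG UU" using sc q.prh.hom_closed by (auto simp: TU_def kernel_def)
  qed
qed

lemma ZG_Suc_subset: "ZG (Suc n) \<subseteq> TU GG TG UU"
proof
  fix c assume c: "c \<in> ZG (Suc n)"
  have "g c = \<one>\<^bsub>UU\<^esub>" if "g \<in> cont_hom_fin GG TG UU" for g
    using gz.zass_kernel_uf[OF p that c] u.uf_top by simp
  then show "c \<in> TU GG TG UU" using gz.zass_carrier[OF c] by (auto simp: TU_def kernel_def)
qed

lemma inflation_gens: "{x \<in> gens. inflation x = \<one>\<^bsub>cg.HH\<^esub>} \<subseteq> gens" by blast

lemma gens_N_rel:
  assumes "x \<in> {x \<in> gens. inflation x = \<one>\<^bsub>cg.HH\<^esub>}" shows "\<exists>\<phi>\<in>corners_N. rel x \<phi>"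
proof -
  obtain \<rho> where \<rho>: "\<rho> \<in> Hom" "rel x (corner \<rho>)" using gens_rel[of x] assms by blast
  have "\<forall>s\<in>N. int p dvd corner \<rho> s" using inflation_iff[OF \<rho>(2)] assms by simp
  then have "corner \<rho> \<in> corners_N" using \<rho>(1) corner_vanishes_N_iff[OF \<rho>(1)] unfolding corners_N_def by blast
  then show ?thesis using \<rho>(2) by blast
qed

lemma rel_gens_N:
  assumes "\<phi> \<in> corners_N" shows "\<exists>x\<in>{x \<in> gens. inflation x = \<one>\<^bsub>cg.HH\<^esub>}. rel x \<phi>"
proof -
  obtain \<rho> where \<rho>: "\<rho> \<in> Hom" "\<forall>x\<in>N. \<rho> x = \<one>\<^bsub>UU\<^esub>" "\<phi> = corner \<rho>" using assms by (auto simp: corners_N_def)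
  obtain x where x: "x \<in> gens" "rel x \<phi>" using rel_gens[OF \<rho>(1)] \<rho>(3) by blast
  have "inflation x = \<one>\<^bsub>cg.HH\<^esub>"
    using inflation_iff[OF x(2)] corner_vanishes_N_iff[OF \<rho>(1)] \<rho>(2,3) by simp
  then show ?thesis using x by blast
qed

lemma zspan_corners_N: "\<phi> \<in> zspan corners_N \<Longrightarrow> s \<in> N \<Longrightarrow> int p dvd \<phi> s"
proof (erule zspan_dvd)
  fix \<psi> assume s: "s \<in> N" and "\<psi> \<in> corners_N"
  then obtain \<rho> where \<rho>: "\<rho> \<in> Hom" "\<forall>x\<in>N. \<rho> x = \<one>\<^bsub>UU\<^esub>" "\<psi> = corner \<rho>" by (auto simp: corners_N_def)
  then show "int p dvd \<psi> s" using corner_vanishes_N_iff[OF \<rho>(1)] s by simp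
qed

text \<open>The easy half of the kernel condition. The vanishing of the inflation is obtained by
  passing to functionals: they all vanish on \<open>N\<close>, and so does every element of their
  span.\<close>

lemma generate_gens_N_kernel:
  assumes "x \<in> generate ck.HH {x \<in> gens. inflation x = \<one>\<^bsub>cg.HH\<^esub>}"
  shows "x \<in> generate ck.HH gens" "inflation x = \<one>\<^bsub>cg.HH\<^esub>"
proof -
  show "x \<in> generate ck.HH gens"
    using group.mono_generate[OF ck.group_HH inflation_gens] assms by blast
  have "\<exists>\<phi>\<in>zspan corners_N. rel x \<phi>" using assms by (rule rel_generate) (rule gens_N_rel)
  then obtain \<phi> where \<phi>: "\<phi> \<in> zspan corners_N" "rel x \<phi>" by (elim bexE)
  show "inflation x = \<one>\<^bsub>cg.HH\<^esub>" using inflation_iff[OF \<phi>(2)] zspan_corners_N[OF \<phi>(1)] by simp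
qed

theorem massey_iff: "TU GG TG UU = ZG (Suc n) \<longleftrightarrow> massey_kernel_gen p n GG TG"
proof
  assume massey: "massey_kernel_gen p n GG TG"
  have "TU GG TG UU \<subseteq> ZG (Suc n)"
  proof (rule subsetI, rule ccontr)
    fix c assume c: "c \<in> TU GG TG UU" and not: "c \<notin> ZG (Suc n)"
    have "c \<in> q.pr ` Z n" using c TU_Suc_subset ZG_eq by blast
    then obtain s where s: "s \<in> Z n" "c = q.pr s" by blast
    have sc: "s \<in> carrier S" using zs.zass_carrier[OF s(1)] .
    have Nc: "x \<in> carrier S" if "x \<in> N" for x using that q.sub_N subgroup.mem_carrier by metis
    have sN: "s \<otimes> x \<in> Z n" if "x \<in> N" for x
      using subgroup.m_closed[OF zs.zass_props(1) s(1)] N_Z that by blast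
    \<comment> \<open>No element of the coset of \<open>s\<close> lies in S_(n+1,p), so Magnus'
      theorem provides a homomorphism that is nontrivial at it.\<close>
    have ex: "\<exists>\<rho>\<in>Hom. \<rho> (s \<otimes> x) \<noteq> \<one>\<^bsub>UU\<^esub>" if x: "x \<in> N" for x
    proof (rule ccontr)
      assume "\<not> ?thesis"
      then have "s \<otimes> x \<in> TU S T UU" using sc Nc[OF x] by (auto simp: TU_def kernel_def)
      then have "s \<otimes> x \<in> Z (Suc n)" by (rule TU_subset_zass[OF n1])
      then have "q.pr (s \<otimes> x) \<in> ZG (Suc n)" unfolding ZG_eq by (rule imageI)
      moreover have "q.pr (s \<otimes> x) = c" using q.pr_N[OF x] s(2) sc Nc[OF x] q.prh.hom_closed[OF sc]
        by (simp add: group.is_monoid[OF q.group_Q])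
      ultimately show False using not by simp
    qed
    \<comment> \<open>The homomorphism depends on \<open>x \<in> N\<close>. By compactness of
      \<open>N\<close> finitely many suffice, and separation then gives a combination of corners
      that vanishes on \<open>N\<close> but not at \<open>s\<close>: a Massey class in the kernel of
      inflation.\<close>
    define O' where "O' = (\<lambda>\<rho>. {x \<in> topspace T. \<rho> (s \<otimes> x) \<in> carrier UU - {\<one>\<^bsub>UU\<^esub>}})"
    have open': "openin T (O' \<rho>)" if "\<rho> \<in> Hom" for \<rho>
      unfolding O'_def using continuous_map_compose[OF left_translation_cont[OF sc] cont_hom_finD(2)[OF that]]
      by (intro openin_continuous_map_preimage) (auto simp: o_def)
    have "N \<subseteq> \<Union>(O' ` Hom)"
    proof
      fix x assume x: "x \<in> N"
      obtain \<rho> where \<rho>: "\<rho> \<in> Hom" "\<rho> (s \<otimes> x) \<noteq> \<one>\<^bsub>UU\<^esub>" using ex[OF x] by blast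
      have "\<rho> (s \<otimes> x) \<in> carrier UU" using Hom_carrier[OF \<rho>(1)] sc Nc[OF x] by simp
      then show "x \<in> \<Union>(O' ` Hom)" using \<rho> Nc[OF x] by (auto simp: O'_def topspace_T)
    qed
    then obtain \<F> where \<F>: "finite \<F>" "\<F> \<subseteq> O' ` Hom" "N \<subseteq> \<Union>\<F>"
      using compactinD[OF compact_N, of "O' ` Hom"] open' by blast
    then obtain R where R: "finite R" "R \<subseteq> Hom" "\<F> = O' ` R" using finite_subset_image by metis
    have "\<exists>\<phi>\<in>zspan (corner ` R). (\<forall>x\<in>N. int p dvd \<phi> x) \<and> \<not> int p dvd \<phi> s"
    proof (rule mZ.separate_functional[OF _ _ q.sub_N N_Z s(1)])
      show "finite (corner ` R)" using R(1) by simp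
      show "mZ.additive \<psi>" if "\<psi> \<in> corner ` R" for \<psi> using that R(2) corner_additive by auto
      fix x assume x: "x \<in> N"
      then obtain \<rho> where "\<rho> \<in> R" "x \<in> O' \<rho>" using \<F>(3) R(3) by blast
      then show "\<exists>\<psi>\<in>corner ` R. \<not> int p dvd \<psi> (s \<otimes> x)"
        using corner_dvd_iff[OF _ sN[OF x], of \<rho>] R(2) by (auto simp: O'_def)
    qed
    then obtain \<phi> where \<phi>: "\<phi> \<in> zspan (corner ` R)" "\<forall>x\<in>N. int p dvd \<phi> x" "\<not> int p dvd \<phi> s" by blast
    have "corner ` R \<subseteq> corners" using R(2) by (auto simp: corners_def)
    then have "\<phi> \<in> zspan corners" using \<phi>(1) zspan_mono by blast
    moreover have "\<exists>x\<in>gens. rel x \<psi>" if \<psi>: "\<psi> \<in> corners" for \<psi>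
    proof -
      obtain \<rho> where "\<rho> \<in> Hom" "\<psi> = corner \<rho>" using \<psi> by (auto simp: corners_def)
      then show ?thesis using rel_gens by metis
    qed
    ultimately have "\<exists>x\<in>generate ck.HH gens. rel x \<phi>" using gens_carrier by (rule rel_zspan)
    then obtain x where x: "x \<in> generate ck.HH gens" "rel x \<phi>" by (elim bexE)
    have "inflation x = \<one>\<^bsub>cg.HH\<^esub>" using inflation_iff[OF x(2)] \<phi>(2) by simp
    then have "x \<in> generate ck.HH {x \<in> gens. inflation x = \<one>\<^bsub>cg.HH\<^esub>}"
      using massey x(1) unfolding massey_kernel_gen_iff by blast
    \<comment> \<open>The hypothesis expresses the same class through corners that vanish on
      \<open>N\<close>. These vanish at \<open>s\<close> because \<open>c\<close> lies in
      \<open>TU\<close>, which contradicts the choice of \<open>\<phi>\<close>.\<close>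
    then have "\<exists>\<phi>'\<in>zspan corners_N. rel x \<phi>'" by (rule rel_generate) (rule gens_N_rel)
    then obtain \<phi>' where \<phi>': "\<phi>' \<in> zspan corners_N" "rel x \<phi>'" by (elim bexE)
    have "int p dvd \<psi> s" if "\<psi> \<in> corners_N" for \<psi> using TU_iff[OF s(1)] c s(2) that by blast
    then have "int p dvd \<phi>' s" by (rule zspan_dvd[OF \<phi>'(1)])
    moreover have "int p dvd \<phi> s - \<phi>' s" by (rule rel_fun[OF x(2) \<phi>'(2) s(1)])
    ultimately show False using \<phi>(3) by (metis dvd_add diff_add_cancel)
  qed
  then show "TU GG TG UU = ZG (Suc n)" using ZG_Suc_subset by blast
next
  assume T: "TU GG TG UU = ZG (Suc n)"
  have "x \<in> generate ck.HH {x \<in> gens. inflation x = \<one>\<^bsub>cg.HH\<^esub>}"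
    if x: "x \<in> generate ck.HH gens" and inf: "inflation x = \<one>\<^bsub>cg.HH\<^esub>" for x
  proof -
    have "\<exists>\<phi>\<in>corners. rel y \<phi>" if y: "y \<in> gens" for y
    proof -
      obtain \<rho> where "\<rho> \<in> Hom" "rel y (corner \<rho>)" using gens_rel[OF y] by blast
      then show ?thesis by (auto simp: corners_def)
    qed
    with x have "\<exists>\<phi>\<in>zspan corners. rel x \<phi>" by (rule rel_generate)
    then obtain \<phi> where \<phi>: "\<phi> \<in> zspan corners" "rel x \<phi>" by (elim bexE)
    have \<phi>N: "int p dvd \<phi> s" if "s \<in> N" for s using inflation_iff[OF \<phi>(2)] inf that by blast
    note \<phi>' = zspan_corners[OF \<phi>(1)]
    \<comment> \<open>By the assumption on \<open>TU\<close> an element killed by all of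
      \<open>corners_N\<close> lies in the product of \<open>N\<close> and \<open>Z (Suc n)\<close>,
      and \<open>\<phi>\<close> vanishes on both factors.\<close>
    have sep: "int p dvd \<phi> s" if s: "s \<in> Z n" and van: "\<And>\<psi>. \<psi> \<in> corners_N \<Longrightarrow> int p dvd \<psi> s" for s
    proof -
      have sc: "s \<in> carrier S" using zs.zass_carrier[OF s] .
      have "q.pr s \<in> ZG (Suc n)" using TU_iff[OF s] van T by blast
      then obtain z where z: "z \<in> Z (Suc n)" "q.pr s = q.pr z" by (auto simp: ZG_eq)
      have zn: "z \<in> Z n" using z zs.zass_Suc by blast
      have zc: "z \<in> carrier S" using zs.zass_carrier[OF zn] .
      have y: "s \<otimes> inv z \<in> N" using q.pr_eq_iff[OF sc zc] z(2) by simp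
      then have "int p dvd \<phi> (s \<otimes> inv z) + \<phi> z + 0" using \<phi>N \<phi>'(3)[OF z(1)] by simp
      then have "int p dvd \<phi> ((s \<otimes> inv z) \<otimes> z) + 0"
        using mZ.additive_mult_iff[OF \<phi>'(2) _ zn, of "s \<otimes> inv z" 0] y N_Z by blast
      then show ?thesis using sc zc by (simp add: m_assoc)
    qed
    \<comment> \<open>The compact set where \<open>\<phi>\<close> is nonzero. Finitely many
      homomorphisms trivial on \<open>N\<close> already have nonzero corners throughout it, so the
      common kernel of these corners lies in that of \<open>\<phi>\<close> and duality
      applies.\<close>
    define D where "D = {s \<in> topspace T. \<phi> s \<in> {k. \<not> int p dvd k}} \<inter> Z n"
    have "closedin T D" unfolding D_def
      using \<phi>'(1) zs.zass_props(2) by (intro closedin_Int closedin_continuous_map_preimage) auto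
    then have D: "compactin T D" using compact_T by (rule closedin_compact_space[rotated])
    define H where "H = {\<rho> \<in> Hom. \<forall>x\<in>N. \<rho> x = \<one>\<^bsub>UU\<^esub>}"
    define O' where "O' = (\<lambda>\<rho> :: 'a \<Rightarrow> nat \<Rightarrow> nat \<Rightarrow> int. {x \<in> topspace T. \<rho> x \<in> carrier UU - {\<one>\<^bsub>UU\<^esub>}})"
    have open': "openin T (O' \<rho>)" if "\<rho> \<in> H" for \<rho>
      unfolding O'_def using that cont_hom_finD(2)[of \<rho> S T UU] by (intro openin_continuous_map_preimage) (auto simp: H_def)
    have "D \<subseteq> \<Union>(O' ` H)"
    proof
      fix s assume s: "s \<in> D"
      then have sn: "s \<in> Z n" "\<not> int p dvd \<phi> s" by (auto simp: D_def)
      then obtain \<psi> where "\<psi> \<in> corners_N" "\<not> int p dvd \<psi> s" using sep by blast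
      then obtain \<rho> where \<rho>: "\<rho> \<in> H" "\<not> int p dvd corner \<rho> s" by (auto simp: corners_N_def H_def)
      then have "\<rho> s \<noteq> \<one>\<^bsub>UU\<^esub>" "\<rho> s \<in> carrier UU"
        using corner_dvd_iff[OF _ sn(1)] Hom_carrier zs.zass_carrier[OF sn(1)] by (auto simp: H_def)
      then show "s \<in> \<Union>(O' ` H)" using \<rho>(1) zs.zass_carrier[OF sn(1)] by (auto simp: O'_def topspace_T)
    qed
    then obtain \<F> where \<F>: "finite \<F>" "\<F> \<subseteq> O' ` H" "D \<subseteq> \<Union>\<F>"
      using compactinD[OF D, of "O' ` H"] open' by blast
    then obtain R where R: "finite R" "R \<subseteq> H" "\<F> = O' ` R" using finite_subset_image by metis
    have R_corners: "corner ` R \<subseteq> corners_N" using R(2) by (auto simp: corners_N_def H_def)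
    have "\<exists>\<phi>'\<in>zspan (corner ` R). \<forall>s\<in>Z n. int p dvd \<phi> s - \<phi>' s"
    proof (rule mZ.span_if_kernels[OF _ _ \<phi>'(2)])
      show "finite (corner ` R)" using R(1) by simp
      show "mZ.additive \<psi>" if "\<psi> \<in> corner ` R" for \<psi> using that R(2) corner_additive by (auto simp: H_def)
      fix s assume s: "s \<in> Z n" and van: "\<And>\<psi>. \<psi> \<in> corner ` R \<Longrightarrow> int p dvd \<psi> s"
      show "int p dvd \<phi> s"
      proof (rule ccontr)
        assume "\<not> int p dvd \<phi> s"
        then have "s \<in> D" using s zs.zass_carrier[OF s] by (simp add: D_def topspace_T)
        then obtain \<rho> where \<rho>: "\<rho> \<in> R" "s \<in> O' \<rho>" using \<F>(3) R(3) by blast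
        then have "\<rho> \<in> Hom" "\<rho> s \<noteq> \<one>\<^bsub>UU\<^esub>" using R(2) by (auto simp: H_def O'_def)
        then show False using van[of "corner \<rho>"] \<rho>(1) corner_dvd_iff[OF _ s] by blast
      qed
    qed
    then obtain \<phi>1 where \<phi>1: "\<phi>1 \<in> zspan (corner ` R)" "\<And>s. s \<in> Z n \<Longrightarrow> int p dvd \<phi> s - \<phi>1 s" by blast
    have "\<exists>y\<in>generate ck.HH {x \<in> gens. inflation x = \<one>\<^bsub>cg.HH\<^esub>}. rel y \<phi>1"
    proof (rule rel_zspan[OF _ rel_gens_N])
      show "\<phi>1 \<in> zspan corners_N" using \<phi>1(1) zspan_mono[OF R_corners] by (rule subsetD[rotated])
      show "{x \<in> gens. inflation x = \<one>\<^bsub>cg.HH\<^esub>} \<subseteq> carrier ck.HH" using inflation_gens gens_carrier by (rule subset_trans)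
    qed
    then obtain y where y: "y \<in> generate ck.HH {x \<in> gens. inflation x = \<one>\<^bsub>cg.HH\<^esub>}" "rel y \<phi>1" by (elim bexE)
    \<comment> \<open>Here injectivity of the transgression carries the identity of functionals back
      to the classes.\<close>
    have "x = y" by (rule rel_inj[OF rel_cong[OF \<phi>(2) \<phi>1(2)] y(2)])
    then show ?thesis using y(1) by simp
  qed
  then show "massey_kernel_gen p n GG TG" unfolding massey_kernel_gen_iff
    using generate_gens_N_kernel by blast
qed

end

theorem theorem9p3:
  fixes S :: "'a monoid" and T :: "'a topology" and B :: "'b set" and emb :: "'b \<Rightarrow> 'a"
    and N :: "'a set" and p n :: nat
  assumes "Factorial_Ring.prime p" and "2 \<le> n"
    and "free_profinite S T B emb"
    and "N \<lhd> S" and "closedin T N" and "N \<subseteq> zass S T p n"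
  shows "TU (S Mod N) (quot_top S T N) (unip p (n - 1)) = zass (S Mod N) (quot_top S T N) p n
    \<and> (TU (S Mod N) (quot_top S T N) (unip p n) = zass (S Mod N) (quot_top S T N) p (n + 1)
         \<longleftrightarrow> massey_kernel_gen p n (S Mod N) (quot_top S T N))"
proof -
  have top: "topgroup S T" using assms(3) by (simp add: free_profinite_def profinite_def)
  then have "group S" by (simp add: topgroup_def)
  then interpret massey_setup S T B emb p N n
    using assms top
    by (intro massey_setup.intro free_pro_prime.intro free_pro.intro topological_group.intro
        topological_group_axioms.intro free_pro_axioms.intro free_pro_prime_axioms.intro massey_setup_axioms.intro)
  show ?thesis using TU_quotient massey_iff by simp
qed

end
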